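(* Let $d\ge 1$, $\varepsilon>0$, $\lambda\in\mathbb{R}$, $h>0$, $\mathcal{A}=\frac1\varepsilon\Delta$, and consider the nonlinear Schrödinger equation $\mathrm{i}u_t=-\frac1\varepsilon\Delta u+\lambda|u|^2u$ on $[-\pi,\pi]^d$ with periodic boundary conditions and initial value $u^0$. Consider a continuous-stage exponential time integrator $$u^{n+\tau}=C_\tau(\mathcal{V})u^n+h\int_0^1A_{\tau,\sigma}(\mathcal{V})f(u^{n+\sigma})\,d\sigma,\qquad 0\le\tau\le1,\ n=0,1,\ldots,$$ with $\mathcal{V}=\mathrm{i}h\mathcal{A}$ and $f(u)=-\mathrm{i}\lambda|u|^2u$, as described in the context. Let $$\mathcal{M}=\begin{pmatrix}\mathcal{A}&0\\0&\mathcal{A}\end{pmatrix},\qquad J=\begin{pmatrix}0&-1\\1&0\end{pmatrix},\qquad \mathcal{K}=hJ\mathcal{M}.$$ If the coefficients satisfy, for all $\tau,\sigma\in[0,1]$, $$\begin{aligned}&A_{0,\sigma}(\mathcal{K})=\mathbf{0},\\ &(e^{\mathcal{K}})^{\intercal}\mathcal{M}A_{1,\tau}(\mathcal{K})\mathcal{K}+(C'_\tau(\mathcal{K}))^{\intercal}\mathcal{M}=\mathbf{0},\\ &\mathcal{K}^{\intercal}(A_{1,\tau}(\mathcal{K}))^{\intercal}\mathcal{M}A_{1,\sigma}(\mathcal{K})\mathcal{K}+\mathcal{M}A'_{\tau,\sigma}(\mathcal{K})\mathcal{K}+(\mathcal{M}A'_{\sigma,\tau}(\mathcal{K})\mathcal{K})^{\intercal}=\mathbf{0},\end{aligned}$$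 where $C'_\tau(\mathcal{K})=\frac{d}{d\tau}C_\tau(\mathcal{K})$ and $A'_{\tau,\sigma}(\mathcal{K})=\frac{\partial}{\partial\tau}A_{\tau,\sigma}(\mathcal{K})$ (so $A'_{\sigma,\tau}$ is the derivative with respect to the first index evaluated at $(\sigma,\tau)$), then the integrator exactly preserves the energy $$H[u,\bar u]=\frac{1}{2(2\pi)^d}\int_{[-\pi,\pi]^d}\Big(\frac1\varepsilon|\nabla u|^2+\frac12\lambda|u|^4\Big)dx,$$ i.e. $H[u^{n+1},\bar u^{n+1}]=H[u^n,\bar u^n]$ for $n=0,1,\ldots$.
   Context: Continuous-stage exponential time integrator: $C_\tau(\cdot)$ and $A_{\tau,\sigma}(\cdot)$, $\tau,\sigma\in[0,1]$, are bounded operator-argument functions (scalar functions evaluated at the operator $\mathcal{V}=\mathrm{i}h\mathcal{A}$ by functional calculus), and $C_\tau$ is required to satisfy $C_{c_j}(\mathcal{V})=e^{c_j\mathcal{V}}$ for $j=0,\ldots,s$, with fitting nodes $c_j$, $s\ge1$, $c_0=0$, $c_s=1$. Given $u^n$, the family $(u^{n+\tau})_{0\le\tau\le1}$ is determined by the (implicit) displayed equation, and the numerical solution after one time step $h$ is $u^{n+1}$, obtained by setting $\tau=1$. Real form: writing $u=p+\mathrm{i}q$ and $y=(p,q)^{\intercal}$, multiplication by $\mathrm{i}\mathcal{A}$ becomes $J\mathcal{M}$, and the scheme becomes $y^{n+\tau}=C_\tau(\mathcal{K})y^n+h\int_0^1A_{\tau,\sigma}(\mathcal{K})g(y^{n+\sigma})\,d\sigma$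 with $g(y)=J\nabla_yU(y)$, $U(y)=-\frac\lambda4(p^2+q^2)^2$; $C_\tau(\mathcal{K})$, $A_{\tau,\sigma}(\mathcal{K})$ are the same coefficient functions evaluated at $\mathcal{K}$. The superscript $\intercal$ denotes the transpose (adjoint with respect to the real $L^2$ inner product on $[-\pi,\pi]^d$).
   Formalization: Added, since conditions 2 and 3 are void on constants (the claim fails there): C'_τ(K)=0 and A'_{τ,σ}(K)=A'_{σ,τ}(K)^T on ker M. Stages are taken C¹ in x and τ with summable Fourier coefficients; C, A uniformly bounded on the spectrum, C', A' continuous. *)

theory Defs
  imports "HOL-Analysis.Analysis"
begin

text \<open>
  Functions on the torus are functions on \<open>real ^ 'd\<close> that are \<open>2 * pi\<close>-periodic in every
  coordinate; \<open>d = CARD('d)\<close>.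
\<close>

definition torus_cube :: "(real ^ 'd) set" where
  "torus_cube = cbox (\<chi> i. - pi) (\<chi> i. pi)"

definition periodic :: "(real ^ 'd \<Rightarrow> 'a) \<Rightarrow> bool" where
  "periodic u \<longleftrightarrow> (\<forall>x i. u (x + (2 * pi) *\<^sub>R axis i 1) = u x)"

definition partial :: "'d \<Rightarrow> (real ^ 'd \<Rightarrow> 'a::real_normed_vector) \<Rightarrow> real ^ 'd \<Rightarrow> 'a" where
  "partial i u x = vector_derivative (\<lambda>t. u (x + t *\<^sub>R axis i 1)) (at 0)"

definition laplacian :: "(real ^ 'd \<Rightarrow> 'a::real_normed_vector) \<Rightarrow> real ^ 'd \<Rightarrow> 'a" where
  "laplacian u x = (\<Sum>i\<in>UNIV. partial i (partial i u) x)"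

definition C1_fun :: "(real ^ 'd \<Rightarrow> 'a::real_normed_vector) \<Rightarrow> bool" where
  "C1_fun u \<longleftrightarrow> continuous_on UNIV u \<and>
     (\<forall>i. (\<forall>x. (\<lambda>t. u (x + t *\<^sub>R axis i 1)) differentiable (at 0)) \<and>
          continuous_on UNIV (partial i u))"

definition fmode :: "int ^ 'd \<Rightarrow> real ^ 'd \<Rightarrow> complex" where
  "fmode k x = cis (\<Sum>i\<in>UNIV. of_int (k $ i) * x $ i)"

definition fcoeff :: "(real ^ 'd \<Rightarrow> complex) \<Rightarrow> int ^ 'd \<Rightarrow> complex" where
  "fcoeff u k =
     integral torus_cube (\<lambda>x. u x * cnj (fmode k x)) / of_real ((2 * pi) ^ CARD('d))"

definition trig_polys :: "(real ^ 'd \<Rightarrow> complex) set" where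
  "trig_polys = {u. \<exists>F c. finite F \<and> u = (\<lambda>x. \<Sum>k\<in>F. c k * fmode k x)}"

text \<open>
  The operators below are diagonal in the orthogonal basis \<open>fmode k\<close>, so the functional
  calculus applies the scalar function to the eigenvalues.  The series is an absolutely
  convergent one when \<open>\<phi>\<close> is bounded on the eigenvalues and \<open>u\<close> has absolutely summable
  Fourier coefficients, and a finite sum for trigonometric polynomials \<open>u\<close>.
\<close>

definition mode_eigval ::
  "((real ^ 'd \<Rightarrow> complex) \<Rightarrow> real ^ 'd \<Rightarrow> complex) \<Rightarrow> int ^ 'd \<Rightarrow> complex" where
  "mode_eigval T k = (THE \<mu>. \<forall>x. T (fmode k) x = \<mu> * fmode k x)"

definition fun_calc ::
  "((real ^ 'd \<Rightarrow> complex) \<Rightarrow> real ^ 'd \<Rightarrow> complex) \<Rightarrow> (complex \<Rightarrow> complex) \<Rightarrow>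
   (real ^ 'd \<Rightarrow> complex) \<Rightarrow> real ^ 'd \<Rightarrow> complex" where
  "fun_calc T \<phi> u x = (\<Sum>\<^sub>\<infinity>k. \<phi> (mode_eigval T k) * fcoeff u k * fmode k x)"

definition to_complex :: "(real ^ 'd \<Rightarrow> real \<times> real) \<Rightarrow> real ^ 'd \<Rightarrow> complex" where
  "to_complex y x = Complex (fst (y x)) (snd (y x))"

definition to_real :: "(real ^ 'd \<Rightarrow> complex) \<Rightarrow> real ^ 'd \<Rightarrow> real \<times> real" where
  "to_real u x = (Re (u x), Im (u x))"

text \<open>
  For an operator \<open>T\<close> on real pairs that commutes with \<open>J\<close>, the operator \<open>\<phi>(T)\<close> is the real form
  of \<open>\<phi>\<close> evaluated at the complex-linear operator corresponding to \<open>T\<close>.  If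
  \<open>\<phi> (cnj z) = cnj (\<phi> z)\<close>, this is the usual functional calculus of the real operator \<open>T\<close>.
\<close>

definition fun_calc_real ::
  "((real ^ 'd \<Rightarrow> real \<times> real) \<Rightarrow> real ^ 'd \<Rightarrow> real \<times> real) \<Rightarrow> (complex \<Rightarrow> complex) \<Rightarrow>
   (real ^ 'd \<Rightarrow> real \<times> real) \<Rightarrow> real ^ 'd \<Rightarrow> real \<times> real" where
  "fun_calc_real T \<phi> y = to_real (fun_calc (\<lambda>w. to_complex (T (to_real w))) \<phi> (to_complex y))"

definition real_trig_polys :: "(real ^ 'd \<Rightarrow> real \<times> real) set" where
  "real_trig_polys = {y. to_complex y \<in> trig_polys}"

text \<open>
  The real trigonometric polynomials are a core, invariant under all operators involved (bounded
  or not), on which the real \<open>L\<^sup>2\<close> adjoint is unambiguous.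
\<close>

definition L2_inner ::
  "(real ^ 'd \<Rightarrow> real \<times> real) \<Rightarrow> (real ^ 'd \<Rightarrow> real \<times> real) \<Rightarrow> real" where
  "L2_inner y w = integral torus_cube (\<lambda>x. y x \<bullet> w x)"

definition L2_adjoint ::
  "((real ^ 'd \<Rightarrow> real \<times> real) \<Rightarrow> real ^ 'd \<Rightarrow> real \<times> real) \<Rightarrow>
   (real ^ 'd \<Rightarrow> real \<times> real) \<Rightarrow> real ^ 'd \<Rightarrow> real \<times> real" where
  "L2_adjoint T w =
     (THE z. z \<in> real_trig_polys \<and> (\<forall>y\<in>real_trig_polys. L2_inner (T y) w = L2_inner y z))"

definition op_A :: "real \<Rightarrow> (real ^ 'd \<Rightarrow> 'a::real_normed_vector) \<Rightarrow> real ^ 'd \<Rightarrow> 'a" where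
  "op_A \<epsilon> u x = (1 / \<epsilon>) *\<^sub>R laplacian u x"

definition op_V :: "real \<Rightarrow> real \<Rightarrow> (real ^ 'd \<Rightarrow> complex) \<Rightarrow> real ^ 'd \<Rightarrow> complex" where
  "op_V \<epsilon> h u x = \<i> * of_real h * op_A \<epsilon> u x"

definition nls_f :: "real \<Rightarrow> complex \<Rightarrow> complex" where
  "nls_f lam w = - \<i> * of_real lam * of_real ((cmod w)\<^sup>2) * w"

definition op_M :: "real \<Rightarrow> (real ^ 'd \<Rightarrow> real \<times> real) \<Rightarrow> real ^ 'd \<Rightarrow> real \<times> real" where
  "op_M \<epsilon> y x = (op_A \<epsilon> (\<lambda>x. fst (y x)) x, op_A \<epsilon> (\<lambda>x. snd (y x)) x)"

definition op_J :: "(real ^ 'd \<Rightarrow> real \<times> real) \<Rightarrow> real ^ 'd \<Rightarrow> real \<times> real" where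
  "op_J y x = (- snd (y x), fst (y x))"

definition op_K :: "real \<Rightarrow> real \<Rightarrow> (real ^ 'd \<Rightarrow> real \<times> real) \<Rightarrow> real ^ 'd \<Rightarrow> real \<times> real" where
  "op_K \<epsilon> h y x = h *\<^sub>R op_J (op_M \<epsilon> y) x"

definition energy :: "real \<Rightarrow> real \<Rightarrow> (real ^ 'd \<Rightarrow> complex) \<Rightarrow> real" where
  "energy \<epsilon> lam u =
     1 / (2 * (2 * pi) ^ CARD('d)) *
       integral torus_cube (\<lambda>x. 1 / \<epsilon> * (\<Sum>i\<in>UNIV. (cmod (partial i u x))\<^sup>2)
                                + 1 / 2 * lam * (cmod (u x)) ^ 4)"

text \<open>
  Regularity of the stages \<open>w \<tau> = u\<^sup>n\<^sup>+\<^sup>\<tau>\<close> of one time step: in space they are \<open>C\<^sup>1\<close>, with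
  Fourier coefficients absolutely summable uniformly in \<open>\<tau>\<close> (so that the defining equation of
  the integrator can be read pointwise); in \<open>\<tau>\<close> they are \<open>C\<^sup>1\<close>.
\<close>

definition regular_stages :: "(real \<Rightarrow> real ^ 'd \<Rightarrow> complex) \<Rightarrow> bool" where
  "regular_stages w \<longleftrightarrow>
     (\<forall>\<tau>\<in>{0..1}. periodic (w \<tau>) \<and> C1_fun (w \<tau>)) \<and>
     (\<exists>S. \<forall>\<tau>\<in>{0..1}. (\<lambda>k. cmod (fcoeff (w \<tau>) k)) summable_on UNIV \<and>
                      (\<Sum>\<^sub>\<infinity>k. cmod (fcoeff (w \<tau>) k)) \<le> S) \<and>
     (\<exists>w'. continuous_on ({0..1} \<times> UNIV) (\<lambda>(\<tau>, x). w' \<tau> x) \<and>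
           (\<forall>\<tau>\<in>{0..1}. \<forall>x. ((\<lambda>\<tau>. w \<tau> x) has_vector_derivative w' \<tau> x) (at \<tau> within {0..1})))"

lemma fmode_shift: "fmode k (x + t *\<^sub>R axis i 1) = fmode k x * cis (of_int (k $ i) * t)"
proof -
  have "(\<Sum>j\<in>UNIV. of_int (k $ j) * (x + t *\<^sub>R axis i 1) $ j)
      = (\<Sum>j\<in>UNIV. of_int (k $ j) * x $ j + (if j = i then of_int (k $ i) * t else 0))"
    by (intro sum.cong) (auto simp: axis_def algebra_simps)
  also have "\<dots> = (\<Sum>j\<in>UNIV. of_int (k $ j) * x $ j) + of_int (k $ i) * t"
    by (simp add: sum.distrib)
  finally show ?thesis
    by (simp add: fmode_def cis_mult)
qed

lemma fmode_nonzero: "fmode k x \<noteq> 0"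
  by (simp add: fmode_def)

lemma has_vector_derivative_fmode:
  "((\<lambda>t. a * fmode k (x + t *\<^sub>R axis i 1)) has_vector_derivative
     a * (\<i> * of_int (k $ i)) * fmode k x) (at 0)"
proof -
  have "((\<lambda>t. a * fmode k x * exp (\<i> * of_real (of_int (k $ i) * t))) has_vector_derivative
     a * fmode k x * (\<i> * of_int (k $ i))) (at 0)"
    by (auto intro!: derivative_eq_intros has_vector_derivative_real_field)
  then show ?thesis
    by (simp add: fmode_shift cis_conv_exp algebra_simps)
qed

lemma partial_fmode: "partial i (\<lambda>x. a * fmode k x) = (\<lambda>x. a * (\<i> * of_int (k $ i)) * fmode k x)"
  unfolding partial_def
  by (intro ext vector_derivative_at has_vector_derivative_fmode)

lemma partial_Re_fmode:
  "partial i (\<lambda>x. Re (a * fmode k x)) = (\<lambda>x. Re (a * (\<i> * of_int (k $ i)) * fmode k x))"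
  unfolding partial_def
  by (intro ext vector_derivative_at
      bounded_linear.has_vector_derivative[OF bounded_linear_Re] has_vector_derivative_fmode)

lemma partial_Im_fmode:
  "partial i (\<lambda>x. Im (a * fmode k x)) = (\<lambda>x. Im (a * (\<i> * of_int (k $ i)) * fmode k x))"
  unfolding partial_def
  by (intro ext vector_derivative_at
      bounded_linear.has_vector_derivative[OF bounded_linear_Im] has_vector_derivative_fmode)

lemma partial_partial_fmode:
  shows "partial i (partial i (fmode k)) x = - (of_int (k $ i))\<^sup>2 * fmode k x"
    and "partial i (partial i (\<lambda>x. Re (fmode k x))) x = Re (- (of_int (k $ i))\<^sup>2 * fmode k x)"
    and "partial i (partial i (\<lambda>x. Im (fmode k x))) x = Im (- (of_int (k $ i))\<^sup>2 * fmode k x)"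
proof -
  have eq: "\<i> * of_int (k $ i) * (\<i> * of_int (k $ i)) = - (of_int (k $ i))\<^sup>2"
    by (simp add: power2_eq_square algebra_simps)
  have 1: "partial i (fmode k) = (\<lambda>x. \<i> * of_int (k $ i) * fmode k x)"
    using partial_fmode[of i 1 k] by simp
  have 2: "partial i (\<lambda>x. Re (fmode k x)) = (\<lambda>x. Re (\<i> * of_int (k $ i) * fmode k x))"
    using partial_Re_fmode[of i 1 k] by (simp only: mult_1_left)
  have 3: "partial i (\<lambda>x. Im (fmode k x)) = (\<lambda>x. Im (\<i> * of_int (k $ i) * fmode k x))"
    using partial_Im_fmode[of i 1 k] by (simp only: mult_1_left)
  show "partial i (partial i (fmode k)) x = - (of_int (k $ i))\<^sup>2 * fmode k x"
    by (simp only: 1 partial_fmode eq)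
  show "partial i (partial i (\<lambda>x. Re (fmode k x))) x = Re (- (of_int (k $ i))\<^sup>2 * fmode k x)"
    by (simp only: 2 partial_Re_fmode eq)
  show "partial i (partial i (\<lambda>x. Im (fmode k x))) x = Im (- (of_int (k $ i))\<^sup>2 * fmode k x)"
    by (simp only: 3 partial_Im_fmode eq)
qed

lemma op_V_fmode:
  "op_V \<epsilon> h (fmode k) x
     = - \<i> * of_real (h * (\<Sum>i\<in>UNIV. (of_int (k $ i))\<^sup>2) / \<epsilon>) * fmode k x"
proof -
  have "laplacian (fmode k) x = - of_real (\<Sum>i\<in>UNIV. (of_int (k $ i))\<^sup>2) * fmode k x"
    unfolding laplacian_def partial_partial_fmode
    by (simp add: sum_distrib_right sum_negf)
  then show ?thesis
    by (simp add: op_V_def op_A_def scaleR_conv_of_real)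
qed

lemma op_K_fmode: "to_complex (op_K \<epsilon> h (to_real (fmode k))) x = op_V \<epsilon> h (fmode k) x"
proof -
  have Re: "laplacian (\<lambda>x. Re (fmode k x)) x = Re (laplacian (fmode k) x)"
    and Im: "laplacian (\<lambda>x. Im (fmode k x)) x = Im (laplacian (fmode k) x)"
    unfolding laplacian_def partial_partial_fmode Re_sum Im_sum by (rule refl)+
  show ?thesis
    by (simp add: to_complex_def to_real_def op_K_def op_J_def op_M_def op_V_def op_A_def
        Re Im complex_eq_iff)
qed

lemma mode_eigval_op_V:
  "mode_eigval (op_V \<epsilon> h) k = - \<i> * of_real (h * (\<Sum>i\<in>UNIV. (of_int (k $ i))\<^sup>2) / \<epsilon>)"
  unfolding mode_eigval_def op_V_fmode
  by (rule the_equality) (simp, metis fmode_nonzero mult_right_cancel)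

lemma mode_eigval_op_K:
  "mode_eigval (\<lambda>w. to_complex (op_K \<epsilon> h (to_real w))) k = mode_eigval (op_V \<epsilon> h) k"
  unfolding mode_eigval_def op_K_fmode ..

end

theory Submission
  imports Defs
begin

text \<open>
  In Fourier space every operator is a multiplier, and the scheme becomes, for each mode \<open>k\<close> with
  \<open>\<mu> = - \<i> h \<alpha>\<close>, \<open>\<alpha> = |k|\<^sup>2 / \<epsilon>\<close>,
  \<open>w\<^sub>k(\<tau>) = C\<^sub>\<tau>(\<mu>) w\<^sub>k(0) + h \<integral> A\<^sub>\<tau>\<^sub>\<sigma>(\<mu>) F\<^sub>k(\<sigma>) d\<sigma>\<close>, where \<open>F\<^sub>k\<close> are the Fourier
  coefficients of the nonlinearity.  The energy conditions turn into the scalar identities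
  \<open>C'\<^sub>\<tau> = exp \<mu> cnj(A\<^sub>1\<^sub>\<tau>) \<mu>\<close> and \<open>A'\<^sub>\<tau>\<^sub>\<sigma> - cnj(A'\<^sub>\<sigma>\<^sub>\<tau>) = \<mu> cnj(A\<^sub>1\<^sub>\<tau>) A\<^sub>1\<^sub>\<sigma>\<close>.
  By Parseval the time derivative of the potential energy is the sum over \<open>k\<close> of
  \<open>Re (w'\<^sub>k cnj(\<i> F\<^sub>k))\<close>; by these identities the integral over \<open>[0,1]\<close> of each summand cancels
  the increment \<open>\<alpha>/2 (|w\<^sub>k(1)|\<^sup>2 - |w\<^sub>k(0)|\<^sup>2)\<close> of the kinetic energy of that mode, the double
  integral being symmetrised in \<open>(\<tau>, \<sigma>)\<close>.
\<close>

section \<open>Integration over the torus\<close>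

text \<open>The total energy is not differentiated in \<tau>: the stages are only C^1 in space and
  \<open>w'\<close> is merely continuous there, so their regularity gives no control of the
  \<tau>-derivative of the gradient. Only the quartic part is differentiated. The kinetic increment
  of each mode is read off from the endpoint values of its coefficient, and the sum over the modes
  is taken after the integration in \<tau>. This interchange is justified by Bessel's inequality for
  \<open>w'\<close> and for the nonlinearity, which bounds the absolute sum of the mode
  contributions uniformly in \<tau>.

  The scheme is an identity at each point x. Passing to coefficients requires both terms on its
  right to be absolutely convergent Fourier series, with bounds uniform in \<sigma>. Hence the
  nonlinearity must inherit absolutely summable coefficients from the stages, which is the algebra
  property of the Wiener space.

  The operator M annihilates the constant mode. At k = 0 it cannot be cancelled from the energy
  conditions, and there the two scalar identities come from the hypotheses on the kernel of
  M.\<close>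

lemma filterlim_to_nat_less:
  "filterlim (\<lambda>N. {k::'k::countable. to_nat k < N}) (finite_subsets_at_top UNIV) sequentially"
  unfolding filterlim_finite_subsets_at_top
proof (intro allI impI, elim conjE)
  fix X :: "'k set" assume X: "finite X"
  have fin: "finite {k::'k. to_nat k < N}" for N
    by (rule finite_imageD[of to_nat]) (auto intro: finite_subset[of _ "{..<N}"])
  have "X \<subseteq> {k. to_nat k < N}" if "N > Max (to_nat ` X)" for N
    using X that by (auto simp: Max_less_iff dest: le_less_trans[rotated, OF _ Max_ge[OF finite_imageI[OF X]]])
  then show "\<forall>\<^sub>F N in sequentially. finite {k::'k. to_nat k < N} \<and> X \<subseteq> {k. to_nat k < N} \<and> {k. to_nat k < N} \<subseteq> UNIV"
    using fin by (auto intro: eventually_mono[OF eventually_gt_at_top])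
qed

lemma abs_summable_onI:
  assumes "\<And>F. finite F \<Longrightarrow> (\<Sum>k\<in>F. norm (f k)) \<le> (B::real)"
  shows "(\<lambda>k. norm (f k)) summable_on UNIV"
  unfolding abs_summable_iff_bdd_above using assms by (auto intro!: bdd_aboveI2)

text \<open>Dominated convergence for a countable series on a box: the uniform bound
  \<open>B\<close> on the absolute partial sums is a constant, hence integrable, majorant. It serves
  both for integrals over the torus and for integrals over the stage parameter.\<close>

lemma infsum_integral:
  fixes f :: "'k::countable \<Rightarrow> 'a::euclidean_space \<Rightarrow> 'b::euclidean_space"
  assumes cont: "\<And>k. continuous_on (cbox a b) (f k)"
    and bound: "\<And>x F. x \<in> cbox a b \<Longrightarrow> finite F \<Longrightarrow> (\<Sum>k\<in>F. norm (f k x)) \<le> B"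
  shows "(\<lambda>x. \<Sum>\<^sub>\<infinity>k. f k x) integrable_on cbox a b"
    and "(\<Sum>k\<in>F. norm (integral (cbox a b) (f k))) \<le> B * measure lborel (cbox a b)"
    and "((\<lambda>k. integral (cbox a b) (f k)) has_sum integral (cbox a b) (\<lambda>x. \<Sum>\<^sub>\<infinity>k. f k x)) UNIV"
proof -
  \<comment> \<open>Infinite sums are limits along the net of finite subsets, whereas dominated
    convergence speaks of sequences. The sets \<open>E N\<close> are finite and eventually contain
    every given finite set, so the limit may be taken along them.\<close>
  define E where "E N = {k::'k. to_nat k < N}" for N
  have E: "filterlim E (finite_subsets_at_top UNIV) sequentially"
    unfolding E_def by (rule filterlim_to_nat_less)
  have fin: "finite (E N)" for N unfolding E_def
    by (rule finite_imageD[of to_nat]) (auto intro: finite_subset[of _ "{..<N}"])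
  have int: "f k integrable_on cbox a b" for k
    by (rule integrable_continuous[OF cont])
  have nint: "(\<lambda>x. norm (f k x)) integrable_on cbox a b" for k
    by (intro integrable_continuous continuous_on_norm cont)
  have lim: "(\<lambda>N. \<Sum>k\<in>E N. f k x) \<longlonglongrightarrow> (\<Sum>\<^sub>\<infinity>k. f k x)" if "x \<in> cbox a b" for x
  proof -
    have "(\<lambda>k. f k x) summable_on UNIV"
      by (rule abs_summable_summable, rule abs_summable_onI[OF bound[OF that]])
    from filterlim_compose[OF infsum_tendsto[OF this] E] show ?thesis by simp
  qed
  have bd: "norm (\<Sum>k\<in>E N. f k x) \<le> B" if "x \<in> cbox a b" for x N
    using norm_sum[of "\<lambda>k. f k x" "E N"] bound[OF that fin, of N] by linarith
  note dc = dominated_convergence[where S = "cbox a b" and f = "\<lambda>N x. \<Sum>k\<in>E N. f k x" and h = "\<lambda>_. B",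
      OF integrable_sum[OF fin int] integrable_const bd lim]
  show "(\<lambda>x. \<Sum>\<^sub>\<infinity>k. f k x) integrable_on cbox a b"
    by (rule dc(1))
  show le: "(\<Sum>k\<in>F. norm (integral (cbox a b) (f k))) \<le> B * measure lborel (cbox a b)" for F
  proof (cases "finite F")
    case F: True
    have "(\<Sum>k\<in>F. norm (integral (cbox a b) (f k))) \<le> (\<Sum>k\<in>F. integral (cbox a b) (\<lambda>x. norm (f k x)))"
      by (intro sum_mono integral_norm_bound_integral int nint) auto
    also have "\<dots> = integral (cbox a b) (\<lambda>x. \<Sum>k\<in>F. norm (f k x))"
      by (rule integral_sum[symmetric, OF F nint])
    also have "\<dots> \<le> integral (cbox a b) (\<lambda>x. B)"
      by (intro integral_le integrable_sum F nint integrable_const bound)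
    finally show ?thesis by (simp add: mult.commute)
  next
    case False
    \<comment> \<open>A sum over an infinite set is 0 by convention, so only the sign of the bound
      matters. If the box has a point, the hypothesis at the empty set gives 0 \<le> B; an empty box
      has measure 0.\<close>
    have "0 \<le> B * measure lborel (cbox a b)"
    proof (cases "cbox a b = {}")
      case False
      then obtain x where "x \<in> cbox a b" by auto
      from bound[OF this, of "{}"] show ?thesis by simp
    qed simp
    then show ?thesis using False by simp
  qed
  have "(\<lambda>k. integral (cbox a b) (f k)) summable_on UNIV"
    by (rule abs_summable_summable, rule abs_summable_onI[OF le])
  then have s: "((\<lambda>k. integral (cbox a b) (f k)) has_sum (\<Sum>\<^sub>\<infinity>k. integral (cbox a b) (f k))) UNIV"
    by simp
  have "(\<lambda>N. \<Sum>k\<in>E N. integral (cbox a b) (f k)) \<longlonglongrightarrow> (\<Sum>\<^sub>\<infinity>k. integral (cbox a b) (f k))"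
    using filterlim_compose[OF s[unfolded has_sum_def] E] by simp
  moreover have "(\<lambda>N. \<Sum>k\<in>E N. integral (cbox a b) (f k)) \<longlonglongrightarrow> integral (cbox a b) (\<lambda>x. \<Sum>\<^sub>\<infinity>k. f k x)"
    using dc(2) by (simp add: integral_sum[OF fin int])
  ultimately show "((\<lambda>k. integral (cbox a b) (f k)) has_sum integral (cbox a b) (\<lambda>x. \<Sum>\<^sub>\<infinity>k. f k x)) UNIV"
    using s LIMSEQ_unique by metis
qed

section \<open>The periodicity cube and the Fourier modes\<close>

lemma mem_torus_cube: "x \<in> torus_cube \<longleftrightarrow> (\<forall>i. \<bar>x $ i\<bar> \<le> pi)"
  by (auto simp: torus_cube_def mem_box_cart abs_le_iff minus_le_iff)

lemma compact_torus_cube: "compact torus_cube"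
  by (simp add: torus_cube_def)

lemma continuous_on_fmode [continuous_intros]:
  "continuous_on S f \<Longrightarrow> continuous_on S (\<lambda>x. fmode k (f x))"
  unfolding fmode_def by (intro continuous_intros)

lemma periodic_fmode: "periodic (fmode k :: real ^ 'd \<Rightarrow> complex)"
  unfolding periodic_def fmode_shift
proof (intro allI)
  fix x :: "real ^ 'd" and i
  have "cis (real_of_int (k $ i) * (2 * pi)) = 1"
    using cis_multiple_2pi[of "real_of_int (k $ i)"] by (simp add: mult_ac)
  then show "fmode k x * cis (real_of_int (k $ i) * (2 * pi)) = fmode k x" by simp
qed

lemma cmod_fmode [simp]: "cmod (fmode k x) = 1"
  by (simp add: fmode_def)

lemma fmode_0 [simp]: "fmode 0 x = 1"
  by (simp add: fmode_def)

lemma fmode_0_fun: "fmode 0 = (\<lambda>x. 1)"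
  by (simp add: fun_eq_iff)

lemma fmode_mult: "fmode k x * fmode l x = fmode (k + l) x"
  by (simp add: fmode_def cis_mult sum.distrib algebra_simps)

lemma cnj_fmode: "cnj (fmode k x) = fmode (- k) x"
  by (simp add: fmode_def cis_cnj sum_negf)

text \<open>Cut the shifted cube at the hyperplane where coordinate i equals pi. The slab beyond it,
  moved back by one period, fills exactly the slab that the shift has uncovered in the original
  cube. The range of \<open>t\<close> keeps the cutting hyperplanes inside the cubes.\<close>

lemma integral_torus_shift:
  fixes g :: "real ^ 'd \<Rightarrow> 'b::banach"
  assumes g: "continuous_on UNIV g" and p: "periodic g" and t: "0 \<le> t" "t \<le> 2 * pi"
  shows "integral torus_cube (\<lambda>x. g (x + t *\<^sub>R axis i 1)) = integral torus_cube g"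
proof -
  define e :: "real ^ 'd" where "e = axis i 1"
  define a :: "real ^ 'd" where "a = (\<chi> i. - pi)"
  define b :: "real ^ 'd" where "b = (\<chi> i. pi)"
  have e: "e \<in> Basis" by (simp add: e_def axis_in_Basis_iff)
  have xe: "x \<bullet> e = x $ i" for x by (simp add: e_def inner_axis)
  have ev: "e $ j = (if j = i then 1 else 0)" for j by (simp add: e_def axis_def)
  have int: "g integrable_on cbox c d" for c d
    by (rule integrable_continuous[OF continuous_on_subset[OF g]]) auto
  have per: "g (x + (2 * pi) *\<^sub>R e) = g x" for x
    using p by (simp add: periodic_def e_def)
  have ax: "(\<forall>j. (if j = i then P j else Q j)) \<longleftrightarrow> P i \<and> (\<forall>j. j \<noteq> i \<longrightarrow> Q j)" for P Q :: "'d \<Rightarrow> bool"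
    by metis
  have 1: "cbox (a + t *\<^sub>R e) (b + t *\<^sub>R e) \<inter> {x. x \<bullet> e \<le> pi} = cbox (a + t *\<^sub>R e) b"
  proof (intro set_eqI)
    fix x
    have "x \<in> cbox (a + t *\<^sub>R e) (b + t *\<^sub>R e) \<inter> {x. x \<bullet> e \<le> pi} \<longleftrightarrow>
       (\<forall>j. (if j = i then -pi + t \<le> x $ j \<and> x $ j \<le> pi + t \<and> x $ j \<le> pi else -pi \<le> x $ j \<and> x $ j \<le> pi))"
      unfolding ax by (auto simp: mem_box_cart xe ev a_def b_def split: if_splits)
    also have "\<dots> \<longleftrightarrow> (\<forall>j. (if j = i then -pi + t \<le> x $ j \<and> x $ j \<le> pi else -pi \<le> x $ j \<and> x $ j \<le> pi))"
      unfolding ax using t by auto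
    also have "\<dots> \<longleftrightarrow> x \<in> cbox (a + t *\<^sub>R e) b"
      unfolding ax by (auto simp: mem_box_cart xe ev a_def b_def split: if_splits)
    finally show "x \<in> cbox (a + t *\<^sub>R e) (b + t *\<^sub>R e) \<inter> {x. x \<bullet> e \<le> pi} \<longleftrightarrow> x \<in> cbox (a + t *\<^sub>R e) b" .
  qed
  have 2: "cbox (a + t *\<^sub>R e) (b + t *\<^sub>R e) \<inter> {x. x \<bullet> e \<ge> pi} = cbox (a + (2 * pi) *\<^sub>R e) (b + t *\<^sub>R e)"
  proof (intro set_eqI)
    fix x
    have "x \<in> cbox (a + t *\<^sub>R e) (b + t *\<^sub>R e) \<inter> {x. x \<bullet> e \<ge> pi} \<longleftrightarrow>
       (\<forall>j. (if j = i then -pi + t \<le> x $ j \<and> x $ j \<le> pi + t \<and> x $ j \<ge> pi else -pi \<le> x $ j \<and> x $ j \<le> pi))"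
      unfolding ax by (auto simp: mem_box_cart xe ev a_def b_def split: if_splits)
    also have "\<dots> \<longleftrightarrow> (\<forall>j. (if j = i then pi \<le> x $ j \<and> x $ j \<le> pi + t else -pi \<le> x $ j \<and> x $ j \<le> pi))"
      unfolding ax using t by auto
    also have "\<dots> \<longleftrightarrow> x \<in> cbox (a + (2 * pi) *\<^sub>R e) (b + t *\<^sub>R e)"
      unfolding ax by (auto simp: mem_box_cart xe ev a_def b_def split: if_splits)
    finally show "x \<in> cbox (a + t *\<^sub>R e) (b + t *\<^sub>R e) \<inter> {x. x \<bullet> e \<ge> pi} \<longleftrightarrow> x \<in> cbox (a + (2 * pi) *\<^sub>R e) (b + t *\<^sub>R e)" .
  qed
  have 3: "cbox a b \<inter> {x. x \<bullet> e \<le> t - pi} = cbox a (b + (t - 2 * pi) *\<^sub>R e)"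
  proof (intro set_eqI)
    fix x
    have "x \<in> cbox a b \<inter> {x. x \<bullet> e \<le> t - pi} \<longleftrightarrow>
       (\<forall>j. (if j = i then -pi \<le> x $ j \<and> x $ j \<le> pi \<and> x $ j \<le> t - pi else -pi \<le> x $ j \<and> x $ j \<le> pi))"
      unfolding ax by (auto simp: mem_box_cart xe ev a_def b_def split: if_splits)
    also have "\<dots> \<longleftrightarrow> (\<forall>j. (if j = i then - pi \<le> x $ j \<and> x $ j \<le> t - pi else -pi \<le> x $ j \<and> x $ j \<le> pi))"
      unfolding ax using t by auto
    also have "\<dots> \<longleftrightarrow> x \<in> cbox a (b + (t - 2 * pi) *\<^sub>R e)"
      unfolding ax by (auto simp: mem_box_cart xe ev a_def b_def split: if_splits)
    finally show "x \<in> cbox a b \<inter> {x. x \<bullet> e \<le> t - pi} \<longleftrightarrow> x \<in> cbox a (b + (t - 2 * pi) *\<^sub>R e)" .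
  qed
  have 4: "cbox a b \<inter> {x. x \<bullet> e \<ge> t - pi} = cbox (a + t *\<^sub>R e) b"
  proof (intro set_eqI)
    fix x
    have "x \<in> cbox a b \<inter> {x. x \<bullet> e \<ge> t - pi} \<longleftrightarrow>
       (\<forall>j. (if j = i then -pi \<le> x $ j \<and> x $ j \<le> pi \<and> x $ j \<ge> t - pi else -pi \<le> x $ j \<and> x $ j \<le> pi))"
      unfolding ax by (auto simp: mem_box_cart xe ev a_def b_def split: if_splits)
    also have "\<dots> \<longleftrightarrow> (\<forall>j. (if j = i then - pi + t \<le> x $ j \<and> x $ j \<le> pi else -pi \<le> x $ j \<and> x $ j \<le> pi))"
      unfolding ax using t by auto
    also have "\<dots> \<longleftrightarrow> x \<in> cbox (a + t *\<^sub>R e) b"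
      unfolding ax by (auto simp: mem_box_cart xe ev a_def b_def split: if_splits)
    finally show "x \<in> cbox a b \<inter> {x. x \<bullet> e \<ge> t - pi} \<longleftrightarrow> x \<in> cbox (a + t *\<^sub>R e) b" .
  qed
  have "integral torus_cube (\<lambda>x. g (x + t *\<^sub>R axis i 1)) = integral (cbox a b) (\<lambda>x. g (x + t *\<^sub>R e))"
    by (simp add: torus_cube_def a_def b_def e_def)
  also have "\<dots> = integral (cbox (a + t *\<^sub>R e) (b + t *\<^sub>R e)) g"
    using integral_shift_cbox[of "a + t *\<^sub>R e" "t *\<^sub>R e" "b + t *\<^sub>R e" g] by simp
  also have "\<dots> = integral (cbox (a + t *\<^sub>R e) b) g + integral (cbox (a + (2 * pi) *\<^sub>R e) (b + t *\<^sub>R e)) g"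
    unfolding integral_split[OF int e, of _ _ pi] 1 2 by simp
  also have "integral (cbox (a + (2 * pi) *\<^sub>R e) (b + t *\<^sub>R e)) g
      = integral (cbox a (b + (t - 2 * pi) *\<^sub>R e)) (\<lambda>x. g (x + (2 * pi) *\<^sub>R e))"
    using integral_shift_cbox[of "a + (2 * pi) *\<^sub>R e" "(2 * pi) *\<^sub>R e" "b + t *\<^sub>R e" g]
    by (simp add: algebra_simps)
  also have "\<dots> = integral (cbox a (b + (t - 2 * pi) *\<^sub>R e)) g"
    by (simp add: per)
  also have "integral (cbox (a + t *\<^sub>R e) b) g + \<dots> = integral (cbox a b) g"
    unfolding integral_split[OF int e, of a b "t - pi"] 3 4 by simp
  also have "\<dots> = integral torus_cube g"
    by (simp add: torus_cube_def a_def b_def)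
  finally show ?thesis .
qed

lemma content_torus_cube: "measure lborel (torus_cube :: (real ^ 'd) set) = (2 * pi) ^ CARD('d)"
proof -
  have "torus_cube \<noteq> ({} :: (real ^ 'd) set)"
    using mem_torus_cube[of "0 :: real ^ 'd"] by fastforce
  then show ?thesis
    by (simp add: torus_cube_def content_cbox_cart)
qed

lemma integral_fmode:
  "integral torus_cube (fmode k :: real ^ 'd \<Rightarrow> complex) = (if k = 0 then (2 * pi) ^ CARD('d) else 0)"
proof (cases "k = 0")
  case True
  have "integral torus_cube (fmode 0 :: real ^ 'd \<Rightarrow> complex) = measure lborel (torus_cube :: (real ^ 'd) set) *\<^sub>R 1"
    unfolding fmode_0_fun torus_cube_def by (simp only: integral_const)
  then show ?thesis using True by (simp add: content_torus_cube scaleR_conv_of_real)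
next
  case False
  then obtain i where i: "k $ i \<noteq> 0" by (auto simp: vec_eq_iff)
  \<comment> \<open>shifting by \<open>t\<close> changes the sign of the integrand\<close>
  define t where "t = pi / \<bar>of_int (k $ i)\<bar>"
  have "\<bar>of_int (k $ i)\<bar> \<ge> (1::real)" using i by linarith
  then have t: "0 \<le> t" "t \<le> 2 * pi"
    by (auto simp: t_def divide_simps intro: order_trans[OF _ mult_left_mono])
  have "of_int (k $ i) * t = pi \<or> of_int (k $ i) * t = - pi"
    using i by (cases "k $ i > 0") (auto simp: t_def)
  then have "cis (of_int (k $ i) * t) = - 1"
    by (elim disjE) (simp_all add: complex_eq_iff)
  then have "integral torus_cube (fmode k) = integral torus_cube (\<lambda>x. - fmode k x :: complex)"
    using integral_torus_shift[OF _ periodic_fmode t, of k i]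
    by (simp add: fmode_shift continuous_on_fmode)
  then show ?thesis using False by simp
qed

section \<open>Density of trigonometric polynomials\<close>

lemma integrable_torus:
  fixes f :: "real ^ 'd \<Rightarrow> 'b::banach"
  shows "continuous_on torus_cube f \<Longrightarrow> f integrable_on torus_cube"
  unfolding torus_cube_def by (rule integrable_continuous)

lemma trig_polysI: "finite F \<Longrightarrow> (\<lambda>x. \<Sum>k\<in>F. c k * fmode k x) \<in> trig_polys"
  unfolding trig_polys_def by blast

lemma trig_polys_fmode: "(\<lambda>x. c * fmode k x) \<in> trig_polys"
  using trig_polysI[of "{k}" "\<lambda>_. c"] by simp

lemma trig_polys_const: "(\<lambda>x. c) \<in> trig_polys"
  using trig_polys_fmode[of c 0] by simp

lemma trig_polys_add:
  assumes "u \<in> trig_polys" "v \<in> trig_polys"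
  shows "(\<lambda>x. u x + v x) \<in> trig_polys"
proof -
  from assms obtain F c G d where
    F: "finite F" "u = (\<lambda>x. \<Sum>k\<in>F. c k * fmode k x)" and
    G: "finite G" "v = (\<lambda>x. \<Sum>k\<in>G. d k * fmode k x)"
    unfolding trig_polys_def by blast
  have "u x = (\<Sum>k\<in>F \<union> G. (if k \<in> F then c k else 0) * fmode k x)" for x
    unfolding F(2) by (rule sum.mono_neutral_cong_left) (use F G in auto)
  moreover have "v x = (\<Sum>k\<in>F \<union> G. (if k \<in> G then d k else 0) * fmode k x)" for x
    unfolding G(2) by (rule sum.mono_neutral_cong_left) (use F G in auto)
  ultimately have "(\<lambda>x. u x + v x) =
      (\<lambda>x. \<Sum>k\<in>F \<union> G. ((if k \<in> F then c k else 0) + (if k \<in> G then d k else 0)) * fmode k x)"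
    by (simp add: distrib_right sum.distrib)
  then show ?thesis
    by (simp only: trig_polysI[OF finite_UnI[OF F(1) G(1)]])
qed

lemma trig_polys_sum:
  assumes "\<And>i. i \<in> I \<Longrightarrow> u i \<in> trig_polys"
  shows "(\<lambda>x. \<Sum>i\<in>I. u i x) \<in> trig_polys"
  using assms
proof (induction I rule: infinite_finite_induct)
  case (insert i I)
  then have "(\<lambda>x. u i x + (\<Sum>i\<in>I. u i x)) \<in> trig_polys"
    by (intro trig_polys_add) simp_all
  with insert show ?case by simp
qed (simp_all add: trig_polys_const)

lemma trig_polys_mult:
  assumes "u \<in> trig_polys" "v \<in> trig_polys"
  shows "(\<lambda>x. u x * v x) \<in> trig_polys"
proof -
  from assms obtain F c G d where
    F: "finite F" "u = (\<lambda>x. \<Sum>k\<in>F. c k * fmode k x)" and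
    G: "finite G" "v = (\<lambda>x. \<Sum>k\<in>G. d k * fmode k x)"
    unfolding trig_polys_def by blast
  have "u x * v x = (\<Sum>k\<in>F. \<Sum>l\<in>G. (c k * d l) * fmode (k + l) x)" for x
    unfolding F G sum_product by (intro sum.cong) (simp_all add: mult_ac flip: fmode_mult)
  then show ?thesis
    by (simp add: trig_polys_sum trig_polys_fmode)
qed

section \<open>Continuous functions on the torus\<close>

definition cont_torus :: "(real ^ 'd \<Rightarrow> 'a::real_normed_vector) \<Rightarrow> bool" where
  "cont_torus u \<longleftrightarrow> continuous_on UNIV u \<and> periodic u"

lemma cont_torusD:
  assumes "cont_torus u"
  shows "continuous_on S u" "periodic u"
  using assms by (auto simp: cont_torus_def intro: continuous_on_subset)

lemma cont_torus_fmode: "cont_torus (fmode k :: real ^ 'd \<Rightarrow> complex)"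
  using periodic_fmode[of k] continuous_on_fmode[of UNIV "\<lambda>x. x" k] by (simp add: cont_torus_def)

lemma cont_torus_const: "cont_torus (\<lambda>x. c)"
  by (simp add: cont_torus_def periodic_def)

lemma cont_torus_comp:
  assumes "cont_torus u" "continuous_on UNIV g"
  shows "cont_torus (\<lambda>x. g (u x))"
  using assms by (auto simp: cont_torus_def periodic_def intro: continuous_on_compose2)

lemma cont_torus_add: "cont_torus u \<Longrightarrow> cont_torus v \<Longrightarrow> cont_torus (\<lambda>x. u x + v x)"
  by (auto simp: cont_torus_def periodic_def intro!: continuous_intros)

lemma cont_torus_diff: "cont_torus u \<Longrightarrow> cont_torus v \<Longrightarrow> cont_torus (\<lambda>x. u x - v x)"
  by (auto simp: cont_torus_def periodic_def intro!: continuous_intros)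

lemma cont_torus_mult:
  "cont_torus u \<Longrightarrow> cont_torus v \<Longrightarrow> cont_torus (\<lambda>x. u x * v x :: 'a::real_normed_algebra)"
  by (auto simp: cont_torus_def periodic_def intro!: continuous_intros)

lemma cont_torus_cnj: "cont_torus u \<Longrightarrow> cont_torus (\<lambda>x. cnj (u x))"
  by (auto simp: cont_torus_def periodic_def intro!: continuous_intros)

lemma cont_torus_sum:
  assumes "\<And>i. i \<in> I \<Longrightarrow> cont_torus (u i)"
  shows "cont_torus (\<lambda>x. \<Sum>i\<in>I. u i x)"
  using assms
proof (induction I rule: infinite_finite_induct)
  case (insert i I)
  then have "cont_torus (\<lambda>x. u i x + (\<Sum>i\<in>I. u i x))"
    by (intro cont_torus_add) simp_all
  with insert show ?case by simp
qed (simp_all add: cont_torus_const)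

lemma cont_torus_trig_polys:
  assumes "u \<in> trig_polys"
  shows "cont_torus u"
  using assms unfolding trig_polys_def
  by (auto intro!: cont_torus_sum cont_torus_mult cont_torus_const cont_torus_fmode)

lemma periodic_int_shift:
  assumes "periodic v"
  shows "v (x + (2 * pi * of_int m) *\<^sub>R axis i 1) = v x"
proof -
  have step: "v (y + (2 * pi) *\<^sub>R axis i 1) = v y" for y
    using assms by (simp add: periodic_def)
  have *: "v (x + (2 * pi * real n) *\<^sub>R axis i 1) = v x" for n x
  proof (induction n)
    case (Suc n)
    have "x + (2 * pi * real (Suc n)) *\<^sub>R axis i 1 = (x + (2 * pi * real n) *\<^sub>R axis i 1) + (2 * pi) *\<^sub>R axis i 1"
      by (simp add: ring_distribs scaleR_add_left)
    then show ?case by (simp only: step Suc)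
  qed simp
  show ?thesis
  proof (cases "m \<ge> 0")
    case True
    then show ?thesis using *[of x "nat m"] by simp
  next
    case False
    then have "real (nat (- m)) = - of_int m" by simp
    then show ?thesis using *[of "x + (2 * pi * of_int m) *\<^sub>R axis i 1" "nat (- m)"] by simp
  qed
qed

text \<open>Equal phases differ by integer multiples of 2 pi, and these shifts are undone one
  coordinate at a time. Consequently a periodic function is well defined on the product of unit
  circles.\<close>

lemma periodic_cis_eq:
  fixes v :: "real ^ 'd \<Rightarrow> 'b"
  assumes "periodic v" and "\<And>i. cis (x $ i) = cis (y $ i)"
  shows "v x = v y"
proof -
  have "\<exists>m::int. x $ i = y $ i + 2 * pi * of_int m" for i
    using assms(2)[of i] sin_cos_eq_iff[of "x $ i" "y $ i"] by (simp add: complex_eq_iff)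
  then obtain m :: "'d \<Rightarrow> int" where m: "\<And>i. x $ i = y $ i + 2 * pi * of_int (m i)"
    by metis
  have *: "v (y + (\<Sum>i\<in>I. (2 * pi * of_int (m i)) *\<^sub>R axis i 1)) = v y" for I
  proof (induction I rule: infinite_finite_induct)
    case (insert i I)
    have "y + (\<Sum>i\<in>insert i I. (2 * pi * of_int (m i)) *\<^sub>R axis i 1)
        = (y + (\<Sum>i\<in>I. (2 * pi * of_int (m i)) *\<^sub>R axis i 1)) + (2 * pi * of_int (m i)) *\<^sub>R axis i 1"
      using insert by (simp add: add_ac)
    then show ?case by (simp only: insert periodic_int_shift[OF assms(1)])
  qed simp_all
  have "(\<Sum>i\<in>UNIV. (2 * pi * of_int (m i)) *\<^sub>R axis i 1) $ j = 2 * pi * of_int (m j)" for j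
  proof -
    have "(\<Sum>i\<in>UNIV. (2 * pi * of_int (m i)) *\<^sub>R axis i (1::real)) $ j
        = (\<Sum>i\<in>UNIV. if i = j then 2 * pi * of_int (m i) else 0)"
      unfolding sum_component by (intro sum.cong) (auto simp: axis_def)
    then show ?thesis by simp
  qed
  then have "x = y + (\<Sum>i\<in>UNIV. (2 * pi * of_int (m i)) *\<^sub>R axis i 1)"
    by (simp only: vec_eq_iff vector_add_component m) simp
  then show ?thesis by (simp only: *)
qed

lemma abs_Arg_le: "\<bar>Arg z\<bar> \<le> pi"
  using Arg_bounded[of z] by linarith

lemma periodic_torus_rep:
  assumes "periodic v"
  obtains y where "y \<in> torus_cube" "v x = v y"
proof
  show "(\<chi> i. Arg (cis (x $ i))) \<in> torus_cube"
    by (simp add: mem_torus_cube abs_Arg_le)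
  show "v x = v (\<chi> i. Arg (cis (x $ i)))"
    by (rule periodic_cis_eq[OF assms]) (simp add: cis_Arg)
qed

text \<open>
  A continuous function on the torus factors through the map \<open>q\<close> onto a product of unit circles,
  where the Stone-Weierstrass theorem applies: unlike the cube, this compact set has its points
  separated by trigonometric polynomials.
\<close>

lemma trig_polys_dense_real:
  fixes v :: "real ^ 'd \<Rightarrow> real"
  assumes v: "cont_torus v" and e: "e > 0"
  shows "\<exists>P\<in>trig_polys. \<forall>x. cmod (of_real (v x) - P x) < e"
proof -
  define q :: "real ^ 'd \<Rightarrow> complex ^ 'd" where "q x = (\<chi> i. cis (x $ i))" for x
  define S where "S = q ` torus_cube"
  define r :: "complex ^ 'd \<Rightarrow> real ^ 'd" where "r z = (\<chi> i. Arg (z $ i))" for z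
  define U where "U z = v (r z)" for z
  have qcont: "continuous_on T q" for T
    unfolding q_def by (intro continuous_intros)
  have S: "compact S"
    unfolding S_def by (intro compact_continuous_image qcont compact_torus_cube)
  have rq: "v (r (q x)) = v x" for x
    by (rule periodic_cis_eq) (use v in \<open>auto simp: cont_torus_def r_def q_def cis_Arg\<close>)
  have r: "r z \<in> torus_cube" for z
    by (simp add: mem_torus_cube r_def abs_Arg_le)
  have qS: "q x \<in> S" for x
  proof -
    have "q x = q (r (q x))" by (simp add: vec_eq_iff q_def r_def cis_Arg)
    then show ?thesis using r unfolding S_def by blast
  qed
  \<comment> \<open>The section \<open>r\<close> jumps at the branch cut of \<open>Arg\<close>, so
    continuity cannot be read off from \<open>U z = v (r z)\<close>. Instead \<open>q\<close> is
    used as a closed map: the preimage of a closed set under \<open>U\<close> is the image under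
    \<open>q\<close> of a compact part of the cube.\<close>
  have U: "continuous_on S U"
    unfolding continuous_on_closed_invariant
  proof (intro allI impI)
    fix B :: "real set" assume B: "closed B"
    have "closed (v -` B)"
      using B cont_torusD(1)[OF v, of UNIV] by (simp add: continuous_on_closed_vimage)
    then have "closed (q ` (torus_cube \<inter> v -` B))"
      by (rule compact_imp_closed[OF compact_continuous_image[OF qcont compact_Int_closed[OF compact_torus_cube]]])
    moreover have "q ` (torus_cube \<inter> v -` B) \<inter> S = U -` B \<inter> S"
      using rq by (auto simp: S_def U_def) (metis rq)
    ultimately show "\<exists>A. closed A \<and> A \<inter> S = U -` B \<inter> S" by blast
  qed
  \<comment> \<open>The algebra for Stone-Weierstrass consists of the functions whose pullback along
    \<open>q\<close> is a trigonometric polynomial. Real and imaginary parts of the coordinates pull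
    back to cosines and sines, and they separate the points of \<open>S\<close>.\<close>
  define PP where "PP g \<longleftrightarrow> continuous_on S g \<and> (\<lambda>x. of_real (g (q x)) :: complex) \<in> trig_polys"
    for g :: "complex ^ 'd \<Rightarrow> real"
  have "\<exists>g. PP g \<and> (\<forall>z\<in>S. \<bar>U z - g z\<bar> < e)"
  proof (rule Stone_Weierstrass_HOL[OF S _ _ _ _ _ U e])
    show "PP (\<lambda>x. c)" for c
      by (simp add: PP_def trig_polys_const)
    show "PP f \<Longrightarrow> continuous_on S f" for f by (simp add: PP_def)
    show "PP f \<and> PP g \<Longrightarrow> PP (\<lambda>x. f x + g x)" for f g
      by (auto simp: PP_def intro!: continuous_intros trig_polys_add)
    show "PP f \<and> PP g \<Longrightarrow> PP (\<lambda>x. f x * g x)" for f g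
      by (auto simp: PP_def intro!: continuous_intros trig_polys_mult)
    fix z w assume zw: "z \<in> S \<and> w \<in> S \<and> z \<noteq> w"
    then obtain i where i: "z $ i \<noteq> w $ i" by (auto simp: vec_eq_iff)
    have "(\<Sum>j\<in>UNIV. of_int (axis i 1 $ j) * x $ j) = (\<Sum>j\<in>UNIV. if j = i then x $ j else 0)" for x :: "real ^ 'd"
      by (intro sum.cong) (auto simp: axis_def)
    then have fm: "fmode (axis i 1) x = cis (x $ i)" "fmode (- axis i 1) x = cis (- (x $ i))" for x
      by (simp_all add: fmode_def sum_negf)
    have "of_real (cos (x $ i)) = (1/2) * fmode (axis i 1) x + (1/2) * fmode (- axis i 1) x" for x
      by (simp add: fm complex_eq_iff)
    then have "(\<lambda>x. of_real (Re (q x $ i)) :: complex) \<in> trig_polys"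
      by (simp only: q_def vec_lambda_beta cis.simps trig_polys_add trig_polys_fmode)
    then have Re: "PP (\<lambda>z. Re (z $ i))"
      by (auto simp: PP_def intro!: continuous_intros)
    have "of_real (sin (x $ i)) = (-\<i>/2) * fmode (axis i 1) x + (\<i>/2) * fmode (- axis i 1) x" for x
      by (simp add: fm complex_eq_iff)
    then have "(\<lambda>x. of_real (Im (q x $ i)) :: complex) \<in> trig_polys"
      by (simp only: q_def vec_lambda_beta cis.simps trig_polys_add trig_polys_fmode)
    then have Im: "PP (\<lambda>z. Im (z $ i))"
      by (auto simp: PP_def intro!: continuous_intros)
    from i have "Re (z $ i) \<noteq> Re (w $ i) \<or> Im (z $ i) \<noteq> Im (w $ i)" by (simp add: complex_eq_iff)
    with Re Im show "\<exists>f. PP f \<and> f z \<noteq> f w" by blast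
  qed
  then obtain g where g: "PP g" "\<And>z. z \<in> S \<Longrightarrow> \<bar>U z - g z\<bar> < e" by blast
  have "cmod (of_real (v x) - of_real (g (q x))) < e" for x
    using g(2)[OF qS[of x]] rq[of x] by (simp add: U_def flip: of_real_diff)
  with g(1) show ?thesis
    by (intro bexI[of _ "\<lambda>x. of_real (g (q x))"]) (simp_all add: PP_def)
qed

lemma trig_polys_dense:
  fixes v :: "real ^ 'd \<Rightarrow> complex"
  assumes v: "cont_torus v" and e: "e > 0"
  shows "\<exists>P\<in>trig_polys. \<forall>x. cmod (v x - P x) < e"
proof -
  from trig_polys_dense_real[OF cont_torus_comp[OF v continuous_on_Re[OF continuous_on_id]], of "e/2"] e
  obtain P where P: "P \<in> trig_polys" "\<And>x. cmod (of_real (Re (v x)) - P x) < e / 2"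
    by auto
  from trig_polys_dense_real[OF cont_torus_comp[OF v continuous_on_Im[OF continuous_on_id]], of "e/2"] e
  obtain Q where Q: "Q \<in> trig_polys" "\<And>x. cmod (of_real (Im (v x)) - Q x) < e / 2"
    by auto
  have "cmod (v x - (P x + \<i> * Q x)) < e" for x
  proof -
    have "v x - (P x + \<i> * Q x) = (of_real (Re (v x)) - P x) + \<i> * (of_real (Im (v x)) - Q x)"
      using complex_eq[of "v x"] by (simp add: algebra_simps)
    then have "cmod (v x - (P x + \<i> * Q x)) \<le> cmod (of_real (Re (v x)) - P x) + cmod (of_real (Im (v x)) - Q x)"
      by (metis norm_triangle_ineq norm_mult norm_ii mult_1)
    then show ?thesis using P(2)[of x] Q(2)[of x] by linarith
  qed
  then show ?thesis
    using trig_polys_add[OF P(1) trig_polys_mult[OF trig_polys_const[of \<i>] Q(1)]]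
    by (intro bexI[of _ "\<lambda>x. P x + \<i> * Q x"]) simp_all
qed

section \<open>Parseval's identity\<close>

lemma nonneg_summable_onI:
  fixes f :: "'k \<Rightarrow> real"
  assumes "\<And>k. f k \<ge> 0" "\<And>F. finite F \<Longrightarrow> sum f F \<le> B"
  shows "f summable_on UNIV"
  using assms by (intro nonneg_bdd_above_summable_on) (auto intro!: bdd_aboveI2)

lemma has_sum_minus:
  fixes f g :: "'k \<Rightarrow> 'b::real_normed_field"
  assumes "(f has_sum a) A" "(g has_sum b) A"
  shows "((\<lambda>k. f k - g k) has_sum (a - b)) A"
  using has_sum_add[OF assms(1) has_sum_uminusI[OF assms(2)]] by simp

text \<open>The division by the volume of the cube makes the modes orthonormal, so that
  \<open>fcoeff\<close> is an inner product with a mode.\<close>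

definition torus_ip :: "(real ^ 'd \<Rightarrow> complex) \<Rightarrow> (real ^ 'd \<Rightarrow> complex) \<Rightarrow> complex" where
  "torus_ip u v = integral torus_cube (\<lambda>x. u x * cnj (v x)) / of_real ((2 * pi) ^ CARD('d))"

lemma fcoeff_eq_ip: "fcoeff u k = torus_ip u (fmode k)"
  by (simp add: fcoeff_def torus_ip_def)

lemma integrable_torus_ip:
  fixes u v :: "real ^ 'd \<Rightarrow> complex"
  assumes "continuous_on torus_cube u" "continuous_on torus_cube v"
  shows "(\<lambda>x. u x * cnj (v x)) integrable_on torus_cube"
  by (intro integrable_torus continuous_intros assms)

lemma torus_ip_add_left:
  assumes "continuous_on torus_cube u" "continuous_on torus_cube u'" "continuous_on torus_cube v"
  shows "torus_ip (\<lambda>x. u x + u' x) v = torus_ip u v + torus_ip u' v"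
  unfolding torus_ip_def distrib_right
  by (simp only: integral_add[OF integrable_torus_ip[OF assms(1,3)] integrable_torus_ip[OF assms(2,3)]] add_divide_distrib)

lemma torus_ip_diff_left:
  assumes "continuous_on torus_cube u" "continuous_on torus_cube u'" "continuous_on torus_cube v"
  shows "torus_ip (\<lambda>x. u x - u' x) v = torus_ip u v - torus_ip u' v"
  unfolding torus_ip_def left_diff_distrib
  by (simp only: integral_diff[OF integrable_torus_ip[OF assms(1,3)] integrable_torus_ip[OF assms(2,3)]] diff_divide_distrib)

lemma torus_ip_cmul_left: "torus_ip (\<lambda>x. c * u x) v = c * torus_ip u v"
  unfolding torus_ip_def by (simp add: mult.assoc)

lemma torus_ip_sum_left:
  assumes "\<And>i. i \<in> I \<Longrightarrow> continuous_on torus_cube (u i)" "continuous_on torus_cube v"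
  shows "torus_ip (\<lambda>x. \<Sum>i\<in>I. u i x) v = (\<Sum>i\<in>I. torus_ip (u i) v)"
proof (cases "finite I")
  case True
  then show ?thesis
    unfolding torus_ip_def sum_distrib_right
    by (simp add: integral_sum integrable_torus_ip assms sum_divide_distrib)
next
  case False
  then show ?thesis by (simp add: torus_ip_def)
qed

lemma torus_ip_commute: "torus_ip u v = cnj (torus_ip v u)"
  unfolding torus_ip_def by (simp add: integral_cnj mult.commute)

lemma torus_ip_diff_right:
  assumes "continuous_on torus_cube u" "continuous_on torus_cube u'" "continuous_on torus_cube v"
  shows "torus_ip v (\<lambda>x. u x - u' x) = torus_ip v u - torus_ip v u'"
  using torus_ip_diff_left[OF assms] by (metis complex_cnj_diff torus_ip_commute)

lemma torus_ip_sum_right: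
  assumes "\<And>i. i \<in> I \<Longrightarrow> continuous_on torus_cube (u i)" "continuous_on torus_cube v"
  shows "torus_ip v (\<lambda>x. \<Sum>i\<in>I. u i x) = (\<Sum>i\<in>I. torus_ip v (u i))"
proof -
  have "torus_ip v (\<lambda>x. \<Sum>i\<in>I. u i x) = cnj (\<Sum>i\<in>I. torus_ip (u i) v)"
    by (subst torus_ip_commute) (simp only: torus_ip_sum_left[of I u v, OF assms])
  then show ?thesis
    by (simp only: cnj_sum flip: torus_ip_commute)
qed

lemma torus_ip_cmul_right: "torus_ip u (\<lambda>x. c * v x) = cnj c * torus_ip u v"
  unfolding torus_ip_commute[of u] torus_ip_cmul_left by simp

lemma torus_ip_fmode:
  "torus_ip (fmode k) (fmode l :: real ^ 'd \<Rightarrow> complex) = (if k = l then 1 else 0)"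
  unfolding torus_ip_def cnj_fmode fmode_mult using integral_fmode[of "k - l"]
  by (auto simp: eta_contract_eq)

definition torus_norm2 :: "(real ^ 'd \<Rightarrow> complex) \<Rightarrow> real" where
  "torus_norm2 u = integral torus_cube (\<lambda>x. (cmod (u x))\<^sup>2) / (2 * pi) ^ CARD('d)"

lemma torus_ip_self:
  assumes "continuous_on torus_cube u"
  shows "torus_ip u u = of_real (torus_norm2 u)"
proof -
  have "(\<lambda>x. (cmod (u x))\<^sup>2) integrable_on torus_cube"
    by (intro integrable_torus continuous_intros assms)
  from integral_linear[OF this bounded_linear_of_real[where 'a = complex]] show ?thesis
    by (simp add: torus_ip_def torus_norm2_def o_def flip: complex_norm_square)
qed

lemma torus_norm2_nonneg: "torus_norm2 u \<ge> 0"
  unfolding torus_norm2_def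
  by (cases "(\<lambda>x. (cmod (u x))\<^sup>2) integrable_on torus_cube")
     (auto intro!: divide_nonneg_nonneg integral_nonneg simp: not_integrable_integral)

lemma torus_norm2_le:
  fixes u :: "real ^ 'd \<Rightarrow> complex"
  assumes "continuous_on torus_cube u" "\<And>x. x \<in> torus_cube \<Longrightarrow> cmod (u x) \<le> B"
  shows "torus_norm2 u \<le> B\<^sup>2"
proof -
  have "integral torus_cube (\<lambda>x. (cmod (u x))\<^sup>2) \<le> integral torus_cube (\<lambda>x::real ^ 'd. B\<^sup>2)"
    by (intro integral_le integrable_torus continuous_intros assms power_mono) auto
  also have "\<dots> = (2 * pi) ^ CARD('d) * B\<^sup>2"
    unfolding content_torus_cube[symmetric] torus_cube_def by simp
  finally show ?thesis by (simp add: torus_norm2_def divide_simps mult.commute)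
qed

lemma continuous_on_trig_sum: "continuous_on S (\<lambda>x. \<Sum>k\<in>F. c k * fmode k x)"
  by (intro continuous_intros)

text \<open>Completing the square in the coefficients. With \<open>c = fcoeff v\<close> it yields
  Bessel's inequality; for arbitrary \<open>c\<close> the last sum is nonnegative, so any good
  approximation bounds the defect in Bessel's inequality.\<close>

lemma torus_norm2_diff_trig:
  assumes v: "continuous_on torus_cube v" and F: "finite F"
  shows "torus_norm2 (\<lambda>x. v x - (\<Sum>k\<in>F. c k * fmode k x))
       = torus_norm2 v - (\<Sum>k\<in>F. (cmod (fcoeff v k))\<^sup>2) + (\<Sum>k\<in>F. (cmod (c k - fcoeff v k))\<^sup>2)"
proof -
  define P where "P = (\<lambda>x. \<Sum>k\<in>F. c k * fmode k x)"
  have P: "continuous_on torus_cube P" unfolding P_def by (rule continuous_on_trig_sum)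
  have cf: "continuous_on torus_cube (\<lambda>x. c k * fmode k x)" for k by (intro continuous_intros)
  have vP: "torus_ip v P = (\<Sum>k\<in>F. cnj (c k) * fcoeff v k)"
    unfolding P_def torus_ip_sum_right[OF cf v] by (simp add: torus_ip_cmul_right fcoeff_eq_ip)
  have "torus_ip P (fmode k) = c k" if "k \<in> F" for k
  proof -
    have "torus_ip P (fmode k) = (\<Sum>l\<in>F. c l * (if l = k then 1 else 0))"
      unfolding P_def
      by (subst torus_ip_sum_left)
         (auto intro!: continuous_intros simp: torus_ip_cmul_left torus_ip_fmode)
    then show ?thesis using that F by (simp add: if_distrib cong: if_cong)
  qed
  then have PP: "torus_ip P P = (\<Sum>k\<in>F. cnj (c k) * c k)"
    unfolding P_def[of] torus_ip_sum_right[OF cf P[unfolded P_def]]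
    by (simp add: torus_ip_cmul_right)
  have "complex_of_real (torus_norm2 (\<lambda>x. v x - P x)) = torus_ip v v - torus_ip v P - (torus_ip P v - torus_ip P P)"
    using v P by (simp add: torus_ip_self[symmetric] continuous_on_diff torus_ip_diff_left torus_ip_diff_right)
  also have "torus_ip P v = (\<Sum>k\<in>F. c k * cnj (fcoeff v k))"
    unfolding torus_ip_commute[of P v] vP by simp
  also have "torus_ip v v - torus_ip v P - ((\<Sum>k\<in>F. c k * cnj (fcoeff v k)) - torus_ip P P)
     = torus_ip v v + (\<Sum>k\<in>F. (c k - fcoeff v k) * cnj (c k - fcoeff v k) - fcoeff v k * cnj (fcoeff v k))"
    unfolding vP PP by (simp add: algebra_simps sum_subtractf sum.distrib sum_negf)
  also have "\<dots> = of_real (torus_norm2 v + (\<Sum>k\<in>F. (cmod (c k - fcoeff v k))\<^sup>2 - (cmod (fcoeff v k))\<^sup>2))"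
    unfolding torus_ip_self[OF v] complex_norm_square[symmetric] by simp
  finally show ?thesis
    unfolding of_real_eq_iff P_def by (simp add: sum_subtractf)
qed

lemma bessel:
  assumes v: "continuous_on torus_cube v"
  shows "(\<Sum>k\<in>F. (cmod (fcoeff v k))\<^sup>2) \<le> torus_norm2 v"
proof (cases "finite F")
  case True
  have "torus_norm2 v - (\<Sum>k\<in>F. (cmod (fcoeff v k))\<^sup>2) = torus_norm2 (\<lambda>x. v x - (\<Sum>k\<in>F. fcoeff v k * fmode k x))"
    using torus_norm2_diff_trig[OF v True, of "fcoeff v"] by simp
  then show ?thesis
    using torus_norm2_nonneg[of "\<lambda>x. v x - (\<Sum>k\<in>F. fcoeff v k * fmode k x)"] by linarith
qed (simp add: torus_norm2_nonneg)

text \<open>Uniform approximation within \<open>sqrt e\<close> leaves a mean square error of at most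
  e. By the completed square, the defect in Bessel's inequality is no larger than that
  error.\<close>

theorem parseval:
  fixes v :: "real ^ 'd \<Rightarrow> complex"
  assumes v: "cont_torus v"
  shows "((\<lambda>k. (cmod (fcoeff v k))\<^sup>2) has_sum torus_norm2 v) UNIV"
proof -
  have vc: "continuous_on torus_cube v" using v by (rule cont_torusD)
  have sm: "(\<lambda>k. (cmod (fcoeff v k))\<^sup>2) summable_on UNIV"
    using bessel[OF vc] by (intro nonneg_summable_onI) auto
  have "torus_norm2 v \<le> (\<Sum>\<^sub>\<infinity>k. (cmod (fcoeff v k))\<^sup>2) + e" if "e > 0" for e
  proof -
    from trig_polys_dense[OF v, of "sqrt e"] that obtain F c where
      F: "finite F" and c: "\<And>x. cmod (v x - (\<Sum>k\<in>F. c k * fmode k x)) < sqrt e"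
      unfolding trig_polys_def by auto
    have "torus_norm2 (\<lambda>x. v x - (\<Sum>k\<in>F. c k * fmode k x)) \<le> (sqrt e)\<^sup>2"
      by (intro torus_norm2_le continuous_intros vc less_imp_le[OF c])
    then have "torus_norm2 v - (\<Sum>k\<in>F. (cmod (fcoeff v k))\<^sup>2) + (\<Sum>k\<in>F. (cmod (c k - fcoeff v k))\<^sup>2) \<le> e"
      unfolding torus_norm2_diff_trig[OF vc F] using that by simp
    moreover have "(\<Sum>k\<in>F. (cmod (fcoeff v k))\<^sup>2) \<le> (\<Sum>\<^sub>\<infinity>k. (cmod (fcoeff v k))\<^sup>2)"
      by (rule finite_sum_le_infsum[OF sm F]) auto
    moreover have "(\<Sum>k\<in>F. (cmod (c k - fcoeff v k))\<^sup>2) \<ge> 0" by (simp add: sum_nonneg)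
    ultimately show ?thesis by linarith
  qed
  then have "torus_norm2 v \<le> (\<Sum>\<^sub>\<infinity>k. (cmod (fcoeff v k))\<^sup>2)"
    by (rule field_le_epsilon)
  moreover have "(\<Sum>\<^sub>\<infinity>k. (cmod (fcoeff v k))\<^sup>2) \<le> torus_norm2 v"
    by (rule infsum_le_finite_sums[OF sm bessel[OF vc]])
  ultimately show ?thesis using has_sum_infsum[OF sm] by simp
qed

text \<open>Polarisation: a quarter of the difference of Parseval's identity for the sum and for the
  difference. The real part alone suffices, because the derivative of the potential energy is a real
  inner product.\<close>

theorem parseval_Re:
  fixes u v :: "real ^ 'd \<Rightarrow> complex"
  assumes u: "cont_torus u" and v: "cont_torus v"
  shows "((\<lambda>k. Re (fcoeff u k * cnj (fcoeff v k))) has_sum Re (torus_ip u v)) UNIV"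
proof -
  have uc: "continuous_on torus_cube u" and vc: "continuous_on torus_cube v"
    using u v by (auto intro: cont_torusD)
  have fm: "continuous_on torus_cube (fmode k :: real ^ 'd \<Rightarrow> complex)" for k
    by (rule cont_torusD[OF cont_torus_fmode])
  have f: "fcoeff (\<lambda>x. u x + v x) k = fcoeff u k + fcoeff v k"
    "fcoeff (\<lambda>x. u x - v x) k = fcoeff u k - fcoeff v k" for k
    unfolding fcoeff_eq_ip by (rule torus_ip_add_left torus_ip_diff_left, rule uc, rule vc, rule fm)+
  have pol: "(cmod (a + b))\<^sup>2 - (cmod (a - b))\<^sup>2 = 4 * Re (a * cnj b)" for a b :: complex
    unfolding cmod_power2 by (simp add: power2_eq_square algebra_simps)
  have "((\<lambda>k. (1/4) * ((cmod (fcoeff (\<lambda>x. u x + v x) k))\<^sup>2 - (cmod (fcoeff (\<lambda>x. u x - v x) k))\<^sup>2))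
     has_sum (1/4) * (torus_norm2 (\<lambda>x. u x + v x) - torus_norm2 (\<lambda>x. u x - v x))) UNIV"
    by (intro has_sum_cmult_right has_sum_minus parseval cont_torus_add cont_torus_diff u v)
  moreover have "torus_norm2 (\<lambda>x. u x + v x) - torus_norm2 (\<lambda>x. u x - v x) = 4 * Re (torus_ip u v)"
  proof -
    have i: "(\<lambda>x. (cmod (u x + v x))\<^sup>2) integrable_on torus_cube"
      "(\<lambda>x. (cmod (u x - v x))\<^sup>2) integrable_on torus_cube"
      "(\<lambda>x. u x * cnj (v x)) integrable_on torus_cube"
      by (intro integrable_torus continuous_intros uc vc)+
    have "torus_norm2 (\<lambda>x. u x + v x) - torus_norm2 (\<lambda>x. u x - v x)
      = integral torus_cube (\<lambda>x. 4 * Re (u x * cnj (v x))) / (2 * pi) ^ CARD('d)"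
      unfolding torus_norm2_def pol[symmetric] by (simp only: integral_diff[OF i(1,2)] diff_divide_distrib)
    also have "integral torus_cube (\<lambda>x. 4 * Re (u x * cnj (v x))) = 4 * Re (integral torus_cube (\<lambda>x. u x * cnj (v x)))"
      using integral_linear[OF i(3) bounded_linear_Re] by (simp only: o_def integral_mult_right)
    finally show ?thesis by (simp add: torus_ip_def)
  qed
  moreover have "(1/4) * (4 * a) = a" for a :: real by simp
  ultimately show ?thesis by (simp only: f pol)
qed

section \<open>Absolutely convergent Fourier series\<close>

lemma torus_ip_infsum_left:
  fixes u :: "'k::countable \<Rightarrow> real ^ 'd \<Rightarrow> complex"
  assumes u: "\<And>k. continuous_on torus_cube (u k)" and v: "continuous_on torus_cube v"
    and bound: "\<And>x F. x \<in> torus_cube \<Longrightarrow> finite F \<Longrightarrow> (\<Sum>k\<in>F. cmod (u k x)) \<le> B"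
  shows "((\<lambda>k. torus_ip (u k) v) has_sum torus_ip (\<lambda>x. \<Sum>\<^sub>\<infinity>k. u k x) v) UNIV"
proof -
  have "bounded (v ` torus_cube)"
    by (rule compact_imp_bounded[OF compact_continuous_image[OF v compact_torus_cube]])
  then obtain V where V: "\<And>x. x \<in> torus_cube \<Longrightarrow> cmod (v x) \<le> V"
    unfolding bounded_iff by blast
  have bd: "(\<Sum>k\<in>F. cmod (u k x * cnj (v x))) \<le> B * V" if "x \<in> torus_cube" "finite F" for x F
  proof -
    have "(\<Sum>k\<in>F. cmod (u k x * cnj (v x))) = (\<Sum>k\<in>F. cmod (u k x)) * cmod (v x)"
      by (simp add: norm_mult sum_distrib_right)
    also have "\<dots> \<le> B * V"
      using bound[OF that] V[OF that(1)] bound[OF that(1), of "{}"]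
      by (intro mult_mono) (auto intro: sum_nonneg)
    finally show ?thesis .
  qed
  have "((\<lambda>k. integral torus_cube (\<lambda>x. u k x * cnj (v x))) has_sum
      integral torus_cube (\<lambda>x. \<Sum>\<^sub>\<infinity>k. u k x * cnj (v x))) UNIV"
    unfolding torus_cube_def
    by (rule infsum_integral(3)[where B = "B * V"])
       (use u v bd in \<open>auto simp: torus_cube_def intro!: continuous_intros\<close>)
  also have "integral torus_cube (\<lambda>x. \<Sum>\<^sub>\<infinity>k. u k x * cnj (v x))
      = integral torus_cube (\<lambda>x. (\<Sum>\<^sub>\<infinity>k. u k x) * cnj (v x))"
    by (simp add: infsum_cmult_left')
  finally show ?thesis
    unfolding torus_ip_def divide_inverse by (rule has_sum_cmult_left)
qed

text \<open>The M-test makes the convergence uniform, which gives continuity, and termwise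
  integration against a mode leaves one coefficient. Any absolutely convergent expansion in modes
  thus determines the coefficients of its sum; the scheme is read mode by mode in this way.\<close>

lemma fourier_series:
  fixes a :: "int ^ 'd \<Rightarrow> complex"
  assumes bound: "\<And>F. finite F \<Longrightarrow> (\<Sum>k\<in>F. cmod (a k)) \<le> B"
  shows cont_torus_fourier_series: "cont_torus (\<lambda>x. \<Sum>\<^sub>\<infinity>k. a k * fmode k x)"
    and fcoeff_fourier_series: "fcoeff (\<lambda>x. \<Sum>\<^sub>\<infinity>k. a k * fmode k x) j = a j"
proof -
  have sm: "(\<lambda>k. cmod (a k)) summable_on UNIV"
    using abs_summable_onI[of a, OF bound] .
  have "uniform_limit UNIV (\<lambda>X x. \<Sum>k\<in>X. a k * fmode k x) (\<lambda>x. \<Sum>\<^sub>\<infinity>k. a k * fmode k x) (finite_subsets_at_top UNIV)"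
    by (rule Weierstrass_m_test_general[OF _ sm]) (simp add: norm_mult)
  then have "continuous_on UNIV (\<lambda>x. \<Sum>\<^sub>\<infinity>k. a k * fmode k x)"
    by (rule uniform_limit_theorem[rotated]) (auto intro!: always_eventually continuous_on_trig_sum)
  moreover have "periodic (\<lambda>x. \<Sum>\<^sub>\<infinity>k. a k * fmode k x)"
    using periodic_fmode[where 'd = 'd] by (simp add: periodic_def)
  ultimately show "cont_torus (\<lambda>x. \<Sum>\<^sub>\<infinity>k. a k * fmode k x)"
    by (simp add: cont_torus_def)
  have "((\<lambda>k. torus_ip (\<lambda>x. a k * fmode k x) (fmode j)) has_sum
     torus_ip (\<lambda>x. \<Sum>\<^sub>\<infinity>k. a k * fmode k x) (fmode j)) UNIV"
    by (rule torus_ip_infsum_left[where B = B])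
       (auto intro!: continuous_intros bound cont_torusD(1)[OF cont_torus_fmode] simp: norm_mult)
  moreover have "((\<lambda>k. torus_ip (\<lambda>x. a k * fmode k x) (fmode j)) has_sum a j) UNIV"
    by (rule has_sum_finite_neutralI[of "{j}"]) (auto simp: torus_ip_cmul_left torus_ip_fmode)
  ultimately show "fcoeff (\<lambda>x. \<Sum>\<^sub>\<infinity>k. a k * fmode k x) j = a j"
    unfolding fcoeff_eq_ip using has_sum_unique by blast
qed

lemma torus_norm2_eq_0:
  fixes u :: "real ^ 'd \<Rightarrow> complex"
  assumes u: "cont_torus u" and 0: "torus_norm2 u = 0"
  shows "u x = 0"
proof -
  obtain y where y: "y \<in> torus_cube" "u x = u y"
    using periodic_torus_rep[OF cont_torusD(2)[OF u]] by blast
  have "integral torus_cube (\<lambda>x. (cmod (u x))\<^sup>2) = 0"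
    using 0 by (simp add: torus_norm2_def)
  moreover have cont: "continuous_on torus_cube (\<lambda>x. (cmod (u x))\<^sup>2)"
    by (intro continuous_intros cont_torusD(1)[OF u])
  ultimately have i: "((\<lambda>x. (cmod (u x))\<^sup>2) has_integral 0) torus_cube"
    using integrable_integral[OF integrable_torus] by fastforce
  have "0 \<in> box (\<chi> i. - pi) ((\<chi> i. pi) :: real ^ 'd)"
    by (simp add: mem_box_cart)
  then have "(cmod (u y))\<^sup>2 = 0"
    using has_integral_0_cbox_imp_0[OF cont[unfolded torus_cube_def] _ i[unfolded torus_cube_def] _ y(1)[unfolded torus_cube_def]]
    by fastforce
  then show ?thesis using y by simp
qed

text \<open>A bound \<open>S\<close> on the norm in the Wiener algebra. Stated through finite
  partial sums, it includes summability and needs no side condition.\<close>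

definition wiener_bound :: "(real ^ 'd \<Rightarrow> complex) \<Rightarrow> real \<Rightarrow> bool" where
  "wiener_bound u S \<longleftrightarrow> (\<forall>F. finite F \<longrightarrow> (\<Sum>k\<in>F. cmod (fcoeff u k)) \<le> S)"

lemma wiener_boundD: "wiener_bound u S \<Longrightarrow> finite F \<Longrightarrow> (\<Sum>k\<in>F. cmod (fcoeff u k)) \<le> S"
  by (simp add: wiener_bound_def)

text \<open>The function and the sum of its series have the same coefficients, so by Parseval their
  difference has mean square 0. Being continuous and periodic, it vanishes at every point.\<close>

theorem fourier_inversion:
  assumes u: "cont_torus u" and S: "wiener_bound u S"
  shows "u x = (\<Sum>\<^sub>\<infinity>k. fcoeff u k * fmode k x)"
proof -
  define v where "v = (\<lambda>x. \<Sum>\<^sub>\<infinity>k. fcoeff u k * fmode k x)"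
  have v: "cont_torus v" "fcoeff v k = fcoeff u k" for k
    unfolding v_def using fourier_series[of "fcoeff u" S, OF wiener_boundD[OF S]] by auto
  have "fcoeff (\<lambda>x. u x - v x) k = 0" for k
    using torus_ip_diff_left[OF cont_torusD(1)[OF u] cont_torusD(1)[OF v(1)] cont_torusD(1)[OF cont_torus_fmode]] v(2)
    by (simp add: fcoeff_eq_ip)
  with parseval[OF cont_torus_diff[OF u v(1)]] have "torus_norm2 (\<lambda>x. u x - v x) = 0"
    using has_sum_unique[OF _ has_sum_0] by fastforce
  from torus_norm2_eq_0[OF cont_torus_diff[OF u v(1)] this] show ?thesis
    by (simp add: v_def)
qed

lemma wiener_bound_cnj:
  assumes "wiener_bound u S"
  shows "wiener_bound (\<lambda>x. cnj (u x)) S"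
  unfolding wiener_bound_def
proof (intro allI impI)
  fix F :: "(int ^ 'a) set" assume F: "finite F"
  have "fcoeff (\<lambda>x. cnj (u x)) k = cnj (fcoeff u (- k))" for k
    by (simp add: fcoeff_def integral_cnj cnj_fmode)
  then have "(\<Sum>k\<in>F. cmod (fcoeff (\<lambda>x. cnj (u x)) k)) = (\<Sum>k\<in>uminus ` F. cmod (fcoeff u k))"
    by (simp add: sum.reindex)
  also have "\<dots> \<le> S" using F by (intro wiener_boundD[OF assms]) simp
  finally show "(\<Sum>k\<in>F. cmod (fcoeff (\<lambda>x. cnj (u x)) k)) \<le> S" .
qed

lemma wiener_bound_cmul:
  assumes "wiener_bound u S"
  shows "wiener_bound (\<lambda>x. c * u x) (cmod c * S)"
  using assms unfolding wiener_bound_def fcoeff_eq_ip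
  by (simp add: torus_ip_cmul_left norm_mult mult_left_mono flip: sum_distrib_left)

lemma has_sum_finite_sum:
  fixes f :: "'i \<Rightarrow> 'k \<Rightarrow> 'b::topological_comm_monoid_add"
  assumes "\<And>i. i \<in> I \<Longrightarrow> (f i has_sum s i) A"
  shows "((\<lambda>k. \<Sum>i\<in>I. f i k) has_sum (\<Sum>i\<in>I. s i)) A"
  using assms by (induction I rule: infinite_finite_induct) (simp_all add: has_sum_add)

text \<open>The coefficients of a product are the convolution of the coefficients, and convolution
  is submultiplicative for the l^1 norm. Only \<open>u\<close> is expanded to obtain the convolution
  formula; \<open>v\<close> is carried along as a continuous factor in the inner product.\<close>

lemma wiener_bound_mult:
  fixes u v :: "real ^ 'd \<Rightarrow> complex"
  assumes u: "cont_torus u" and v: "cont_torus v" and S: "wiener_bound u S" and T: "wiener_bound v T"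
  shows "wiener_bound (\<lambda>x. u x * v x) (S * T)"
  unfolding wiener_bound_def
proof (intro allI impI)
  fix F :: "(int ^ 'd) set" assume F: "finite F"
  have vb: "bounded (v ` torus_cube)"
    by (rule compact_imp_bounded[OF compact_continuous_image[OF cont_torusD(1)[OF v] compact_torus_cube]])
  then obtain V where V: "\<And>x. x \<in> torus_cube \<Longrightarrow> cmod (v x) \<le> V"
    unfolding bounded_iff by blast
  have conv: "((\<lambda>k. fcoeff u k * fcoeff v (j - k)) has_sum fcoeff (\<lambda>x. u x * v x) j) UNIV" for j
  proof -
    have "((\<lambda>k. torus_ip (\<lambda>x. fcoeff u k * fmode k x) (\<lambda>x. cnj (v x) * fmode j x)) has_sum
       torus_ip (\<lambda>x. \<Sum>\<^sub>\<infinity>k. fcoeff u k * fmode k x) (\<lambda>x. cnj (v x) * fmode j x)) UNIV"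
      by (rule torus_ip_infsum_left[where B = S])
         (auto intro!: continuous_intros cont_torusD(1)[OF v] wiener_boundD[OF S]
           simp: norm_mult)
    also have "torus_ip (\<lambda>x. \<Sum>\<^sub>\<infinity>k. fcoeff u k * fmode k x) (\<lambda>x. cnj (v x) * fmode j x) = fcoeff (\<lambda>x. u x * v x) j"
      unfolding fourier_inversion[OF u S, symmetric] by (simp add: fcoeff_def torus_ip_def mult.assoc)
    finally have *: "((\<lambda>k. torus_ip (\<lambda>x. fcoeff u k * fmode k x) (\<lambda>x. cnj (v x) * fmode j x)) has_sum
       fcoeff (\<lambda>x. u x * v x) j) UNIV" .
    have "torus_ip (\<lambda>x. fcoeff u k * fmode k x) (\<lambda>x. cnj (v x) * fmode j x) = fcoeff u k * fcoeff v (j - k)" for k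
    proof -
      have "fmode k x * (v x * cnj (fmode j x)) = v x * cnj (fmode (j - k) x)" for x
        by (simp add: cnj_fmode fmode_mult mult.left_commute)
      then show ?thesis
        unfolding torus_ip_cmul_left
        by (simp only: fcoeff_def torus_ip_def complex_cnj_mult complex_cnj_cnj)
    qed
    with * show ?thesis by simp
  qed
  have sm: "(\<lambda>k. cmod (fcoeff u k)) summable_on UNIV"
    by (rule abs_summable_onI[of "fcoeff u", OF wiener_boundD[OF S]])
  have Tk: "(\<Sum>j\<in>F. cmod (fcoeff v (j - k))) \<le> T" for k
  proof -
    have "(\<Sum>j\<in>F. cmod (fcoeff v (j - k))) = (\<Sum>l\<in>(\<lambda>j. j - k) ` F. cmod (fcoeff v l))"
      by (subst sum.reindex) (auto simp: inj_on_def)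
    also have "\<dots> \<le> T" by (intro wiener_boundD[OF T] finite_imageI F)
    finally show ?thesis .
  qed
  have T0: "T \<ge> 0" using wiener_boundD[OF T, of "{}"] by simp
  \<comment> \<open>unimodular weights \<open>s\<close> reduce the bound on a sum of moduli to one on the modulus of a sum,
      to which the convolution formula applies termwise\<close>
  have nle: "cmod (\<Sum>j\<in>F. s j * fcoeff (\<lambda>x. u x * v x) j) \<le> S * T" if s: "\<And>j. cmod (s j) = 1" for s
  proof -
    have hs: "((\<lambda>k. \<Sum>j\<in>F. s j * (fcoeff u k * fcoeff v (j - k))) has_sum (\<Sum>j\<in>F. s j * fcoeff (\<lambda>x. u x * v x) j)) UNIV"
      by (intro has_sum_finite_sum has_sum_cmult_right conv)
    have b: "cmod (\<Sum>j\<in>F. s j * (fcoeff u k * fcoeff v (j - k))) \<le> cmod (fcoeff u k) * T" for k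
    proof -
      have "cmod (\<Sum>j\<in>F. s j * (fcoeff u k * fcoeff v (j - k))) \<le> (\<Sum>j\<in>F. cmod (fcoeff u k) * cmod (fcoeff v (j - k)))"
        by (rule order_trans[OF norm_sum]) (simp add: norm_mult s)
      also have "\<dots> \<le> cmod (fcoeff u k) * T"
        unfolding sum_distrib_left[symmetric] by (intro mult_left_mono Tk) auto
      finally show ?thesis .
    qed
    have "cmod (\<Sum>j\<in>F. s j * fcoeff (\<lambda>x. u x * v x) j) \<le> (\<Sum>\<^sub>\<infinity>k. cmod (fcoeff u k) * T)"
      by (rule norm_infsum_le[OF hs has_sum_infsum b]) (intro summable_on_cmult_left sm)
    also have "\<dots> = (\<Sum>\<^sub>\<infinity>k. cmod (fcoeff u k)) * T"
      by (rule infsum_cmult_left')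
    also have "\<dots> \<le> S * T"
      by (intro mult_right_mono T0 infsum_le_finite_sums[OF sm]) (rule wiener_boundD[OF S])
    finally show ?thesis .
  qed
  let ?w = "\<lambda>j. fcoeff (\<lambda>x. u x * v x) j"
  \<comment> \<open>Conjugate phases of the coefficients, with the value 1 where a coefficient
    vanishes so that every weight is unimodular.\<close>
  define s where "s j = (if ?w j = 0 then 1 else cnj (?w j) / of_real (cmod (?w j)))" for j
  have s1: "cmod (s j) = 1" for j by (simp add: s_def norm_divide)
  have "s j * ?w j = of_real (cmod (?w j))" for j
  proof -
    have "?w j * cnj (?w j) = of_real (cmod (?w j)) * of_real (cmod (?w j))"
      by (simp flip: complex_norm_square add: power2_eq_square)
    then show ?thesis by (simp add: s_def mult.commute)
  qed
  then have "(\<Sum>j\<in>F. s j * ?w j) = of_real (\<Sum>j\<in>F. cmod (?w j))" by simp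
  with nle[of s, OF s1] show "(\<Sum>j\<in>F. cmod (?w j)) \<le> S * T"
    by (simp only: norm_of_real)
qed

section \<open>Fourier representation of the energy\<close>

lemma C1_fun_has_vector_derivative:
  assumes "C1_fun u"
  shows "((\<lambda>t. u (x + t *\<^sub>R axis i 1)) has_vector_derivative partial i u (x + t *\<^sub>R axis i 1)) (at t within A)"
proof -
  define y where "y = x + t *\<^sub>R axis i 1"
  have "((\<lambda>s. u (y + s *\<^sub>R axis i 1)) has_vector_derivative partial i u y) (at 0)"
    using assms unfolding C1_fun_def partial_def by (auto simp: vector_derivative_works[symmetric])
  moreover have "((\<lambda>s. s - t) has_vector_derivative 1) (at t)"
    by (auto intro!: derivative_eq_intros)
  ultimately have "((\<lambda>s. u (y + s *\<^sub>R axis i 1)) \<circ> (\<lambda>s. s - t) has_vector_derivative 1 *\<^sub>R partial i u y) (at t)"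
    by (intro vector_diff_chain_at) simp_all
  then have "((\<lambda>s. u (x + s *\<^sub>R axis i 1)) has_vector_derivative partial i u y) (at t)"
    by (simp add: o_def y_def algebra_simps)
  then show ?thesis
    unfolding y_def by (rule has_vector_derivative_at_within)
qed

lemma cont_torus_C1: "C1_fun u \<Longrightarrow> periodic u \<Longrightarrow> cont_torus u"
  by (simp add: cont_torus_def C1_fun_def)

lemma cont_torus_partial:
  assumes "C1_fun u" "periodic u"
  shows "cont_torus (partial i u)"
proof -
  have "u (x + (2 * pi) *\<^sub>R axis j 1 + t *\<^sub>R axis i 1) = u (x + t *\<^sub>R axis i 1)" for x j t
  proof -
    have "x + (2 * pi) *\<^sub>R axis j 1 + t *\<^sub>R axis i 1 = (x + t *\<^sub>R axis i 1) + (2 * pi) *\<^sub>R axis j 1"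
      by (simp add: add_ac)
    then show ?thesis using assms(2) by (simp only: periodic_def)
  qed
  then show ?thesis
    using assms(1) by (simp add: cont_torus_def C1_fun_def periodic_def partial_def)
qed

text \<open>
  Instead of integrating by parts, differentiate the translation invariance of the integral over
  the torus.
\<close>

lemma fcoeff_partial:
  fixes u :: "real ^ 'd \<Rightarrow> complex"
  assumes u: "C1_fun u" "periodic u"
  shows "fcoeff (partial i u) k = \<i> * of_int (k $ i) * fcoeff u k"
proof -
  define I where "I = integral torus_cube (\<lambda>x. u x * cnj (fmode k x))"
  define \<phi> where "\<phi> t = integral torus_cube (\<lambda>x. u (x + t *\<^sub>R axis i 1) * cnj (fmode k x))" for t
  have uc: "continuous_on S u" "continuous_on S (partial i u)" for S
    using cont_torus_C1[OF u] cont_torus_partial[OF u] by (auto intro: cont_torusD)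
  have 1: "(\<phi> has_vector_derivative integral torus_cube (\<lambda>x. partial i u (x + 0 *\<^sub>R axis i 1) * cnj (fmode k x))) (at 0 within {0..1})"
    unfolding \<phi>_def torus_cube_def
  proof (rule leibniz_rule_vector_derivative)
    show "((\<lambda>t. u (x + t *\<^sub>R axis i 1) * cnj (fmode k x)) has_vector_derivative
       partial i u (x + t *\<^sub>R axis i 1) * cnj (fmode k x)) (at t within {0..1})" for t x
      by (intro has_vector_derivative_mult_left C1_fun_has_vector_derivative u)
    show "(\<lambda>x. u (x + t *\<^sub>R axis i 1) * cnj (fmode k x)) integrable_on cbox (\<chi> i. - pi) (\<chi> i. pi)" for t
      by (intro integrable_continuous continuous_intros continuous_on_compose2[OF uc(1)[of UNIV]]) auto
    show "continuous_on ({0..1} \<times> cbox (\<chi> i. - pi) (\<chi> i. pi))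
       (\<lambda>(t, x). partial i u (x + t *\<^sub>R axis i 1) * cnj (fmode k x))"
      unfolding split_beta
      by (intro continuous_intros continuous_on_compose2[OF uc(2)[of UNIV]]) auto
  qed auto
  \<comment> \<open>Up to the phase of the mode, translating \<open>u\<close> amounts to translating
    the whole integrand, whose integral does not change. Only the derivative at 0 is compared, so
    the unit interval suffices; it lies within the shifts allowed above.\<close>
  have \<phi>: "\<phi> t = cis (of_int (k $ i) * t) * I" if "t \<in> {0..1}" for t
  proof -
    define g where "g x = u x * cnj (fmode k x)" for x
    have g: "cont_torus g"
      unfolding g_def by (intro cont_torus_mult cont_torus_cnj cont_torus_fmode cont_torus_C1 u)
    have "cis (of_int (k $ i) * t) * cnj (cis (of_int (k $ i) * t)) = 1"
      by (simp add: cis_cnj cis_mult)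
    then have "u (x + t *\<^sub>R axis i 1) * cnj (fmode k x) = cis (of_int (k $ i) * t) * g (x + t *\<^sub>R axis i 1)" for x
      unfolding g_def fmode_shift by (simp add: mult_ac)
    then have "\<phi> t = cis (of_int (k $ i) * t) * integral torus_cube (\<lambda>x. g (x + t *\<^sub>R axis i 1))"
      unfolding \<phi>_def by simp
    also have "t \<le> 2 * pi" using that pi_gt3 by simp
    then have "integral torus_cube (\<lambda>x. g (x + t *\<^sub>R axis i 1)) = integral torus_cube g"
      using that by (intro integral_torus_shift cont_torusD[OF g]) auto
    finally show ?thesis by (simp add: I_def g_def[abs_def])
  qed
  have "((\<lambda>t. cis (of_int (k $ i) * t) * I) has_vector_derivative (\<i> * of_int (k $ i)) * I) (at 0 within {0..1})"
  proof -
    have "((\<lambda>t. exp (\<i> * of_real (of_int (k $ i) * t)) * I) has_vector_derivative \<i> * of_int (k $ i) * I) (at 0 within {0..1})"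
      by (auto intro!: derivative_eq_intros has_vector_derivative_real_field)
    then show ?thesis by (simp add: cis_conv_exp)
  qed
  then have 2: "(\<phi> has_vector_derivative (\<i> * of_int (k $ i)) * I) (at 0 within {0..1})"
    by (rule has_vector_derivative_transform[rotated 2]) (simp_all add: \<phi>)
  have "integral torus_cube (\<lambda>x. partial i u x * cnj (fmode k x)) = (\<i> * of_int (k $ i)) * I"
    using vector_derivative_unique_within_closed_interval[of 0 1 0 \<phi>] 1 2 by simp
  then show ?thesis
    by (simp add: fcoeff_def I_def)
qed

text \<open>The sign is that of the negative operator: \<open>op_A\<close> multiplies mode k by
  minus this number, which is nonnegative for positive \<epsilon>.\<close>

definition laplace_eigval :: "real \<Rightarrow> int ^ 'd \<Rightarrow> real" where
  "laplace_eigval \<epsilon> k = (\<Sum>i\<in>UNIV. (of_int (k $ i))\<^sup>2) / \<epsilon>"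

definition torus_norm4 :: "(real ^ 'd \<Rightarrow> complex) \<Rightarrow> real" where
  "torus_norm4 u = integral torus_cube (\<lambda>x. (cmod (u x)) ^ 4) / (2 * pi) ^ CARD('d)"

text \<open>Parseval for each partial derivative turns the gradient term into a sum weighted by the
  squares of the frequencies. The quartic term stays an integral, since only its \<tau>-derivative
  is expanded in modes.\<close>

lemma energy_fourier:
  fixes u :: "real ^ 'd \<Rightarrow> complex"
  assumes u: "C1_fun u" "periodic u"
  shows "((\<lambda>k. laplace_eigval \<epsilon> k / 2 * (cmod (fcoeff u k))\<^sup>2) has_sum
           (energy \<epsilon> lam u - lam / 4 * torus_norm4 u)) UNIV"
proof -
  have c: "continuous_on torus_cube u" "continuous_on torus_cube (partial i u)" for i
    using cont_torus_C1[OF u] cont_torus_partial[OF u] by (auto intro: cont_torusD)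
  have int: "(\<lambda>x. (cmod (partial i u x))\<^sup>2) integrable_on torus_cube"
    "(\<lambda>x. (cmod (u x)) ^ 4) integrable_on torus_cube" for i
    by (intro integrable_torus continuous_intros c)+
  have "integral torus_cube (\<lambda>x. 1 / \<epsilon> * (\<Sum>i\<in>UNIV. (cmod (partial i u x))\<^sup>2) + 1 / 2 * lam * (cmod (u x)) ^ 4)
      = 1 / \<epsilon> * (\<Sum>i\<in>UNIV. integral torus_cube (\<lambda>x. (cmod (partial i u x))\<^sup>2))
        + 1 / 2 * lam * integral torus_cube (\<lambda>x. (cmod (u x)) ^ 4)"
    by (subst integral_add)
       (simp_all only: integral_mult_right integral_sum[OF finite int(1)] integrable_on_mult_right
          integrable_sum[OF finite int(1)] int(2))
  then have "energy \<epsilon> lam u - lam / 4 * torus_norm4 u = 1 / (2 * \<epsilon>) * (\<Sum>i\<in>UNIV. torus_norm2 (partial i u))"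
    unfolding energy_def torus_norm4_def torus_norm2_def
    by (simp add: sum_divide_distrib[symmetric] field_simps)
  moreover have "((\<lambda>k. 1 / (2 * \<epsilon>) * (\<Sum>i\<in>UNIV. (cmod (fcoeff (partial i u) k))\<^sup>2)) has_sum
      1 / (2 * \<epsilon>) * (\<Sum>i\<in>UNIV. torus_norm2 (partial i u))) UNIV"
    by (intro has_sum_cmult_right has_sum_finite_sum parseval cont_torus_partial u)
  moreover have "1 / (2 * \<epsilon>) * (\<Sum>i\<in>UNIV. (cmod (fcoeff (partial i u) k))\<^sup>2)
      = laplace_eigval \<epsilon> k / 2 * (cmod (fcoeff u k))\<^sup>2" for k
  proof -
    have "(\<Sum>i\<in>UNIV. (cmod (fcoeff (partial i u) k))\<^sup>2) = (\<Sum>i\<in>UNIV. (of_int (k $ i))\<^sup>2) * (cmod (fcoeff u k))\<^sup>2"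
      unfolding fcoeff_partial[OF u] sum_distrib_right
      by (simp add: norm_mult power_mult_distrib)
    then show ?thesis by (simp add: laplace_eigval_def)
  qed
  ultimately show ?thesis by (simp only:)
qed

section \<open>Fourier multipliers and their adjoints\<close>

text \<open>Indexing by the mode rather than by an eigenvalue puts \<open>M\<close>,
  \<open>K\<close> and all functions of \<open>K\<close> and \<open>V\<close> into one form, in
  which composition on trigonometric polynomials is pointwise multiplication.\<close>

definition fmultiplier :: "(int ^ 'd \<Rightarrow> complex) \<Rightarrow> (real ^ 'd \<Rightarrow> complex) \<Rightarrow> real ^ 'd \<Rightarrow> complex" where
  "fmultiplier m u x = (\<Sum>\<^sub>\<infinity>k. m k * fcoeff u k * fmode k x)"

lemma fun_calc_eq_fmultiplier: "fun_calc T \<phi> = fmultiplier (\<lambda>k. \<phi> (mode_eigval T k))"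
  by (simp add: fun_eq_iff fun_calc_def fmultiplier_def)

lemma torus_ip_trig_left:
  assumes "continuous_on torus_cube v"
  shows "torus_ip (\<lambda>x. \<Sum>k\<in>F. c k * fmode k x) v = (\<Sum>k\<in>F. c k * cnj (fcoeff v k))"
proof -
  have "torus_ip (\<lambda>x. \<Sum>k\<in>F. c k * fmode k x) v = (\<Sum>k\<in>F. torus_ip (\<lambda>x. c k * fmode k x) v)"
    by (intro torus_ip_sum_left assms continuous_intros)
  then show ?thesis
    by (simp add: torus_ip_cmul_left fcoeff_eq_ip torus_ip_commute[of _ v])
qed

lemma fcoeff_trig_sum:
  assumes "finite F"
  shows "fcoeff (\<lambda>x. \<Sum>k\<in>F. c k * fmode k x) j = (if j \<in> F then c j else 0)"
proof -
  have "fcoeff (\<lambda>x. \<Sum>k\<in>F. c k * fmode k x) j = (\<Sum>k\<in>F. c k * cnj (fcoeff (fmode j) k))"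
    unfolding fcoeff_eq_ip[of _ j] by (rule torus_ip_trig_left[OF cont_torusD(1)[OF cont_torus_fmode]])
  also have "\<dots> = (\<Sum>k\<in>F. if k = j then c k else 0)"
    by (intro sum.cong) (auto simp: fcoeff_eq_ip torus_ip_fmode)
  finally show ?thesis using assms by simp
qed

lemma fmultiplier_trig_sum:
  assumes "finite F"
  shows "fmultiplier m (\<lambda>x. \<Sum>k\<in>F. c k * fmode k x) = (\<lambda>x. \<Sum>k\<in>F. m k * c k * fmode k x)"
proof
  fix x
  have "((\<lambda>k. m k * (if k \<in> F then c k else 0) * fmode k x) has_sum (\<Sum>k\<in>F. m k * c k * fmode k x)) UNIV"
    using assms by (intro has_sum_finite_neutralI[of F]) (auto intro!: sum.cong)
  then show "fmultiplier m (\<lambda>x. \<Sum>k\<in>F. c k * fmode k x) x = (\<Sum>k\<in>F. m k * c k * fmode k x)"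
    unfolding fmultiplier_def fcoeff_trig_sum[OF assms] by (rule infsumI)
qed

lemma fmultiplier_fmode: "fmultiplier m (fmode k) = (\<lambda>x. m k * fmode k x)"
  using fmultiplier_trig_sum[of "{k}" m "\<lambda>_. 1"] by simp

lemma trig_polysE:
  assumes "u \<in> trig_polys"
  obtains F c where "finite F" "u = (\<lambda>x. \<Sum>k\<in>F. c k * fmode k x)"
  using assms unfolding trig_polys_def by blast

lemma fmultiplier_trig_polys:
  assumes "u \<in> trig_polys"
  shows "fmultiplier m u \<in> trig_polys"
    and "fcoeff (fmultiplier m u) k = m k * fcoeff u k"
    and "fmultiplier m' (fmultiplier m u) = fmultiplier (\<lambda>k. m' k * m k) u"
    and "fmultiplier (\<lambda>k. 1) u = u"
proof -
  obtain F c where F: "finite F" and u: "u = (\<lambda>x. \<Sum>k\<in>F. c k * fmode k x)"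
    using trig_polysE[OF assms] by blast
  show "fmultiplier m u \<in> trig_polys"
    unfolding u fmultiplier_trig_sum[OF F] by (rule trig_polysI[OF F])
  show m: "fcoeff (fmultiplier m u) k = m k * fcoeff u k" for m k
    unfolding u fmultiplier_trig_sum[OF F] fcoeff_trig_sum[OF F] by simp
  show "fmultiplier m' (fmultiplier m u) = fmultiplier (\<lambda>k. m' k * m k) u"
    unfolding u fmultiplier_trig_sum[OF F] by (simp add: mult.assoc)
  show "fmultiplier (\<lambda>k. 1) u = u"
    unfolding u fmultiplier_trig_sum[OF F] by simp
qed

lemma torus_ip_fmultiplier_left:
  assumes u: "u \<in> trig_polys" and v: "v \<in> trig_polys"
  shows "torus_ip (fmultiplier m u) v = torus_ip u (fmultiplier (\<lambda>k. cnj (m k)) v)"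
proof -
  obtain F c where F: "finite F" and u: "u = (\<lambda>x. \<Sum>k\<in>F. c k * fmode k x)"
    using trig_polysE[OF u] by blast
  have vc: "continuous_on torus_cube v" "continuous_on torus_cube (fmultiplier (\<lambda>k. cnj (m k)) v)"
    using v fmultiplier_trig_polys(1)[OF v] by (auto intro: cont_torusD cont_torus_trig_polys)
  show ?thesis
    unfolding u fmultiplier_trig_sum[OF F] torus_ip_trig_left[OF vc(1)] torus_ip_trig_left[OF vc(2)]
    by (simp add: fmultiplier_trig_polys(2)[OF v] mult_ac)
qed

section \<open>Real pairs, transposes, and the multipliers of M and K\<close>

lemma to_real_to_complex [simp]: "to_real (to_complex y) = y"
  by (simp add: fun_eq_iff to_real_def to_complex_def)

lemma to_complex_to_real [simp]: "to_complex (to_real u) = u"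
  by (simp add: fun_eq_iff to_real_def to_complex_def)

definition fmultiplier_real ::
  "(int ^ 'd \<Rightarrow> complex) \<Rightarrow> (real ^ 'd \<Rightarrow> real \<times> real) \<Rightarrow> real ^ 'd \<Rightarrow> real \<times> real" where
  "fmultiplier_real m y = to_real (fmultiplier m (to_complex y))"

text \<open>Agreement is asked for on trigonometric polynomials only: this is the space on which
  \<open>L2_adjoint\<close> is characterised, and elsewhere the derivatives in \<open>op_M\<close>
  and \<open>op_K\<close> need not exist.\<close>

definition acts_as :: "((real ^ 'd \<Rightarrow> real \<times> real) \<Rightarrow> real ^ 'd \<Rightarrow> real \<times> real) \<Rightarrow> (int ^ 'd \<Rightarrow> complex) \<Rightarrow> bool" where
  "acts_as T m \<longleftrightarrow> (\<forall>y\<in>real_trig_polys. T y = fmultiplier_real m y)"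

lemma fmultiplier_real_in: "y \<in> real_trig_polys \<Longrightarrow> fmultiplier_real m y \<in> real_trig_polys"
  by (simp add: real_trig_polys_def fmultiplier_real_def fmultiplier_trig_polys)

lemma acts_as_comp:
  assumes "acts_as T m" "acts_as T' m'"
  shows "acts_as (T \<circ> T') (\<lambda>k. m k * m' k)"
  unfolding acts_as_def
proof
  fix y :: "real ^ 'a \<Rightarrow> real \<times> real" assume y: "y \<in> real_trig_polys"
  then have "(T \<circ> T') y = fmultiplier_real m (fmultiplier_real m' y)"
    using assms fmultiplier_real_in[OF y] by (simp add: acts_as_def)
  also have "\<dots> = fmultiplier_real (\<lambda>k. m k * m' k) y"
    using y by (simp add: fmultiplier_real_def fmultiplier_trig_polys real_trig_polys_def)
  finally show "(T \<circ> T') y = fmultiplier_real (\<lambda>k. m k * m' k) y" .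
qed

lemma L2_inner_eq:
  fixes y w :: "real ^ 'd \<Rightarrow> real \<times> real"
  assumes y: "y \<in> real_trig_polys" and w: "w \<in> real_trig_polys"
  shows "L2_inner y w = (2 * pi) ^ CARD('d) * Re (torus_ip (to_complex y) (to_complex w))"
proof -
  have c: "continuous_on torus_cube (to_complex y)" "continuous_on torus_cube (to_complex w)"
    using y w by (auto simp: real_trig_polys_def intro: cont_torusD cont_torus_trig_polys)
  have "y x \<bullet> w x = Re (to_complex y x * cnj (to_complex w x))" for x
    by (simp add: to_complex_def inner_prod_def)
  then have "L2_inner y w = integral torus_cube (\<lambda>x. Re (to_complex y x * cnj (to_complex w x)))"
    by (simp add: L2_inner_def)
  also have "\<dots> = Re (integral torus_cube (\<lambda>x. to_complex y x * cnj (to_complex w x)))"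
    using integral_linear[OF integrable_torus_ip[OF c] bounded_linear_Re] by (simp only: o_def)
  finally show ?thesis
    unfolding torus_ip_def Re_divide_of_real by simp
qed

lemma L2_inner_unique:
  fixes z z' :: "real ^ 'd \<Rightarrow> real \<times> real"
  assumes z: "z \<in> real_trig_polys" "z' \<in> real_trig_polys"
    and eq: "\<And>y. y \<in> real_trig_polys \<Longrightarrow> L2_inner y z = L2_inner y z'"
  shows "z = z'"
proof -
  have zt: "to_complex z \<in> trig_polys" "to_complex z' \<in> trig_polys"
    using z by (auto simp: real_trig_polys_def)
  have "fcoeff (to_complex z) k = fcoeff (to_complex z') k" for k
  proof -
    define c where "c = fcoeff (to_complex z) k - fcoeff (to_complex z') k"
    \<comment> \<open>The real inner product detects only real parts. With the coefficient
      difference \<open>c\<close> itself as amplitude, the tested quantity becomes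
      \<open>c * cnj c\<close>, so both parts of \<open>c\<close> vanish.\<close>
    define y where "y = to_real (\<lambda>x. c * fmode k x)"
    have y: "y \<in> real_trig_polys"
      by (simp add: y_def real_trig_polys_def trig_polys_fmode)
    have "Re (torus_ip (to_complex y) (to_complex z)) = Re (torus_ip (to_complex y) (to_complex z'))"
      using eq[OF y] by (simp add: L2_inner_eq y z)
    moreover have "torus_ip (to_complex y) v = c * cnj (fcoeff v k)" for v
      by (simp add: y_def torus_ip_cmul_left fcoeff_eq_ip torus_ip_commute[of _ v])
    ultimately have "Re (c * cnj c) = 0"
      by (simp add: c_def algebra_simps)
    then have "(Re c)\<^sup>2 + (Im c)\<^sup>2 = 0" by (simp add: power2_eq_square)
    then have "c = 0" by (simp add: complex_eq_iff sum_power2_eq_zero_iff)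
    then show ?thesis by (simp add: c_def)
  qed
  then have "fmultiplier (\<lambda>k. 1) (to_complex z) = fmultiplier (\<lambda>k. 1) (to_complex z')"
    by (simp add: fun_eq_iff fmultiplier_def)
  then have "to_complex z = to_complex z'"
    by (simp only: fmultiplier_trig_polys(4)[OF zt(1)] fmultiplier_trig_polys(4)[OF zt(2)])
  then have "to_real (to_complex z) = to_real (to_complex z')" by (rule arg_cong)
  then show ?thesis by (simp only: to_real_to_complex)
qed

text \<open>The real inner product is a multiple of the real part of the complex one, so transposing
  conjugates the multiplier. Uniqueness among trigonometric polynomials makes the definite
  description in \<open>L2_adjoint\<close> meaningful.\<close>

lemma acts_as_L2_adjoint:
  assumes "acts_as T m"
  shows "acts_as (L2_adjoint T) (\<lambda>k. cnj (m k))"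
  unfolding acts_as_def
proof
  fix w :: "real ^ 'a \<Rightarrow> real \<times> real" assume w: "w \<in> real_trig_polys"
  let ?z = "fmultiplier_real (\<lambda>k. cnj (m k)) w"
  have z: "?z \<in> real_trig_polys" by (rule fmultiplier_real_in[OF w])
  have adj: "L2_inner (T y) w = L2_inner y ?z" if y: "y \<in> real_trig_polys" for y
  proof -
    have "L2_inner (T y) w = L2_inner (fmultiplier_real m y) w"
      using assms y by (simp add: acts_as_def)
    also have "\<dots> = L2_inner y ?z"
      unfolding L2_inner_eq[OF fmultiplier_real_in[OF y] w] L2_inner_eq[OF y z]
      using y w by (simp add: fmultiplier_real_def real_trig_polys_def torus_ip_fmultiplier_left)
    finally show ?thesis .
  qed
  show "L2_adjoint T w = ?z"
    unfolding L2_adjoint_def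
    by (rule the_equality) (use z adj L2_inner_unique in auto)
qed

text \<open>The versions for real and imaginary parts are there because \<open>op_M\<close>
  differentiates the two components of a real pair separately.\<close>

lemma partial_trig_sum:
  "partial i (\<lambda>x. \<Sum>k\<in>F. c k * fmode k x) = (\<lambda>x. \<Sum>k\<in>F. (\<i> * of_int (k $ i)) * c k * fmode k x)"
  "partial i (\<lambda>x. Re (\<Sum>k\<in>F. c k * fmode k x)) = (\<lambda>x. Re (\<Sum>k\<in>F. (\<i> * of_int (k $ i)) * c k * fmode k x))"
  "partial i (\<lambda>x. Im (\<Sum>k\<in>F. c k * fmode k x)) = (\<lambda>x. Im (\<Sum>k\<in>F. (\<i> * of_int (k $ i)) * c k * fmode k x))"
proof -
  have d: "((\<lambda>t. \<Sum>k\<in>F. c k * fmode k (x + t *\<^sub>R axis i 1)) has_vector_derivative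
     (\<Sum>k\<in>F. (\<i> * of_int (k $ i)) * c k * fmode k x)) (at 0)" for x
    using has_vector_derivative_fmode[of "c k" k x i for k]
    by (intro has_vector_derivative_sum) (simp add: mult_ac)
  show "partial i (\<lambda>x. \<Sum>k\<in>F. c k * fmode k x) = (\<lambda>x. \<Sum>k\<in>F. (\<i> * of_int (k $ i)) * c k * fmode k x)"
    unfolding partial_def by (intro ext vector_derivative_at d)
  show "partial i (\<lambda>x. Re (\<Sum>k\<in>F. c k * fmode k x)) = (\<lambda>x. Re (\<Sum>k\<in>F. (\<i> * of_int (k $ i)) * c k * fmode k x))"
    unfolding partial_def
    by (intro ext vector_derivative_at bounded_linear.has_vector_derivative[OF bounded_linear_Re] d)
  show "partial i (\<lambda>x. Im (\<Sum>k\<in>F. c k * fmode k x)) = (\<lambda>x. Im (\<Sum>k\<in>F. (\<i> * of_int (k $ i)) * c k * fmode k x))"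
    unfolding partial_def
    by (intro ext vector_derivative_at bounded_linear.has_vector_derivative[OF bounded_linear_Im] d)
qed

lemma acts_as_op_M:
  "acts_as (op_M \<epsilon> :: (real ^ 'd \<Rightarrow> real \<times> real) \<Rightarrow> _) (\<lambda>k. - of_real (laplace_eigval \<epsilon> k))"
  unfolding acts_as_def
proof (intro ballI ext)
  fix y :: "real ^ 'd \<Rightarrow> real \<times> real" and x assume "y \<in> real_trig_polys"
  then obtain F c where F: "finite F" and y: "to_complex y = (\<lambda>x. \<Sum>k\<in>F. c k * fmode k x)"
    unfolding real_trig_polys_def by (blast elim: trig_polysE)
  have Re: "fst (y x) = Re (\<Sum>k\<in>F. c k * fmode k x)" and Im: "snd (y x) = Im (\<Sum>k\<in>F. c k * fmode k x)" for x
    using fun_cong[OF y, of x] by (simp_all add: to_complex_def complex_eq_iff)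
  have L: "(\<Sum>i\<in>UNIV. \<Sum>k\<in>F. (\<i> * of_int (k $ i)) * ((\<i> * of_int (k $ i)) * c k) * fmode k x)
      = (\<Sum>k\<in>F. - of_real (\<Sum>i\<in>UNIV. (of_int (k $ i))\<^sup>2) * c k * fmode k x)"
  proof (subst sum.swap, intro sum.cong refl)
    fix k
    have "(\<i> * of_int (k $ i)) * ((\<i> * of_int (k $ i)) * c k) * fmode k x = - ((of_int (k $ i))\<^sup>2 * (c k * fmode k x))" for i
      by (simp add: power2_eq_square algebra_simps)
    then show "(\<Sum>i\<in>UNIV. (\<i> * of_int (k $ i)) * ((\<i> * of_int (k $ i)) * c k) * fmode k x)
        = - of_real (\<Sum>i\<in>UNIV. (of_int (k $ i))\<^sup>2) * c k * fmode k x"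
      by (simp add: sum_distrib_right sum_negf mult.assoc)
  qed
  have aux: "(a * Re (Z x), a * Im (Z x)) = to_real (\<lambda>x. of_real a * Z x) x" for a and Z :: "real ^ 'd \<Rightarrow> complex" and x
    by (simp add: to_real_def)
  have "op_M \<epsilon> y x = (1 / \<epsilon> * Re (\<Sum>k\<in>F. - of_real (\<Sum>i\<in>UNIV. (of_int (k $ i))\<^sup>2) * c k * fmode k x),
      1 / \<epsilon> * Im (\<Sum>k\<in>F. - of_real (\<Sum>i\<in>UNIV. (of_int (k $ i))\<^sup>2) * c k * fmode k x))"
    unfolding op_M_def op_A_def laplacian_def Re Im partial_trig_sum L[symmetric]
    by (simp only: Re_sum Im_sum real_scaleR_def)
  also have "\<dots> = to_real (\<lambda>x. of_real (1 / \<epsilon>) * (\<Sum>k\<in>F. - of_real (\<Sum>i\<in>UNIV. (of_int (k $ i))\<^sup>2) * c k * fmode k x)) x"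
    by (rule aux)
  also have "(\<lambda>x. of_real (1 / \<epsilon>) * (\<Sum>k\<in>F. - of_real (\<Sum>i\<in>UNIV. (of_int (k $ i))\<^sup>2) * c k * fmode k x))
     = (\<lambda>x. \<Sum>k\<in>F. - of_real (laplace_eigval \<epsilon> k) * c k * fmode k x)"
    unfolding sum_distrib_left laplace_eigval_def
    by (intro ext sum.cong) (simp_all add: field_simps)
  also have "to_real (\<lambda>x. \<Sum>k\<in>F. - of_real (laplace_eigval \<epsilon> k) * c k * fmode k x) x
     = fmultiplier_real (\<lambda>k. - of_real (laplace_eigval \<epsilon> k)) y x"
    unfolding fmultiplier_real_def y fmultiplier_trig_sum[OF F] ..
  finally show "op_M \<epsilon> y x = fmultiplier_real (\<lambda>k. - of_real (laplace_eigval \<epsilon> k)) y x" .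
qed

lemma mode_eigval_op_V_laplace: "mode_eigval (op_V \<epsilon> h) k = - \<i> * of_real (h * laplace_eigval \<epsilon> k)"
  by (simp add: mode_eigval_op_V laplace_eigval_def)

text \<open>Under the identification of pairs with complex numbers \<open>op_J\<close> is
  multiplication by \<open>\<i>\<close>, so \<open>K\<close> and \<open>V\<close> share their
  eigenvalues.\<close>

lemma acts_as_op_K:
  "acts_as (op_K \<epsilon> h :: (real ^ 'd \<Rightarrow> real \<times> real) \<Rightarrow> _) (mode_eigval (op_V \<epsilon> h))"
  unfolding acts_as_def
proof (intro ballI ext)
  fix y :: "real ^ 'd \<Rightarrow> real \<times> real" and x assume y: "y \<in> real_trig_polys"
  then obtain F c where F: "finite F" and yc: "to_complex y = (\<lambda>x. \<Sum>k\<in>F. c k * fmode k x)"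
    unfolding real_trig_polys_def by (blast elim: trig_polysE)
  let ?m = "\<lambda>k. - complex_of_real (laplace_eigval \<epsilon> k)"
  have M: "op_M \<epsilon> y = to_real (fmultiplier ?m (to_complex y))"
    using acts_as_op_M[where 'd = 'd, of \<epsilon>] y by (simp add: acts_as_def fmultiplier_real_def)
  have "op_K \<epsilon> h y x = to_real (\<lambda>x. \<i> * of_real h * fmultiplier ?m (to_complex y) x) x"
    by (simp add: op_K_def op_J_def M to_real_def)
  also have "(\<lambda>x. \<i> * of_real h * fmultiplier ?m (to_complex y) x) = fmultiplier (mode_eigval (op_V \<epsilon> h)) (to_complex y)"
    unfolding yc fmultiplier_trig_sum[OF F] sum_distrib_left mode_eigval_op_V_laplace
    by (intro ext sum.cong) (simp_all add: mult_ac)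
  finally show "op_K \<epsilon> h y x = fmultiplier_real (mode_eigval (op_V \<epsilon> h)) y x"
    by (simp add: fmultiplier_real_def)
qed

lemma acts_as_fun_calc_real: "acts_as (fun_calc_real (op_K \<epsilon> h) \<phi>) (\<lambda>k. \<phi> (mode_eigval (op_V \<epsilon> h) k))"
  by (simp add: acts_as_def fun_calc_real_def fmultiplier_real_def fun_calc_eq_fmultiplier mode_eigval_op_K)

lemma to_real_fmode: "to_real (fmode k) \<in> real_trig_polys"
  using trig_polys_fmode[of 1 k] by (simp add: real_trig_polys_def)

text \<open>All modes equal 1 at the origin, so evaluating there returns the multiplier. Operator
  identities become scalar ones through this evaluation.\<close>

lemma acts_as_at_0:
  assumes "acts_as T m"
  shows "T (to_real (fmode k)) 0 = (Re (m k), Im (m k))"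
proof -
  have "fmode k 0 = 1" by (simp add: fmode_def)
  with assms to_real_fmode[of k] show ?thesis
    by (simp add: acts_as_def fmultiplier_real_def fmultiplier_fmode to_real_def)
qed

section \<open>One step of the integrator\<close>

lemma integral_cnj': "integral S (\<lambda>x. cnj (f x)) = cnj (integral S f)"
  by (simp add: integral_cnj)

lemma continuous_on_slices:
  assumes "continuous_on (S \<times> T) (\<lambda>(x, y). f x y)"
  shows "x \<in> S \<Longrightarrow> continuous_on T (\<lambda>y. f x y)" and "y \<in> T \<Longrightarrow> continuous_on S (\<lambda>x. f x y)"
    and "continuous_on (T \<times> S) (\<lambda>(y, x). f x y)"
proof -
  show "continuous_on T (\<lambda>y. f x y)" if "x \<in> S"
  proof -
    have "continuous_on T (\<lambda>y. case (x, y) of (x, y) \<Rightarrow> f x y)"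
      by (rule continuous_on_compose2[OF assms]) (use that in \<open>auto intro!: continuous_on_Pair continuous_on_const continuous_on_id\<close>)
    then show ?thesis by simp
  qed
  show "continuous_on S (\<lambda>x. f x y)" if "y \<in> T"
  proof -
    have "continuous_on S (\<lambda>x. case (x, y) of (x, y) \<Rightarrow> f x y)"
      by (rule continuous_on_compose2[OF assms]) (use that in \<open>auto intro!: continuous_on_Pair continuous_on_const continuous_on_id\<close>)
    then show ?thesis by simp
  qed
  have "continuous_on (T \<times> S) (\<lambda>z. case (snd z, fst z) of (x, y) \<Rightarrow> f x y)"
    by (rule continuous_on_compose2[OF assms]) (auto intro!: continuous_intros)
  then show "continuous_on (T \<times> S) (\<lambda>(y, x). f x y)"
    by (simp add: split_beta)
qed

text \<open>Expand the square of \<open>p * w + h * X\<close>, where \<open>X\<close> is the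
  integral of \<open>a * F\<close>. The cross term is cancelled by the part of the integral that is
  linear in \<open>w\<close>, and the term in the square of \<open>cmod X\<close> by the double
  integral. The latter enters only through its imaginary part, that is, through its difference from
  its conjugate, and \<open>sym\<close> factors the integrand of this difference into a product that
  integrates to a multiple of \<open>X * cnj X\<close>.\<close>

lemma mode_balance:
  fixes F a :: "real \<Rightarrow> complex" and a' :: "real \<Rightarrow> real \<Rightarrow> complex" and p w :: complex and \<alpha> h :: real
  assumes F: "continuous_on {0..1} F" and a: "continuous_on {0..1} a"
    and a': "continuous_on ({0..1} \<times> {0..1}) (\<lambda>(\<tau>, \<sigma>). a' \<tau> \<sigma>)"
    and p: "cmod p = 1"
    and sym: "\<And>\<tau> \<sigma>. \<tau> \<in> {0..1} \<Longrightarrow> \<sigma> \<in> {0..1} \<Longrightarrow>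
       a' \<tau> \<sigma> - cnj (a' \<sigma> \<tau>) = - \<i> * of_real (h * \<alpha>) * (cnj (a \<tau>) * a \<sigma>)"
  shows "\<alpha> / 2 * (cmod (p * w + of_real h * integral {0..1} (\<lambda>\<sigma>. a \<sigma> * F \<sigma>)))\<^sup>2
      + integral {0..1} (\<lambda>\<tau>. Re ((p * cnj (a \<tau>) * (- \<i> * of_real (h * \<alpha>)) * w
            + of_real h * integral {0..1} (\<lambda>\<sigma>. a' \<tau> \<sigma> * F \<sigma>)) * cnj (\<i> * F \<tau>)))
      = \<alpha> / 2 * (cmod w)\<^sup>2"
proof -
  define X where "X = integral {0..1} (\<lambda>\<sigma>. a \<sigma> * F \<sigma>)"
  define b where "b \<tau> \<sigma> = cnj (F \<tau>) * (a' \<tau> \<sigma> * F \<sigma>)" for \<tau> \<sigma>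
  define D where "D = integral {0..1} (\<lambda>\<tau>. integral {0..1} (b \<tau>))"
  have b_cont: "continuous_on ({0..1} \<times> {0..1}) (\<lambda>(\<tau>, \<sigma>). b \<tau> \<sigma>)"
    using a' unfolding b_def split_beta
    by (intro continuous_intros continuous_on_compose2[OF F]) auto
  have b1: "continuous_on {0..1} (b \<tau>)" if "\<tau> \<in> {0..1}" for \<tau>
    by (rule continuous_on_slices(1)[OF b_cont that])
  have b2: "continuous_on {0..1} (\<lambda>\<sigma>. b \<sigma> \<tau>)" if "\<tau> \<in> {0..1}" for \<tau>
    by (rule continuous_on_slices(2)[OF b_cont that])
  have bi: "continuous_on {0..1} (\<lambda>\<tau>. integral {0..1} (b \<tau>))"
    using integral_continuous_on_param[of "{0..1}" 0 1 b] b_cont by simp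
  have b_cont': "continuous_on ({0..1} \<times> {0..1}) (\<lambda>(\<tau>, \<sigma>). b \<sigma> \<tau>)"
    by (rule continuous_on_slices(3)[OF b_cont])
  have bi': "continuous_on {0..1} (\<lambda>\<tau>. integral {0..1} (\<lambda>\<sigma>. b \<sigma> \<tau>))"
    using integral_continuous_on_param[of "{0..1}" 0 1 "\<lambda>\<tau> \<sigma>. b \<sigma> \<tau>"] b_cont' by simp
  \<comment> \<open>Exchanging the order of integration in the conjugate copy of \<open>D\<close>
    brings \<open>a' \<tau> \<sigma>\<close> and the conjugate of \<open>a' \<sigma> \<tau>\<close>
    under one integral, which is the combination in \<open>sym\<close>.\<close>
  have swap: "D = integral {0..1} (\<lambda>\<tau>. integral {0..1} (\<lambda>\<sigma>. b \<sigma> \<tau>))"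
    using integral_swap_continuous[of 0 0 1 1 b] b_cont by (simp add: D_def cbox_Pair_eq)
  have aF: "continuous_on {0..1} (\<lambda>\<sigma>. a \<sigma> * F \<sigma>)"
    by (intro continuous_intros a F)
  have "D - cnj D = integral {0..1} (\<lambda>\<tau>. integral {0..1} (b \<tau>)) - integral {0..1} (\<lambda>\<tau>. cnj (integral {0..1} (\<lambda>\<sigma>. b \<sigma> \<tau>)))"
    by (simp only: swap[symmetric] integral_cnj') (simp only: D_def)
  also have "\<dots> = integral {0..1} (\<lambda>\<tau>. integral {0..1} (b \<tau>) - cnj (integral {0..1} (\<lambda>\<sigma>. b \<sigma> \<tau>)))"
    by (intro integral_diff[symmetric] integrable_continuous_real continuous_intros bi bi')
  also have "\<dots> = integral {0..1} (\<lambda>\<tau>. integral {0..1} (\<lambda>\<sigma>. b \<tau> \<sigma> - cnj (b \<sigma> \<tau>)))"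
    unfolding integral_cnj'[symmetric]
    by (intro integral_cong integral_diff[symmetric] integrable_continuous_real continuous_intros b1 b2)
  also have "\<dots> = integral {0..1} (\<lambda>\<tau>. integral {0..1} (\<lambda>\<sigma>. - \<i> * of_real (h * \<alpha>) * cnj (a \<tau> * F \<tau>) * (a \<sigma> * F \<sigma>)))"
  proof (intro integral_cong)
    fix \<tau> \<sigma> :: real assume "\<tau> \<in> {0..1}" "\<sigma> \<in> {0..1}"
    have "b \<tau> \<sigma> - cnj (b \<sigma> \<tau>) = (a' \<tau> \<sigma> - cnj (a' \<sigma> \<tau>)) * (cnj (F \<tau>) * F \<sigma>)"
      by (simp add: b_def algebra_simps)
    then show "b \<tau> \<sigma> - cnj (b \<sigma> \<tau>) = - \<i> * of_real (h * \<alpha>) * cnj (a \<tau> * F \<tau>) * (a \<sigma> * F \<sigma>)"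
      unfolding sym[OF \<open>\<tau> \<in> {0..1}\<close> \<open>\<sigma> \<in> {0..1}\<close>] by (simp add: mult_ac)
  qed
  also have "\<dots> = integral {0..1} (\<lambda>\<tau>. - \<i> * of_real (h * \<alpha>) * X * cnj (a \<tau> * F \<tau>))"
    by (intro integral_cong) (simp only: integral_mult_right X_def, simp only: mult_ac)
  also have "\<dots> = - \<i> * of_real (h * \<alpha>) * X * cnj X"
    unfolding integral_mult_right integral_cnj' X_def[symmetric] ..
  also have "\<dots> = - \<i> * of_real (h * \<alpha> * (cmod X)\<^sup>2)"
    unfolding of_real_mult complex_norm_square by (simp add: mult_ac)
  finally have "Im (D - cnj D) = Im (- \<i> * of_real (h * \<alpha> * (cmod X)\<^sup>2))" by (rule arg_cong)
  then have ImD: "2 * Im D = - (h * \<alpha> * (cmod X)\<^sup>2)" by simp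
  \<comment> \<open>The factor \<open>- \<i>\<close> of the eigenvalue and the one from
    \<open>cnj (\<i> * F \<tau>)\<close> multiply to -1. Conjugating inside the real part then
    leaves \<open>a \<tau> * F \<tau>\<close> without conjugates, with this constant in
    front.\<close>
  define c where "c = of_real (- (h * \<alpha>)) * cnj (p * w)"
  have G: "Re ((p * cnj (a \<tau>) * (- \<i> * of_real (h * \<alpha>)) * w
            + of_real h * integral {0..1} (\<lambda>\<sigma>. a' \<tau> \<sigma> * F \<sigma>)) * cnj (\<i> * F \<tau>))
       = Re (c * (a \<tau> * F \<tau>)) + h * Im (integral {0..1} (b \<tau>))" for \<tau>
  proof -
    have "integral {0..1} (b \<tau>) = cnj (F \<tau>) * integral {0..1} (\<lambda>\<sigma>. a' \<tau> \<sigma> * F \<sigma>)"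
      unfolding b_def by (rule integral_mult_right)
    moreover have "Re ((p * cnj x * (- \<i> * of_real (h * \<alpha>)) * w + of_real h * z) * cnj (\<i> * y))
      = Re (c * (x * y)) + h * Im (cnj y * z)" for x y z
      by (simp add: c_def algebra_simps)
    ultimately show ?thesis by simp
  qed
  have "integral {0..1} (\<lambda>\<tau>. Re (c * (a \<tau> * F \<tau>)) + h * Im (integral {0..1} (b \<tau>)))
      = integral {0..1} (\<lambda>\<tau>. Re (c * (a \<tau> * F \<tau>))) + integral {0..1} (\<lambda>\<tau>. h * Im (integral {0..1} (b \<tau>)))"
    by (intro integral_add integrable_continuous_real continuous_intros aF bi)
  also have "integral {0..1} (\<lambda>\<tau>. Re (c * (a \<tau> * F \<tau>))) = Re (integral {0..1} (\<lambda>\<tau>. c * (a \<tau> * F \<tau>)))"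
    using integral_linear[OF _ bounded_linear_Re, of "\<lambda>\<tau>. c * (a \<tau> * F \<tau>)" "{0..1}"]
    by (simp only: o_def integrable_continuous_real continuous_on_mult_left aF)
  also have "integral {0..1} (\<lambda>\<tau>. c * (a \<tau> * F \<tau>)) = c * X"
    unfolding X_def by (rule integral_mult_right)
  also have "integral {0..1} (\<lambda>\<tau>. h * Im (integral {0..1} (b \<tau>))) = h * Im D"
    using integral_linear[OF _ bounded_linear_Im, of "\<lambda>\<tau>. integral {0..1} (b \<tau>)" "{0..1}"]
    by (simp only: D_def o_def integrable_continuous_real bi integral_mult_right)
  finally have I: "integral {0..1} (\<lambda>\<tau>. Re (c * (a \<tau> * F \<tau>)) + h * Im (integral {0..1} (b \<tau>)))
      = Re (c * X) + h * Im D" .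
  have e1: "(cmod (p * w + of_real h * X))\<^sup>2 = (cmod (p * w))\<^sup>2 + 2 * h * Re (cnj (p * w) * X) + h\<^sup>2 * (cmod X)\<^sup>2"
    unfolding cmod_power2 by (simp add: power2_eq_square algebra_simps)
  have e2: "(cmod (p * w))\<^sup>2 = (cmod w)\<^sup>2" by (simp add: norm_mult p)
  have e3: "Re (c * X) = - (h * \<alpha>) * Re (cnj (p * w) * X)"
  proof -
    have "Re (of_real r * z) = r * Re z" for r z by simp
    then show ?thesis unfolding c_def by (simp only: mult.assoc)
  qed
  have e4: "h * Im D = - (h * (h * \<alpha> * (cmod X)\<^sup>2)) / 2" using ImD by (simp add: field_simps)
  have "\<alpha> / 2 * (n + 2 * h * r + h\<^sup>2 * y) + (- (h * \<alpha>) * r + - (h * (h * \<alpha> * y)) / 2) = \<alpha> / 2 * n" for n r y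
    by (simp add: field_simps power2_eq_square)
  then show ?thesis
    unfolding G I X_def[symmetric] e1 e2 e3 e4 .
qed

text \<open>On a compact set the derivative is bounded, so \<open>w\<close> is Lipschitz in \<tau>
  uniformly in x; together with continuity in x at fixed \<tau> this is joint continuity. The
  regularity of the stages states joint continuity for the derivative only.\<close>

lemma continuous_on_vector_derivative_param:
  fixes w :: "real \<Rightarrow> 'a::metric_space \<Rightarrow> 'b::banach"
  assumes K: "compact K"
    and w: "\<And>\<tau>. \<tau> \<in> {0..1} \<Longrightarrow> continuous_on K (w \<tau>)"
    and w': "continuous_on ({0..1} \<times> K) (\<lambda>(\<tau>, x). w' \<tau> x)"
    and deriv: "\<And>\<tau> x. \<tau> \<in> {0..1} \<Longrightarrow> x \<in> K \<Longrightarrow> ((\<lambda>\<tau>. w \<tau> x) has_vector_derivative w' \<tau> x) (at \<tau> within {0..1})"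
  shows "continuous_on ({0..1} \<times> K) (\<lambda>(\<tau>, x). w \<tau> x)"
proof -
  have "bounded ((\<lambda>(\<tau>, x). w' \<tau> x) ` ({0..1} \<times> K))"
    by (intro compact_imp_bounded compact_continuous_image w' compact_Times K) auto
  then obtain B0 where B0: "\<And>\<tau> x. \<tau> \<in> {0..1} \<Longrightarrow> x \<in> K \<Longrightarrow> norm (w' \<tau> x) \<le> B0"
    unfolding bounded_iff by fastforce
  \<comment> \<open>The lower bound 1 permits the division by \<open>2 * B\<close> even if the
    derivative vanishes identically.\<close>
  define B where "B = max B0 1"
  have B: "norm (w' \<tau> x) \<le> B" if "\<tau> \<in> {0..1}" "x \<in> K" for \<tau> x
    using B0[OF that] by (simp add: B_def)
  have B1: "B \<ge> 1" by (simp add: B_def)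
  have lip: "norm (w \<tau> x - w \<sigma> x) \<le> B * norm (\<tau> - \<sigma>)" if "\<tau> \<in> {0..1}" "\<sigma> \<in> {0..1}" "x \<in> K" for \<tau> \<sigma> x
  proof (rule differentiable_bound[of "{0..1}" "\<lambda>\<tau>. w \<tau> x" "\<lambda>\<tau> t. t *\<^sub>R w' \<tau> x"])
    show "((\<lambda>\<tau>. w \<tau> x) has_derivative (\<lambda>t. t *\<^sub>R w' \<tau> x)) (at \<tau> within {0..1})" if "\<tau> \<in> {0..1}" for \<tau>
      using deriv[OF that \<open>x \<in> K\<close>] by (simp add: has_vector_derivative_def)
    show "onorm (\<lambda>t. t *\<^sub>R w' \<tau> x) \<le> B" if "\<tau> \<in> {0..1}" for \<tau>
      using B[OF that \<open>x \<in> K\<close>] B1 by (intro onorm_le) (simp add: mult.commute[of B] mult_left_mono)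
  qed (use that in auto)
  show ?thesis
    unfolding continuous_on_iff
  proof (intro ballI allI impI)
    fix z :: "real \<times> 'a" and e :: real
    assume z: "z \<in> {0..1} \<times> K" and e: "0 < e"
    obtain \<tau> x where zx: "z = (\<tau>, x)" by (cases z)
    with z have \<tau>: "\<tau> \<in> {0..1}" and x: "x \<in> K" by auto
    obtain d where d: "d > 0" "\<And>y. y \<in> K \<Longrightarrow> dist y x < d \<Longrightarrow> dist (w \<tau> y) (w \<tau> x) < e / 2"
      using w[OF \<tau>] x e unfolding continuous_on_iff by (metis half_gt_zero)
    show "\<exists>d>0. \<forall>z'\<in>{0..1} \<times> K. dist z' z < d \<longrightarrow> dist (case z' of (\<tau>, x) \<Rightarrow> w \<tau> x) (case z of (\<tau>, x) \<Rightarrow> w \<tau> x) < e"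
    proof (intro exI[of _ "min d (e / (2 * B))"] conjI ballI impI)
      show "0 < min d (e / (2 * B))" using d e B1 by simp
      fix z' assume z': "z' \<in> {0..1} \<times> K" and dz: "dist z' z < min d (e / (2 * B))"
      obtain \<sigma> y where zy: "z' = (\<sigma>, y)" by (cases z')
      with z' have \<sigma>: "\<sigma> \<in> {0..1}" and y: "y \<in> K" by auto
      have ds: "dist \<sigma> \<tau> < e / (2 * B)" "dist y x < d"
        using dist_fst_le[of z' z] dist_snd_le[of z' z] dz by (auto simp: zx zy)
      have "dist (w \<sigma> y) (w \<tau> y) \<le> B * dist \<sigma> \<tau>"
        using lip[OF \<sigma> \<tau> y] by (simp add: dist_norm)
      also have "\<dots> \<le> B * (e / (2 * B))"
        using ds B1 by (intro mult_left_mono) auto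
      also have "\<dots> = e / 2" using B1 by simp
      finally have "dist (w \<sigma> y) (w \<tau> x) < e"
        using d(2)[OF y ds(2)] dist_triangle[of "w \<sigma> y" "w \<tau> x" "w \<tau> y"] by linarith
      then show "dist (case z' of (\<tau>, x) \<Rightarrow> w \<tau> x) (case z of (\<tau>, x) \<Rightarrow> w \<tau> x) < e"
        by (simp add: zx zy)
    qed
  qed
qed

lemma vector_derivative_unique_unit_interval:
  fixes f :: "real \<Rightarrow> 'a::real_normed_vector"
  assumes "\<tau> \<in> {0..1}" "(f has_vector_derivative a) (at \<tau> within {0..1})"
    "(f has_vector_derivative b) (at \<tau> within {0..1})"
  shows "a = b"
  using vector_derivative_unique_within_closed_interval[of 0 1 \<tau> f a b] assms by simp

section \<open>The cubic nonlinearity in the Wiener algebra\<close>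

lemma continuous_on_nls_f [continuous_intros]:
  "continuous_on S f \<Longrightarrow> continuous_on S (\<lambda>x. nls_f lam (f x))"
  unfolding nls_f_def by (intro continuous_intros)

lemma nls_f_eq: "nls_f lam z = (- \<i> * of_real lam) * (z * (cnj z * z))"
  unfolding nls_f_def complex_norm_square by (simp add: mult_ac)

text \<open>The nonlinearity is a cubic monomial in u and its conjugate, so the product estimate
  applies twice; conjugation preserves the bound, whence three factors \<open>S\<close>.\<close>

lemma nls_f_wiener:
  assumes "cont_torus u" "wiener_bound u S"
  shows "cont_torus (\<lambda>x. nls_f lam (u x))" "wiener_bound (\<lambda>x. nls_f lam (u x)) (\<bar>lam\<bar> * (S * (S * S)))"
proof -
  note c = cont_torus_cnj[OF assms(1)] and cb = wiener_bound_cnj[OF assms(2)]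
  have m: "cont_torus (\<lambda>x. cnj (u x) * u x)" "wiener_bound (\<lambda>x. cnj (u x) * u x) (S * S)"
    by (rule cont_torus_mult[OF c assms(1)]) (rule wiener_bound_mult[OF c assms(1) cb assms(2)])
  have m2: "cont_torus (\<lambda>x. u x * (cnj (u x) * u x))" "wiener_bound (\<lambda>x. u x * (cnj (u x) * u x)) (S * (S * S))"
    by (rule cont_torus_mult[OF assms(1) m(1)]) (rule wiener_bound_mult[OF assms(1) m(1) assms(2) m(2)])
  show "cont_torus (\<lambda>x. nls_f lam (u x))"
    unfolding nls_f_eq by (rule cont_torus_mult[OF cont_torus_const m2(1)])
  show "wiener_bound (\<lambda>x. nls_f lam (u x)) (\<bar>lam\<bar> * (S * (S * S)))"
    unfolding nls_f_eq using wiener_bound_cmul[OF m2(2), of "- \<i> * of_real lam"] by (simp add: norm_mult)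
qed

lemma continuous_on_fcoeff_param:
  fixes f :: "real \<Rightarrow> real ^ 'd \<Rightarrow> complex"
  assumes "continuous_on ({0..1} \<times> torus_cube) (\<lambda>(\<tau>, x). f \<tau> x)"
  shows "continuous_on {0..1} (\<lambda>\<tau>. fcoeff (f \<tau>) k)"
  unfolding fcoeff_def torus_cube_def
proof (intro continuous_intros integral_continuous_on_param)
  have "continuous_on ({0..1} \<times> torus_cube) (\<lambda>z. (case z of (\<tau>, x) \<Rightarrow> f \<tau> x) * cnj (fmode k (snd z)))"
    by (intro continuous_intros assms)
  then show "continuous_on ({0..1} \<times> cbox (\<chi> i. - pi) (\<chi> i. pi)) (\<lambda>(\<tau>, x). f \<tau> x * cnj (fmode k x))"
    by (simp add: torus_cube_def split_beta)
qed simp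

text \<open>One time step with the functional calculus already removed: coefficients are indexed by
  modes, the energy conditions appear in scalar form, and the value of the exponential is
  represented by the unimodular number \<open>C 1 k\<close>.\<close>

locale nls_step =
  fixes \<epsilon> lam h :: real and w w' :: "real \<Rightarrow> real ^ 'd \<Rightarrow> complex"
    and C C' :: "real \<Rightarrow> int ^ 'd \<Rightarrow> complex" and A A' :: "real \<Rightarrow> real \<Rightarrow> int ^ 'd \<Rightarrow> complex"
    and S B :: real
  assumes w_C1: "\<tau> \<in> {0..1} \<Longrightarrow> C1_fun (w \<tau>)" and w_periodic: "\<tau> \<in> {0..1} \<Longrightarrow> periodic (w \<tau>)"
    and w_wiener: "\<tau> \<in> {0..1} \<Longrightarrow> wiener_bound (w \<tau>) S"
    and w'_cont: "continuous_on ({0..1} \<times> UNIV) (\<lambda>(\<tau>, x). w' \<tau> x)"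
    and w_deriv: "\<tau> \<in> {0..1} \<Longrightarrow> ((\<lambda>\<tau>. w \<tau> x) has_vector_derivative w' \<tau> x) (at \<tau> within {0..1})"
    and C_bound: "\<tau> \<in> {0..1} \<Longrightarrow> cmod (C \<tau> k) \<le> B"
    and A_bound: "\<tau> \<in> {0..1} \<Longrightarrow> \<sigma> \<in> {0..1} \<Longrightarrow> cmod (A \<tau> \<sigma> k) \<le> B"
    and C_deriv: "\<tau> \<in> {0..1} \<Longrightarrow> ((\<lambda>t. C t k) has_vector_derivative C' \<tau> k) (at \<tau> within {0..1})"
    and A_deriv: "\<tau> \<in> {0..1} \<Longrightarrow> \<sigma> \<in> {0..1} \<Longrightarrow>
          ((\<lambda>t. A t \<sigma> k) has_vector_derivative A' \<tau> \<sigma> k) (at \<tau> within {0..1})"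
    and A'_cont: "continuous_on ({0..1} \<times> {0..1}) (\<lambda>(\<tau>, \<sigma>). A' \<tau> \<sigma> k)"
    and A_0: "\<sigma> \<in> {0..1} \<Longrightarrow> A 0 \<sigma> k = 0"
    and C_1: "cmod (C 1 k) = 1"
    and step: "\<tau> \<in> {0..1} \<Longrightarrow> w \<tau> x = fmultiplier (C \<tau>) (w 0) x
          + of_real h * integral {0..1} (\<lambda>\<sigma>. fmultiplier (A \<tau> \<sigma>) (\<lambda>\<xi>. nls_f lam (w \<sigma> \<xi>)) x)"
    and C'_eq: "\<tau> \<in> {0..1} \<Longrightarrow> C' \<tau> k = C 1 k * cnj (A 1 \<tau> k) * (- \<i> * of_real (h * laplace_eigval \<epsilon> k))"
    and A'_eq: "\<tau> \<in> {0..1} \<Longrightarrow> \<sigma> \<in> {0..1} \<Longrightarrow>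
          A' \<tau> \<sigma> k - cnj (A' \<sigma> \<tau> k) = - \<i> * of_real (h * laplace_eigval \<epsilon> k) * (cnj (A 1 \<tau> k) * A 1 \<sigma> k)"
begin

definition F :: "real \<Rightarrow> int ^ 'd \<Rightarrow> complex" where
  "F \<tau> k = fcoeff (\<lambda>x. nls_f lam (w \<tau> x)) k"

lemma w_torus: "\<tau> \<in> {0..1} \<Longrightarrow> cont_torus (w \<tau>)"
  by (intro cont_torus_C1 w_C1 w_periodic)

text \<open>Periodicity of \<open>w'\<close> is not assumed; it passes from the stages to their
  derivative because derivatives on the unit interval are unique.\<close>

lemma w'_torus:
  assumes \<tau>: "\<tau> \<in> {0..1}"
  shows "cont_torus (w' \<tau>)"
proof -
  have "w' \<tau> (x + (2 * pi) *\<^sub>R axis i 1) = w' \<tau> x" for x i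
  proof -
    have "((\<lambda>\<tau>. w \<tau> x) has_vector_derivative w' \<tau> (x + (2 * pi) *\<^sub>R axis i 1)) (at \<tau> within {0..1})"
      by (rule has_vector_derivative_transform[OF \<tau> _ w_deriv[OF \<tau>, of "x + (2 * pi) *\<^sub>R axis i 1"]])
         (use w_periodic in \<open>simp add: periodic_def\<close>)
    then show ?thesis
      using vector_derivative_unique_unit_interval[OF \<tau>] w_deriv[OF \<tau>, of x] by blast
  qed
  then show ?thesis
    using continuous_on_slices(1)[OF w'_cont \<tau>] by (simp add: cont_torus_def periodic_def)
qed

lemma w'_cont_cube: "continuous_on ({0..1} \<times> torus_cube) (\<lambda>(\<tau>, x). w' \<tau> x)"
  by (rule continuous_on_subset[OF w'_cont]) auto

lemma w_cont: "continuous_on ({0..1} \<times> torus_cube) (\<lambda>(\<tau>, x). w \<tau> x)"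
  by (rule continuous_on_vector_derivative_param[OF compact_torus_cube _ w'_cont_cube w_deriv])
     (auto intro: cont_torusD(1)[OF w_torus])

lemma f_cont: "continuous_on ({0..1} \<times> torus_cube) (\<lambda>(\<tau>, x). nls_f lam (w \<tau> x))"
  using continuous_on_nls_f[OF w_cont, of lam] by (simp add: split_beta)

lemma F_cont: "continuous_on {0..1} (\<lambda>\<tau>. F \<tau> k)"
  unfolding F_def by (rule continuous_on_fcoeff_param[OF f_cont])

lemma F_bound: "\<tau> \<in> {0..1} \<Longrightarrow> finite K \<Longrightarrow> (\<Sum>k\<in>K. cmod (F \<tau> k)) \<le> \<bar>lam\<bar> * (S * (S * S))"
  unfolding F_def by (intro wiener_boundD nls_f_wiener w_torus w_wiener)

text \<open>Continuity in the second index is not assumed. Since \<open>A\<close> vanishes at \<tau>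
  = 0, it is the integral of the jointly continuous \<open>A'\<close> in the first index, hence
  continuous in the second.\<close>

lemma A_cont:
  assumes \<tau>: "\<tau> \<in> {0..1}"
  shows "continuous_on {0..1} (\<lambda>\<sigma>. A \<tau> \<sigma> k)"
proof -
  have eq: "integral (cbox 0 \<tau>) (\<lambda>r. A' r \<sigma> k) = A \<tau> \<sigma> k" if "\<sigma> \<in> {0..1}" for \<sigma>
  proof -
    have "((\<lambda>r. A' r \<sigma> k) has_integral (A \<tau> \<sigma> k - A 0 \<sigma> k)) {0..\<tau>}"
      using \<tau> by (intro fundamental_theorem_of_calculus has_vector_derivative_within_subset[OF A_deriv[OF _ that]]) auto
    then show ?thesis using A_0[OF that] by (simp add: integral_unique)
  qed
  have "continuous_on {0..1} (\<lambda>\<sigma>. integral (cbox 0 \<tau>) (\<lambda>r. A' r \<sigma> k))"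
    by (rule integral_continuous_on_param, rule continuous_on_subset[OF continuous_on_slices(3)[OF A'_cont[of k]]])
       (use \<tau> in auto)
  then show ?thesis by (rule continuous_on_eq) (rule eq)
qed

lemma AF_cont: "\<tau> \<in> {0..1} \<Longrightarrow> continuous_on {0..1} (\<lambda>\<sigma>. A \<tau> \<sigma> k * F \<sigma> k)"
  by (intro continuous_intros A_cont F_cont)

text \<open>Both terms of the scheme are absolutely convergent series in the modes, the second after
  exchanging the sum with the integral in \<sigma>. Their sum represents the stage, and its
  coefficients are the stated ones.\<close>

lemma fcoeff_w:
  assumes \<tau>: "\<tau> \<in> {0..1}"
  shows "fcoeff (w \<tau>) k = C \<tau> k * fcoeff (w 0) k + of_real h * integral {0..1} (\<lambda>\<sigma>. A \<tau> \<sigma> k * F \<sigma> k)"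
proof -
  define L where "L = \<bar>lam\<bar> * (S * (S * S))"
  define b where "b k = integral {0..1} (\<lambda>\<sigma>. A \<tau> \<sigma> k * F \<sigma> k)" for k
  have "B \<ge> 0" using C_bound[OF \<tau>, of undefined] norm_ge_zero order_trans by blast
  have AF: "(\<Sum>k\<in>K. cmod (A \<tau> \<sigma> k * F \<sigma> k)) \<le> B * L" if "\<sigma> \<in> {0..1}" "finite K" for \<sigma> K
  proof -
    have "(\<Sum>k\<in>K. cmod (A \<tau> \<sigma> k * F \<sigma> k)) \<le> B * (\<Sum>k\<in>K. cmod (F \<sigma> k))"
      unfolding sum_distrib_left norm_mult by (intro sum_mono mult_right_mono A_bound \<tau> that) simp
    also have "\<dots> \<le> B * L"
      unfolding L_def by (intro mult_left_mono F_bound that \<open>B \<ge> 0\<close>)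
    finally show ?thesis .
  qed
  have b_bound: "(\<Sum>k\<in>K. cmod (b k)) \<le> B * L" for K
    using infsum_integral(2)[of 0 1 "\<lambda>k \<sigma>. A \<tau> \<sigma> k * F \<sigma> k" "B * L" K] AF_cont[OF \<tau>] AF
    by (simp add: b_def)
  have bs: "((\<lambda>k. b k * fmode k x) has_sum integral {0..1} (\<lambda>\<sigma>. fmultiplier (A \<tau> \<sigma>) (\<lambda>\<xi>. nls_f lam (w \<sigma> \<xi>)) x)) UNIV" for x
  proof -
    have "((\<lambda>k. integral (cbox 0 1) (\<lambda>\<sigma>. A \<tau> \<sigma> k * F \<sigma> k * fmode k x)) has_sum
        integral (cbox 0 1) (\<lambda>\<sigma>. \<Sum>\<^sub>\<infinity>k. A \<tau> \<sigma> k * F \<sigma> k * fmode k x)) UNIV"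
    proof (rule infsum_integral(3))
      show "continuous_on (cbox 0 1) (\<lambda>\<sigma>. A \<tau> \<sigma> k * F \<sigma> k * fmode k x)" for k
        using AF_cont[OF \<tau>] by (intro continuous_on_mult_right) simp
      show "(\<Sum>k\<in>K. cmod (A \<tau> \<sigma> k * F \<sigma> k * fmode k x)) \<le> B * L" if "\<sigma> \<in> cbox 0 1" "finite K" for \<sigma> K
        using AF[of \<sigma> K] that by (simp add: norm_mult)
    qed
    then show ?thesis by (simp add: b_def fmultiplier_def F_def)
  qed
  have W: "((\<lambda>k. C \<tau> k * fcoeff (w 0) k * fmode k x) has_sum fmultiplier (C \<tau>) (w 0) x) UNIV"
    and CW: "\<And>K. finite K \<Longrightarrow> (\<Sum>k\<in>K. cmod (C \<tau> k * fcoeff (w 0) k)) \<le> B * S" for x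
  proof -
    show le: "(\<Sum>k\<in>K. cmod (C \<tau> k * fcoeff (w 0) k)) \<le> B * S" if "finite K" for K
    proof -
      have "(\<Sum>k\<in>K. cmod (C \<tau> k * fcoeff (w 0) k)) \<le> B * (\<Sum>k\<in>K. cmod (fcoeff (w 0) k))"
        unfolding sum_distrib_left norm_mult by (intro sum_mono mult_right_mono C_bound \<tau>) simp
      also have "\<dots> \<le> B * S"
        by (intro mult_left_mono wiener_boundD[OF w_wiener] that \<open>B \<ge> 0\<close>) simp
      finally show ?thesis .
    qed
    have "(\<Sum>k\<in>K. cmod (C \<tau> k * fcoeff (w 0) k * fmode k x)) \<le> B * S" if "finite K" for K
      using le[OF that] by (simp add: norm_mult)
    from abs_summable_summable[OF abs_summable_onI[of "\<lambda>k. C \<tau> k * fcoeff (w 0) k * fmode k x", OF this]]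
    show "((\<lambda>k. C \<tau> k * fcoeff (w 0) k * fmode k x) has_sum fmultiplier (C \<tau>) (w 0) x) UNIV"
      unfolding fmultiplier_def by (rule has_sum_infsum)
  qed
  define a where "a k = C \<tau> k * fcoeff (w 0) k + of_real h * b k" for k
  have "(\<Sum>k\<in>K. cmod (a k)) \<le> B * S + \<bar>h\<bar> * (B * L)" if "finite K" for K
  proof -
    have "(\<Sum>k\<in>K. cmod (a k)) \<le> (\<Sum>k\<in>K. cmod (C \<tau> k * fcoeff (w 0) k) + \<bar>h\<bar> * cmod (b k))"
      unfolding a_def by (intro sum_mono order_trans[OF norm_triangle_ineq]) (simp add: norm_mult)
    also have "\<dots> \<le> B * S + \<bar>h\<bar> * (B * L)"
      unfolding sum.distrib sum_distrib_left[symmetric]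
      by (intro add_mono mult_left_mono b_bound CW that) simp
    finally show ?thesis .
  qed
  from fcoeff_fourier_series[of a, OF this]
  have "fcoeff (\<lambda>x. \<Sum>\<^sub>\<infinity>k. a k * fmode k x) k = a k" .
  moreover have "w \<tau> = (\<lambda>x. \<Sum>\<^sub>\<infinity>k. a k * fmode k x)"
  proof
    fix x
    have "((\<lambda>k. C \<tau> k * fcoeff (w 0) k * fmode k x + of_real h * (b k * fmode k x)) has_sum w \<tau> x) UNIV"
      unfolding step[OF \<tau>] by (intro has_sum_add has_sum_cmult_right W bs)
    moreover have "C \<tau> k * fcoeff (w 0) k * fmode k x + of_real h * (b k * fmode k x) = a k * fmode k x" for k
      by (simp add: a_def algebra_simps)
    ultimately show "w \<tau> x = (\<Sum>\<^sub>\<infinity>k. a k * fmode k x)"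
      using infsumI by (metis (no_types, lifting) infsum_cong)
  qed
  ultimately show ?thesis by (simp add: a_def b_def)
qed

text \<open>The coefficient of the stage is differentiated twice over: under the integral over the
  torus, and in its representation by the scheme under the integral in \<sigma>. The two results
  agree.\<close>

lemma fcoeff_w':
  assumes \<tau>: "\<tau> \<in> {0..1}"
  shows "fcoeff (w' \<tau>) k = C' \<tau> k * fcoeff (w 0) k + of_real h * integral {0..1} (\<lambda>\<sigma>. A' \<tau> \<sigma> k * F \<sigma> k)"
proof -
  have 1: "((\<lambda>\<tau>. fcoeff (w \<tau>) k) has_vector_derivative fcoeff (w' \<tau>) k) (at \<tau> within {0..1})"
    unfolding fcoeff_def divide_inverse torus_cube_def
  proof (rule has_vector_derivative_mult_left, rule leibniz_rule_vector_derivative)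
    show "((\<lambda>\<tau>. w \<tau> x * cnj (fmode k x)) has_vector_derivative w' t x * cnj (fmode k x)) (at t within {0..1})"
      if "t \<in> {0..1}" for t x
      by (intro has_vector_derivative_mult_left w_deriv that)
    show "(\<lambda>x. w t x * cnj (fmode k x)) integrable_on cbox (\<chi> i. - pi) (\<chi> i. pi)" if "t \<in> {0..1}" for t
      by (intro integrable_continuous continuous_intros cont_torusD(1)[OF w_torus] that)
    have "continuous_on ({0..1} \<times> torus_cube) (\<lambda>z. (case z of (\<tau>, x) \<Rightarrow> w' \<tau> x) * cnj (fmode k (snd z)))"
      by (intro continuous_intros w'_cont_cube)
    then show "continuous_on ({0..1} \<times> cbox (\<chi> i. - pi) (\<chi> i. pi)) (\<lambda>(\<tau>, x). w' \<tau> x * cnj (fmode k x))"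
      by (simp add: torus_cube_def split_beta)
  qed (use \<tau> in auto)
  have "((\<lambda>\<tau>. integral (cbox 0 1) (\<lambda>\<sigma>. A \<tau> \<sigma> k * F \<sigma> k)) has_vector_derivative
      integral (cbox 0 1) (\<lambda>\<sigma>. A' \<tau> \<sigma> k * F \<sigma> k)) (at \<tau> within {0..1})"
  proof (rule leibniz_rule_vector_derivative)
    show "((\<lambda>\<tau>. A \<tau> \<sigma> k * F \<sigma> k) has_vector_derivative A' t \<sigma> k * F \<sigma> k) (at t within {0..1})"
      if "t \<in> {0..1}" "\<sigma> \<in> cbox 0 1" for t \<sigma>
      using that by (intro has_vector_derivative_mult_left A_deriv) auto
    show "(\<lambda>\<sigma>. A t \<sigma> k * F \<sigma> k) integrable_on cbox 0 1" if "t \<in> {0..1}" for t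
      using AF_cont[OF that] by (intro integrable_continuous) simp
    have "continuous_on ({0..1} \<times> {0..1}) (\<lambda>z. (case z of (\<tau>, \<sigma>) \<Rightarrow> A' \<tau> \<sigma> k) * F (snd z) k)"
      by (intro continuous_intros A'_cont continuous_on_compose2[OF F_cont]) auto
    then show "continuous_on ({0..1} \<times> cbox 0 1) (\<lambda>(\<tau>, \<sigma>). A' \<tau> \<sigma> k * F \<sigma> k)"
      by (simp add: split_beta)
  qed (use \<tau> in auto)
  then have 2: "((\<lambda>\<tau>. C \<tau> k * fcoeff (w 0) k + of_real h * integral {0..1} (\<lambda>\<sigma>. A \<tau> \<sigma> k * F \<sigma> k)) has_vector_derivative
     C' \<tau> k * fcoeff (w 0) k + of_real h * integral {0..1} (\<lambda>\<sigma>. A' \<tau> \<sigma> k * F \<sigma> k)) (at \<tau> within {0..1})"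
    by (intro has_vector_derivative_add has_vector_derivative_mult_left has_vector_derivative_mult_right C_deriv \<tau>) simp
  have 3: "((\<lambda>\<tau>. fcoeff (w \<tau>) k) has_vector_derivative
     C' \<tau> k * fcoeff (w 0) k + of_real h * integral {0..1} (\<lambda>\<sigma>. A' \<tau> \<sigma> k * F \<sigma> k)) (at \<tau> within {0..1})"
    by (rule has_vector_derivative_transform[OF \<tau> fcoeff_w 2])
  show ?thesis
    by (rule vector_derivative_unique_unit_interval[OF \<tau> 1 3])
qed

text \<open>The share of mode k in the \<tau>-derivative of the quartic energy.\<close>

definition G :: "int ^ 'd \<Rightarrow> real \<Rightarrow> real" where
  "G k \<tau> = Re (fcoeff (w' \<tau>) k * cnj (\<i> * F \<tau> k))"

lemma mode_identity:
  "laplace_eigval \<epsilon> k / 2 * (cmod (fcoeff (w 1) k))\<^sup>2 + integral {0..1} (G k)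
     = laplace_eigval \<epsilon> k / 2 * (cmod (fcoeff (w 0) k))\<^sup>2"
proof -
  have "integral {0..1} (G k) = integral {0..1} (\<lambda>\<tau>. Re ((C 1 k * cnj (A 1 \<tau> k) * (- \<i> * of_real (h * laplace_eigval \<epsilon> k)) * fcoeff (w 0) k
            + of_real h * integral {0..1} (\<lambda>\<sigma>. A' \<tau> \<sigma> k * F \<sigma> k)) * cnj (\<i> * F \<tau> k)))"
    by (intro integral_cong) (simp only: G_def fcoeff_w' C'_eq)
  moreover have "fcoeff (w 1) k = C 1 k * fcoeff (w 0) k + of_real h * integral {0..1} (\<lambda>\<sigma>. A 1 \<sigma> k * F \<sigma> k)"
    by (rule fcoeff_w) simp
  ultimately show ?thesis
    using mode_balance[of "\<lambda>\<tau>. F \<tau> k" "\<lambda>\<sigma>. A 1 \<sigma> k" "\<lambda>\<tau> \<sigma>. A' \<tau> \<sigma> k" "C 1 k" h "laplace_eigval \<epsilon> k" "fcoeff (w 0) k",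
        OF F_cont A_cont A'_cont C_1 A'_eq]
    by (simp only: atLeastAtMost_iff zero_le_one order_refl simp_thms)
qed

lemma G_cont: "continuous_on {0..1} (G k)"
  unfolding G_def[abs_def]
  by (intro continuous_intros F_cont continuous_on_fcoeff_param[OF w'_cont_cube])

text \<open>Each product of coefficients is at most the sum of their squares, and Bessel's
  inequality bounds both sums of squares by suprema over a compact set. Thus continuity of
  \<open>w'\<close> suffices, without summability of its coefficients.\<close>

lemma G_bound: "\<exists>D. \<forall>\<tau>\<in>{0..1}. \<forall>K. (\<Sum>k\<in>K. norm (G k \<tau>)) \<le> D"
proof -
  have "bounded ((\<lambda>(\<tau>, x). w' \<tau> x) ` ({0..1} \<times> torus_cube))"
    "bounded ((\<lambda>(\<tau>, x). nls_f lam (w \<tau> x)) ` ({0..1} \<times> torus_cube))"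
    by (intro compact_imp_bounded compact_continuous_image w'_cont_cube f_cont compact_Times compact_torus_cube; simp)+
  then obtain D1 D2 where
    D1: "\<And>\<tau> x. \<tau> \<in> {0..1} \<Longrightarrow> x \<in> torus_cube \<Longrightarrow> cmod (w' \<tau> x) \<le> D1" and
    D2: "\<And>\<tau> x. \<tau> \<in> {0..1} \<Longrightarrow> x \<in> torus_cube \<Longrightarrow> cmod (nls_f lam (w \<tau> x)) \<le> D2"
    unfolding bounded_iff by fastforce
  have "(\<Sum>k\<in>K. norm (G k \<tau>)) \<le> D1\<^sup>2 + D2\<^sup>2" if \<tau>: "\<tau> \<in> {0..1}" for \<tau> K
  proof -
    have "norm (G k \<tau>) \<le> (cmod (fcoeff (w' \<tau>) k))\<^sup>2 + (cmod (F \<tau> k))\<^sup>2" for k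
    proof -
      have "norm (G k \<tau>) \<le> cmod (fcoeff (w' \<tau>) k) * cmod (F \<tau> k)"
        unfolding G_def real_norm_def
        by (rule order_trans[OF abs_Re_le_cmod]) (simp add: norm_mult)
      also have "\<dots> \<le> (cmod (fcoeff (w' \<tau>) k))\<^sup>2 + (cmod (F \<tau> k))\<^sup>2"
      proof -
        have "0 \<le> cmod (fcoeff (w' \<tau>) k) * cmod (F \<tau> k)" by simp
        then show ?thesis
          using sum_squares_bound[of "cmod (fcoeff (w' \<tau>) k)" "cmod (F \<tau> k)"] by linarith
      qed
      finally show ?thesis .
    qed
    then have "(\<Sum>k\<in>K. norm (G k \<tau>)) \<le> (\<Sum>k\<in>K. (cmod (fcoeff (w' \<tau>) k))\<^sup>2) + (\<Sum>k\<in>K. (cmod (F \<tau> k))\<^sup>2)"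
      unfolding sum.distrib[symmetric] by (rule sum_mono)
    also have "\<dots> \<le> torus_norm2 (w' \<tau>) + torus_norm2 (\<lambda>x. nls_f lam (w \<tau> x))"
      unfolding F_def
      by (intro add_mono bessel continuous_intros cont_torusD(1)[OF w'_torus] cont_torusD(1)[OF w_torus] \<tau>)
    also have "\<dots> \<le> D1\<^sup>2 + D2\<^sup>2"
      by (intro add_mono torus_norm2_le continuous_intros cont_torusD(1)[OF w'_torus] cont_torusD(1)[OF w_torus] \<tau> D1 D2)
    finally show ?thesis .
  qed
  then show ?thesis by blast
qed

text \<open>The factor \<open>\<i>\<close> turns the nonlinearity into a gradient:
  \<open>\<i> * nls_f lam z\<close> is \<open>lam * (cmod z)\<^sup>2 * z\<close>, the gradient of
  \<open>lam / 4 * (cmod z) ^ 4\<close> for the real inner product.\<close>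

lemma quartic_deriv:
  assumes \<tau>: "\<tau> \<in> {0..1}"
  shows "((\<lambda>\<tau>. lam / 4 * torus_norm4 (w \<tau>)) has_vector_derivative
      Re (torus_ip (w' \<tau>) (\<lambda>x. \<i> * nls_f lam (w \<tau> x)))) (at \<tau> within {0..1})"
proof -
  define q where "q \<tau> x = 4 * (cmod (w \<tau> x))\<^sup>2 * Re (w' \<tau> x * cnj (w \<tau> x))" for \<tau> x
  have aux: "((\<lambda>\<tau>. ((r \<tau>)\<^sup>2 + (s \<tau>)\<^sup>2)\<^sup>2) has_real_derivative 4 * ((r t)\<^sup>2 + (s t)\<^sup>2) * (r t * r' + s t * s')) (at t within T)"
    if "(r has_real_derivative r') (at t within T)" "(s has_real_derivative s') (at t within T)" for r s :: "real \<Rightarrow> real" and r' s' t T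
    using that by (auto intro!: derivative_eq_intros simp: algebra_simps)
  have eq4: "(cmod z) ^ 4 = ((Re z)\<^sup>2 + (Im z)\<^sup>2)\<^sup>2" for z
    by (simp add: cmod_power2[symmetric])
  have d: "((\<lambda>\<tau>. integral torus_cube (\<lambda>x. (cmod (w \<tau> x)) ^ 4)) has_vector_derivative integral torus_cube (q \<tau>)) (at \<tau> within {0..1})"
    unfolding torus_cube_def
  proof (rule leibniz_rule_vector_derivative)
    show "((\<lambda>\<tau>. (cmod (w \<tau> x)) ^ 4) has_vector_derivative q t x) (at t within {0..1})" if t: "t \<in> {0..1}" for t x
    proof -
      have "((\<lambda>\<tau>. Re (w \<tau> x)) has_real_derivative Re (w' t x)) (at t within {0..1})"
        "((\<lambda>\<tau>. Im (w \<tau> x)) has_real_derivative Im (w' t x)) (at t within {0..1})"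
        unfolding has_real_derivative_iff_has_vector_derivative
        by (rule bounded_linear.has_vector_derivative[OF bounded_linear_Re w_deriv[OF t]]
            bounded_linear.has_vector_derivative[OF bounded_linear_Im w_deriv[OF t]])+
      then have "((\<lambda>\<tau>. ((Re (w \<tau> x))\<^sup>2 + (Im (w \<tau> x))\<^sup>2)\<^sup>2) has_real_derivative
          4 * ((Re (w t x))\<^sup>2 + (Im (w t x))\<^sup>2) * (Re (w t x) * Re (w' t x) + Im (w t x) * Im (w' t x))) (at t within {0..1})"
        by (rule aux)
      moreover have "4 * ((Re (w t x))\<^sup>2 + (Im (w t x))\<^sup>2) * (Re (w t x) * Re (w' t x) + Im (w t x) * Im (w' t x)) = q t x"
        by (simp add: q_def cmod_power2 mult.commute)
      ultimately have "((\<lambda>\<tau>. ((Re (w \<tau> x))\<^sup>2 + (Im (w \<tau> x))\<^sup>2)\<^sup>2) has_real_derivative q t x) (at t within {0..1})"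
        by simp
      then show ?thesis
        unfolding eq4 has_real_derivative_iff_has_vector_derivative .
    qed
    show "(\<lambda>x. (cmod (w t x)) ^ 4) integrable_on cbox (\<chi> i. - pi) (\<chi> i. pi)" if "t \<in> {0..1}" for t
      by (intro integrable_continuous continuous_intros cont_torusD(1)[OF w_torus] that)
    have "continuous_on ({0..1} \<times> torus_cube)
      (\<lambda>z. 4 * (cmod (case z of (\<tau>, x) \<Rightarrow> w \<tau> x))\<^sup>2 * Re ((case z of (\<tau>, x) \<Rightarrow> w' \<tau> x) * cnj (case z of (\<tau>, x) \<Rightarrow> w \<tau> x)))"
      by (intro continuous_intros w'_cont_cube w_cont)
    then show "continuous_on ({0..1} \<times> cbox (\<chi> i. - pi) (\<chi> i. pi)) (\<lambda>(\<tau>, x). q \<tau> x)"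
      by (simp add: torus_cube_def split_beta q_def)
  qed (use \<tau> in auto)
  have c: "continuous_on torus_cube (w \<tau>)" "continuous_on torus_cube (w' \<tau>)"
    by (rule cont_torusD(1)[OF w_torus[OF \<tau>]] cont_torusD(1)[OF w'_torus[OF \<tau>]])+
  have "lam / 4 * q \<tau> x = Re (w' \<tau> x * cnj (\<i> * nls_f lam (w \<tau> x)))" for x
    by (simp add: q_def nls_f_def algebra_simps)
  then have "lam / 4 * integral torus_cube (q \<tau>) = integral torus_cube (\<lambda>x. Re (w' \<tau> x * cnj (\<i> * nls_f lam (w \<tau> x))))"
    by (simp only: integral_mult_right[symmetric])
  also have "\<dots> = Re (integral torus_cube (\<lambda>x. w' \<tau> x * cnj (\<i> * nls_f lam (w \<tau> x))))"
    using integral_linear[OF integrable_torus_ip bounded_linear_Re, of "w' \<tau>" "\<lambda>x. \<i> * nls_f lam (w \<tau> x)"] c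
    by (simp only: o_def continuous_on_nls_f continuous_on_mult_left)
  finally have "lam / 4 * (integral torus_cube (q \<tau>) / (2 * pi) ^ CARD('d)) = Re (torus_ip (w' \<tau>) (\<lambda>x. \<i> * nls_f lam (w \<tau> x)))"
    unfolding torus_ip_def Re_divide_of_real by simp
  moreover have "((\<lambda>\<tau>. lam / 4 * torus_norm4 (w \<tau>)) has_vector_derivative lam / 4 * (integral torus_cube (q \<tau>) / (2 * pi) ^ CARD('d))) (at \<tau> within {0..1})"
    unfolding torus_norm4_def divide_inverse
    by (intro has_vector_derivative_mult_right has_vector_derivative_mult_left d[unfolded divide_inverse])
  ultimately show ?thesis by simp
qed

lemma G_has_sum:
  assumes \<tau>: "\<tau> \<in> {0..1}"
  shows "((\<lambda>k. G k \<tau>) has_sum Re (torus_ip (w' \<tau>) (\<lambda>x. \<i> * nls_f lam (w \<tau> x)))) UNIV"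
proof -
  have c: "cont_torus (\<lambda>x. \<i> * nls_f lam (w \<tau> x))"
    by (rule cont_torus_mult[OF cont_torus_const nls_f_wiener(1)[OF w_torus w_wiener]]) (rule \<tau>)+
  have "fcoeff (\<lambda>x. \<i> * nls_f lam (w \<tau> x)) k = \<i> * F \<tau> k" for k
    unfolding F_def fcoeff_eq_ip by (rule torus_ip_cmul_left)
  with parseval_Re[OF w'_torus[OF \<tau>] c] show ?thesis by (simp only: G_def)
qed

text \<open>The integrals of \<open>G k\<close> are summed over the modes in two ways. By
  interchange they give the increment of the quartic part; by \<open>mode_identity\<close> each is a
  kinetic decrement, and these add up to the loss of kinetic energy. Uniqueness of the sum equates
  the two.\<close>

theorem energy_preserved: "energy \<epsilon> lam (w 1) = energy \<epsilon> lam (w 0)"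
proof -
  obtain D where D: "\<And>\<tau> K. \<tau> \<in> {0..1} \<Longrightarrow> (\<Sum>k\<in>K. norm (G k \<tau>)) \<le> D"
    using G_bound by blast
  have "((\<lambda>\<tau>. Re (torus_ip (w' \<tau>) (\<lambda>x. \<i> * nls_f lam (w \<tau> x)))) has_integral
      lam / 4 * torus_norm4 (w 1) - lam / 4 * torus_norm4 (w 0)) {0..1}"
    by (rule fundamental_theorem_of_calculus[OF _ quartic_deriv]) auto
  moreover have "integral {0..1} (\<lambda>\<tau>. \<Sum>\<^sub>\<infinity>k. G k \<tau>)
      = integral {0..1} (\<lambda>\<tau>. Re (torus_ip (w' \<tau>) (\<lambda>x. \<i> * nls_f lam (w \<tau> x))))"
    by (intro integral_cong infsumI G_has_sum)
  ultimately have Q: "lam / 4 * torus_norm4 (w 1) - lam / 4 * torus_norm4 (w 0)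
      = integral {0..1} (\<lambda>\<tau>. \<Sum>\<^sub>\<infinity>k. G k \<tau>)"
    by (simp only: integral_unique)
  have "((\<lambda>k. integral {0..1} (G k)) has_sum (lam / 4 * torus_norm4 (w 1) - lam / 4 * torus_norm4 (w 0))) UNIV"
    unfolding Q using infsum_integral(3)[of 0 1 G D] G_cont D by simp
  moreover have "integral {0..1} (G k) = laplace_eigval \<epsilon> k / 2 * (cmod (fcoeff (w 0) k))\<^sup>2
      - laplace_eigval \<epsilon> k / 2 * (cmod (fcoeff (w 1) k))\<^sup>2" for k
    using mode_identity[of k] by linarith
  moreover have "((\<lambda>k. laplace_eigval \<epsilon> k / 2 * (cmod (fcoeff (w 0) k))\<^sup>2 - laplace_eigval \<epsilon> k / 2 * (cmod (fcoeff (w 1) k))\<^sup>2)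
      has_sum ((energy \<epsilon> lam (w 0) - lam / 4 * torus_norm4 (w 0)) - (energy \<epsilon> lam (w 1) - lam / 4 * torus_norm4 (w 1)))) UNIV"
    by (intro has_sum_minus energy_fourier w_C1 w_periodic) auto
  ultimately have "lam / 4 * torus_norm4 (w 1) - lam / 4 * torus_norm4 (w 0)
     = (energy \<epsilon> lam (w 0) - lam / 4 * torus_norm4 (w 0)) - (energy \<epsilon> lam (w 1) - lam / 4 * torus_norm4 (w 1))"
    using has_sum_unique by (simp only:) blast
  then show ?thesis by linarith
qed

end

section \<open>The energy conditions in Fourier space\<close>

lemma acts_as_sum_eq_0:
  assumes "acts_as T m" "acts_as T' m'"
    and "\<And>y x. y \<in> real_trig_polys \<Longrightarrow> T y x + T' y x = 0"
  shows "m k + m' k = 0"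
  using assms(3)[OF to_real_fmode, of k 0] acts_as_at_0[OF assms(1), of k] acts_as_at_0[OF assms(2), of k]
  by (simp add: complex_eq_iff zero_prod_def)

lemma acts_as_sum3_eq_0:
  assumes "acts_as T m" "acts_as T' m'" "acts_as T'' m''"
    and "\<And>y x. y \<in> real_trig_polys \<Longrightarrow> T y x + T' y x + T'' y x = 0"
  shows "m k + m' k + m'' k = 0"
  using assms(4)[OF to_real_fmode, of k 0] acts_as_at_0[OF assms(1), of k]
    acts_as_at_0[OF assms(2), of k] acts_as_at_0[OF assms(3), of k]
  by (simp add: complex_eq_iff zero_prod_def)

lemma laplace_eigval_eq_0:
  assumes "\<epsilon> \<noteq> 0" "laplace_eigval \<epsilon> k = 0"
  shows "k = 0"
  using assms by (simp add: laplace_eigval_def sum_nonneg_eq_0_iff vec_eq_iff)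

lemma op_M_fmode_0:
  fixes x :: "real ^ 'd"
  shows "op_M \<epsilon> (to_real (fmode 0)) x = 0"
proof -
  have "to_real (fmode 0 :: real ^ 'd \<Rightarrow> complex) \<in> real_trig_polys"
    by (rule to_real_fmode)
  then have "op_M \<epsilon> (to_real (fmode 0 :: real ^ 'd \<Rightarrow> complex)) = fmultiplier_real (\<lambda>k. - of_real (laplace_eigval \<epsilon> k)) (to_real (fmode 0))"
    using acts_as_op_M[where 'd = 'd, of \<epsilon>] by (simp add: acts_as_def)
  then show ?thesis
    by (simp add: fmultiplier_real_def fmultiplier_fmode to_real_def laplace_eigval_def zero_prod_def)
qed

text \<open>For nonzero k the eigenvalue of \<open>M\<close> cancels, and conjugation changes the
  sign of the imaginary number \<mu>. At k = 0 also \<mu> = 0, so the claim is that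
  \<open>C' \<mu>\<close> vanishes, which is the kernel hypothesis on constants.\<close>

lemma mode_condition_C':
  fixes \<epsilon> h :: real and A1 C' :: "complex \<Rightarrow> complex" and k :: "int ^ 'd"
  defines "K \<equiv> (op_K \<epsilon> h :: (real ^ 'd \<Rightarrow> real \<times> real) \<Rightarrow> _)" and "\<mu> \<equiv> mode_eigval (op_V \<epsilon> h) k"
  assumes \<epsilon>: "\<epsilon> \<noteq> 0"
    and cond: "\<And>y x. y \<in> real_trig_polys \<Longrightarrow>
           (L2_adjoint (fun_calc_real K exp) \<circ> op_M \<epsilon> \<circ> fun_calc_real K A1 \<circ> K) y x
             + (L2_adjoint (fun_calc_real K C') \<circ> op_M \<epsilon>) y x = 0"
    and kernel: "\<And>y x. y \<in> real_trig_polys \<Longrightarrow> (\<forall>x. op_M \<epsilon> y x = 0) \<Longrightarrow> fun_calc_real K C' y x = 0"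
  shows "C' \<mu> = exp \<mu> * cnj (A1 \<mu>) * \<mu>"
proof (cases "laplace_eigval \<epsilon> k = 0")
  case True
  then have k: "k = 0" by (rule laplace_eigval_eq_0[OF \<epsilon>])
  have "acts_as (fun_calc_real K C') (\<lambda>k. C' (mode_eigval (op_V \<epsilon> h) k))"
    unfolding K_def by (rule acts_as_fun_calc_real)
  from acts_as_at_0[OF this, of k] kernel[OF to_real_fmode, of k 0] have "C' \<mu> = 0"
    by (simp add: k op_M_fmode_0 \<mu>_def complex_eq_iff zero_prod_def)
  moreover have "\<mu> = 0" using True by (simp add: \<mu>_def mode_eigval_op_V_laplace)
  ultimately show ?thesis by simp
next
  case False
  define a where "a = complex_of_real (laplace_eigval \<epsilon> k)"
  have a: "a \<noteq> 0" using False by (simp add: a_def)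
  have eq: "cnj (exp \<mu>) * - a * A1 \<mu> * \<mu> + cnj (C' \<mu>) * - a = 0"
    using acts_as_sum_eq_0[OF
      acts_as_comp[OF acts_as_comp[OF acts_as_comp[OF acts_as_L2_adjoint[OF acts_as_fun_calc_real] acts_as_op_M]
        acts_as_fun_calc_real] acts_as_op_K]
      acts_as_comp[OF acts_as_L2_adjoint[OF acts_as_fun_calc_real] acts_as_op_M], OF cond[unfolded K_def], of k]
    by (simp only: \<mu>_def a_def)
  have "a * (cnj (exp \<mu>) * A1 \<mu> * \<mu> + cnj (C' \<mu>))
      = - (cnj (exp \<mu>) * - a * A1 \<mu> * \<mu> + cnj (C' \<mu>) * - a)"
    by (simp add: algebra_simps)
  then have "a * (cnj (exp \<mu>) * A1 \<mu> * \<mu> + cnj (C' \<mu>)) = 0"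
    unfolding eq by simp
  then have "cnj (C' \<mu>) = - (cnj (exp \<mu>) * A1 \<mu> * \<mu>)"
    using a by (simp add: eq_neg_iff_add_eq_0 add.commute)
  then have "C' \<mu> = cnj (- (cnj (exp \<mu>) * A1 \<mu> * \<mu>))"
    by (metis complex_cnj_cnj)
  also have "\<dots> = exp \<mu> * cnj (A1 \<mu>) * (- cnj \<mu>)" by simp
  also have "- cnj \<mu> = \<mu>" by (simp add: \<mu>_def mode_eigval_op_V_laplace)
  finally show ?thesis .
qed

text \<open>\<open>A1\<close>, \<open>A2\<close> stand for the final weights at \<tau> and \<sigma>,
  and \<open>A''\<close> for \<open>A'\<close> with exchanged indices. Here the common factor is the
  eigenvalue of \<open>M\<close> times \<mu>, nonzero for nonzero k because h is nonzero. At k = 0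
  the right side vanishes and the kernel hypothesis gives the symmetry.\<close>

lemma mode_condition_A':
  fixes \<epsilon> h :: real and A1 A2 A' A'' :: "complex \<Rightarrow> complex" and k :: "int ^ 'd"
  defines "K \<equiv> (op_K \<epsilon> h :: (real ^ 'd \<Rightarrow> real \<times> real) \<Rightarrow> _)" and "\<mu> \<equiv> mode_eigval (op_V \<epsilon> h) k"
  assumes \<epsilon>: "\<epsilon> \<noteq> 0" and h: "h \<noteq> 0"
    and cond: "\<And>y x. y \<in> real_trig_polys \<Longrightarrow>
           (L2_adjoint K \<circ> L2_adjoint (fun_calc_real K A1) \<circ> op_M \<epsilon> \<circ> fun_calc_real K A2 \<circ> K) y x
             + (op_M \<epsilon> \<circ> fun_calc_real K A' \<circ> K) y x
             + L2_adjoint (op_M \<epsilon> \<circ> fun_calc_real K A'' \<circ> K) y x = 0"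
    and kernel: "\<And>y x. y \<in> real_trig_polys \<Longrightarrow> (\<forall>x. op_M \<epsilon> y x = 0) \<Longrightarrow>
           fun_calc_real K A' y x = L2_adjoint (fun_calc_real K A'') y x"
  shows "A' \<mu> - cnj (A'' \<mu>) = \<mu> * (cnj (A1 \<mu>) * A2 \<mu>)"
proof (cases "laplace_eigval \<epsilon> k = 0")
  case True
  then have k: "k = 0" by (rule laplace_eigval_eq_0[OF \<epsilon>])
  have 1: "acts_as (fun_calc_real K A') (\<lambda>k. A' (mode_eigval (op_V \<epsilon> h) k))"
    unfolding K_def by (rule acts_as_fun_calc_real)
  have 2: "acts_as (L2_adjoint (fun_calc_real K A'')) (\<lambda>k. cnj (A'' (mode_eigval (op_V \<epsilon> h) k)))"
    unfolding K_def by (rule acts_as_L2_adjoint[OF acts_as_fun_calc_real])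
  have "A' \<mu> = cnj (A'' \<mu>)"
    using acts_as_at_0[OF 1, of k] acts_as_at_0[OF 2, of k] kernel[OF to_real_fmode, of k 0]
    by (simp add: k op_M_fmode_0 \<mu>_def complex_eq_iff)
  moreover have "\<mu> = 0" using True by (simp add: \<mu>_def mode_eigval_op_V_laplace)
  ultimately show ?thesis by simp
next
  case False
  define a where "a = complex_of_real (laplace_eigval \<epsilon> k)"
  have a: "a \<noteq> 0" using False by (simp add: a_def)
  have \<mu>: "cnj \<mu> = - \<mu>" "\<mu> \<noteq> 0"
    using False h by (simp_all add: \<mu>_def mode_eigval_op_V_laplace)
  have "cnj \<mu> * cnj (A1 \<mu>) * - a * A2 \<mu> * \<mu> + - a * A' \<mu> * \<mu> + cnj (- a * A'' \<mu> * \<mu>) = 0"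
    using acts_as_sum3_eq_0[OF
      acts_as_comp[OF acts_as_comp[OF acts_as_comp[OF acts_as_comp[OF acts_as_L2_adjoint[OF acts_as_op_K]
        acts_as_L2_adjoint[OF acts_as_fun_calc_real]] acts_as_op_M] acts_as_fun_calc_real] acts_as_op_K]
      acts_as_comp[OF acts_as_comp[OF acts_as_op_M acts_as_fun_calc_real] acts_as_op_K]
      acts_as_L2_adjoint[OF acts_as_comp[OF acts_as_comp[OF acts_as_op_M acts_as_fun_calc_real] acts_as_op_K]],
      OF cond[unfolded K_def], of k]
    by (simp only: \<mu>_def a_def)
  moreover have "cnj a = a" by (simp add: a_def)
  ultimately have "(a * \<mu>) * (\<mu> * (cnj (A1 \<mu>) * A2 \<mu>) - (A' \<mu> - cnj (A'' \<mu>))) = 0"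
    by (simp add: \<mu>(1) algebra_simps)
  then show ?thesis using a \<mu>(2) by simp
qed

theorem theorem1:
  fixes \<epsilon> lam h :: real
    and s :: nat and c :: "nat \<Rightarrow> real"
    and C C' :: "real \<Rightarrow> complex \<Rightarrow> complex"
    and A A' :: "real \<Rightarrow> real \<Rightarrow> complex \<Rightarrow> complex"
    and u0 :: "real ^ 'd \<Rightarrow> complex"
    and u :: "real \<Rightarrow> real ^ 'd \<Rightarrow> complex"
  defines "spec \<equiv> range (mode_eigval (op_V \<epsilon> h :: (real ^ 'd \<Rightarrow> complex) \<Rightarrow> _))"
    and "V \<equiv> (op_V \<epsilon> h :: (real ^ 'd \<Rightarrow> complex) \<Rightarrow> _)"
    and "M \<equiv> (op_M \<epsilon> :: (real ^ 'd \<Rightarrow> real \<times> real) \<Rightarrow> _)"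
    and "K \<equiv> (op_K \<epsilon> h :: (real ^ 'd \<Rightarrow> real \<times> real) \<Rightarrow> _)"
    and "D \<equiv> (real_trig_polys :: (real ^ 'd \<Rightarrow> real \<times> real) set)"
  assumes "\<epsilon> > 0" and "h > 0"
    \<comment> \<open>fitting nodes\<close>
    and "s \<ge> 1" and "c 0 = 0" and "c s = 1" and "\<forall>j\<le>s. c j \<in> {0..1}"
    and "\<forall>j\<le>s. \<forall>v\<in>trig_polys. fun_calc V (C (c j)) v = fun_calc V (\<lambda>z. exp (of_real (c j) * z)) v"
    \<comment> \<open>boundedness and regularity of the coefficient functions\<close>
    and "bounded ((\<lambda>(\<tau>, z). C \<tau> z) ` ({0..1} \<times> spec))"
    and "bounded ((\<lambda>(\<tau>, \<sigma>, z). A \<tau> \<sigma> z) ` ({0..1} \<times> {0..1} \<times> spec))"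
    and "\<forall>z\<in>spec. \<forall>\<tau>\<in>{0..1}.
           ((\<lambda>t. C t z) has_vector_derivative C' \<tau> z) (at \<tau> within {0..1})"
    and "\<forall>z\<in>spec. \<forall>\<tau>\<in>{0..1}. \<forall>\<sigma>\<in>{0..1}.
           ((\<lambda>t. A t \<sigma> z) has_vector_derivative A' \<tau> \<sigma> z) (at \<tau> within {0..1})"
    and "\<forall>z\<in>spec. continuous_on {0..1} (\<lambda>\<tau>. C' \<tau> z)"
    and "\<forall>z\<in>spec. continuous_on ({0..1} \<times> {0..1}) (\<lambda>(\<tau>, \<sigma>). A' \<tau> \<sigma> z)"
    \<comment> \<open>the integrator\<close>
    and "u 0 = u0"
    and "\<forall>n::nat. regular_stages (\<lambda>\<tau>. u (real n + \<tau>))"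
    and "\<forall>n::nat. \<forall>\<tau>\<in>{0..1}. \<forall>x.
           u (real n + \<tau>) x = fun_calc V (C \<tau>) (u (real n)) x
             + of_real h * integral {0..1}
                 (\<lambda>\<sigma>. fun_calc V (A \<tau> \<sigma>) (\<lambda>\<xi>. nls_f lam (u (real n + \<sigma>) \<xi>)) x)"
    \<comment> \<open>the energy conditions\<close>
    and "\<forall>\<sigma>\<in>{0..1}. \<forall>y\<in>D. \<forall>x. fun_calc_real K (A 0 \<sigma>) y x = 0"
    and "\<forall>\<tau>\<in>{0..1}. \<forall>y\<in>D. \<forall>x.
           (L2_adjoint (fun_calc_real K exp) \<circ> M \<circ> fun_calc_real K (A 1 \<tau>) \<circ> K) y x
             + (L2_adjoint (fun_calc_real K (C' \<tau>)) \<circ> M) y x = 0"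
    and "\<forall>\<tau>\<in>{0..1}. \<forall>\<sigma>\<in>{0..1}. \<forall>y\<in>D. \<forall>x.
           (L2_adjoint K \<circ> L2_adjoint (fun_calc_real K (A 1 \<tau>)) \<circ> M
               \<circ> fun_calc_real K (A 1 \<sigma>) \<circ> K) y x
             + (M \<circ> fun_calc_real K (A' \<tau> \<sigma>) \<circ> K) y x
             + L2_adjoint (M \<circ> fun_calc_real K (A' \<sigma> \<tau>) \<circ> K) y x = 0"
    \<comment> \<open>on the kernel of M the last two conditions are void; there they are required in the form
        obtained by cancelling the common factors M and M K\<close>
    and "\<forall>\<tau>\<in>{0..1}. \<forall>y\<in>D. (\<forall>x. M y x = 0) \<longrightarrow> (\<forall>x. fun_calc_real K (C' \<tau>) y x = 0)"
    and "\<forall>\<tau>\<in>{0..1}. \<forall>\<sigma>\<in>{0..1}. \<forall>y\<in>D. (\<forall>x. M y x = 0) \<longrightarrow>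
           (\<forall>x. fun_calc_real K (A' \<tau> \<sigma>) y x = L2_adjoint (fun_calc_real K (A' \<sigma> \<tau>)) y x)"
  shows "\<forall>n::nat. energy \<epsilon> lam (u (real n + 1)) = energy \<epsilon> lam (u (real n))"
proof
  fix n :: nat
  define \<mu> where "\<mu> k = mode_eigval (op_V \<epsilon> h :: (real ^ 'd \<Rightarrow> complex) \<Rightarrow> _) k" for k
  have \<mu>_eq: "\<mu> k = - \<i> * of_real (h * laplace_eigval \<epsilon> k)" for k
    by (simp add: \<mu>_def mode_eigval_op_V_laplace)
  have \<mu>_spec: "\<mu> k \<in> spec" for k
    by (simp add: \<mu>_def spec_def)
  have fc: "fun_calc V \<phi> = fmultiplier (\<lambda>k. \<phi> (\<mu> k))" for \<phi>
    by (simp add: fun_calc_eq_fmultiplier V_def \<mu>_def)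
  \<comment> \<open>The fitting condition at the last node, tested on a single mode.\<close>
  have C1: "C 1 (\<mu> k) = exp (\<mu> k)" for k
  proof -
    have "fun_calc V (C (c s)) (fmode k) = fun_calc V (\<lambda>z. exp (of_real (c s) * z)) (fmode k)"
      using assms(12) trig_polys_fmode[of 1 k] by simp
    from fun_cong[OF this, of 0] show ?thesis
      by (simp add: fc fmultiplier_fmode fmode_nonzero \<open>c s = 1\<close>)
  qed
  obtain B1 where B1: "\<And>\<tau> z. \<tau> \<in> {0..1} \<Longrightarrow> z \<in> spec \<Longrightarrow> cmod (C \<tau> z) \<le> B1"
    using assms(13) unfolding bounded_iff by fastforce
  obtain B2 where B2: "\<And>\<tau> \<sigma> z. \<tau> \<in> {0..1} \<Longrightarrow> \<sigma> \<in> {0..1} \<Longrightarrow> z \<in> spec \<Longrightarrow> cmod (A \<tau> \<sigma> z) \<le> B2"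
    using assms(14) unfolding bounded_iff by fastforce
  have reg: "regular_stages (\<lambda>\<tau>. u (real n + \<tau>))"
    using assms(20) by blast
  obtain S where S: "\<And>\<tau>. \<tau> \<in> {0..1} \<Longrightarrow> (\<lambda>k. cmod (fcoeff (u (real n + \<tau>)) k)) summable_on UNIV"
      "\<And>\<tau>. \<tau> \<in> {0..1} \<Longrightarrow> (\<Sum>\<^sub>\<infinity>k. cmod (fcoeff (u (real n + \<tau>)) k)) \<le> S"
    using reg unfolding regular_stages_def by blast
  have wb: "wiener_bound (u (real n + \<tau>)) S" if "\<tau> \<in> {0..1}" for \<tau>
    unfolding wiener_bound_def
    using finite_sum_le_infsum[OF S(1)[OF that]] S(2)[OF that] by (fastforce intro: order_trans)
  obtain w' where w': "continuous_on ({0..1} \<times> UNIV) (\<lambda>(\<tau>, x). w' \<tau> x)"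
    "\<And>\<tau> x. \<tau> \<in> {0..1} \<Longrightarrow> ((\<lambda>\<tau>. u (real n + \<tau>) x) has_vector_derivative w' \<tau> x) (at \<tau> within {0..1})"
    using reg unfolding regular_stages_def by blast
  \<comment> \<open>The n-th step with its time shifted to the unit interval and the coefficient
    functions sampled at the eigenvalues \<open>\<mu> k\<close>. The maximum merges the separate
    bounds for \<open>C\<close> and \<open>A\<close> into one.\<close>
  interpret nls_step \<epsilon> lam h "\<lambda>\<tau>. u (real n + \<tau>)" w' "\<lambda>\<tau> k. C \<tau> (\<mu> k)" "\<lambda>\<tau> k. C' \<tau> (\<mu> k)"
    "\<lambda>\<tau> \<sigma> k. A \<tau> \<sigma> (\<mu> k)" "\<lambda>\<tau> \<sigma> k. A' \<tau> \<sigma> (\<mu> k)" S "max B1 B2"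
  proof
    fix \<tau> :: real assume \<tau>: "\<tau> \<in> {0..1}"
    show "C1_fun (u (real n + \<tau>))" "periodic (u (real n + \<tau>))"
      using reg \<tau> unfolding regular_stages_def by blast+
    show "wiener_bound (u (real n + \<tau>)) S" by (rule wb[OF \<tau>])
    show "((\<lambda>\<tau>. u (real n + \<tau>) x) has_vector_derivative w' \<tau> x) (at \<tau> within {0..1})" for x
      by (rule w'(2)[OF \<tau>])
    show "cmod (C \<tau> (\<mu> k)) \<le> max B1 B2" for k
      using B1[OF \<tau> \<mu>_spec[of k]] by simp
    show "((\<lambda>t. C t (\<mu> k)) has_vector_derivative C' \<tau> (\<mu> k)) (at \<tau> within {0..1})" for k
      using assms(15) \<mu>_spec \<tau> by blast
    show "u (real n + \<tau>) x = fmultiplier (\<lambda>k. C \<tau> (\<mu> k)) (u (real n + 0)) x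
          + of_real h * integral {0..1} (\<lambda>\<sigma>. fmultiplier (\<lambda>k. A \<tau> \<sigma> (\<mu> k)) (\<lambda>\<xi>. nls_f lam (u (real n + \<sigma>) \<xi>)) x)" for x
      using assms(21) \<tau> by (simp only: fc add_0_right)
    show "C' \<tau> (\<mu> k) = C 1 (\<mu> k) * cnj (A 1 \<tau> (\<mu> k)) * (- \<i> * of_real (h * laplace_eigval \<epsilon> k))" for k
      unfolding C1 \<mu>_eq[symmetric] unfolding \<mu>_def
      by (rule mode_condition_C') (use assms \<tau> in \<open>simp_all add: K_def M_def D_def\<close>)
    fix \<sigma> :: real assume \<sigma>: "\<sigma> \<in> {0..1}"
    show "cmod (A \<tau> \<sigma> (\<mu> k)) \<le> max B1 B2" for k
      using B2[OF \<tau> \<sigma> \<mu>_spec[of k]] by simp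
    show "((\<lambda>t. A t \<sigma> (\<mu> k)) has_vector_derivative A' \<tau> \<sigma> (\<mu> k)) (at \<tau> within {0..1})" for k
      using assms(16) \<mu>_spec \<tau> \<sigma> by blast
    show "A' \<tau> \<sigma> (\<mu> k) - cnj (A' \<sigma> \<tau> (\<mu> k))
        = - \<i> * of_real (h * laplace_eigval \<epsilon> k) * (cnj (A 1 \<tau> (\<mu> k)) * A 1 \<sigma> (\<mu> k))" for k
      unfolding \<mu>_eq[symmetric] unfolding \<mu>_def
      by (rule mode_condition_A') (use assms \<tau> \<sigma> in \<open>simp_all add: K_def M_def D_def\<close>)
  next
    show "continuous_on ({0..1} \<times> UNIV) (\<lambda>(\<tau>, x). w' \<tau> x)" by (rule w'(1))
    show "continuous_on ({0..1} \<times> {0..1}) (\<lambda>(\<tau>, \<sigma>). A' \<tau> \<sigma> (\<mu> k))" for k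
      using assms(18) \<mu>_spec by blast
    show "A 0 \<sigma> (\<mu> k) = 0" if "\<sigma> \<in> {0..1}" for \<sigma> k
    proof -
      have "acts_as (fun_calc_real K (A 0 \<sigma>)) (\<lambda>k. A 0 \<sigma> (\<mu> k))"
        unfolding K_def \<mu>_def by (rule acts_as_fun_calc_real)
      from acts_as_at_0[OF this, of k] show ?thesis
        using assms(22) that to_real_fmode[of k] by (auto simp: D_def complex_eq_iff zero_prod_def)
    qed
    show "cmod (C 1 (\<mu> k)) = 1" for k
      unfolding C1 norm_exp_eq_Re by (simp add: \<mu>_eq)
  qed
  show "energy \<epsilon> lam (u (real n + 1)) = energy \<epsilon> lam (u (real n))"
    using energy_preserved by simp
qed

end
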